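(* Let $m,n\in\mathbb N$, $a(z)\in z^{2m}(1+z^{-1}\mathbb C[[z^{-1}]])$ and $b(z)\in z^{2n}(1+z^{-1}\mathbb C[[z^{-1}]])$. Then the coproduct $\Delta:Y\to Y\otimes Y$ of the Yangian $Y$ of $\mathfrak{sl}_2$ induces an algebra morphism $$Y^{ab}\longrightarrow Y^a\otimes Y^b,$$ i.e. there is an algebra morphism $\overline\Delta:Y^{ab}\to Y^a\otimes Y^b$ with $\overline\Delta\circ\pi_{ab}=(\pi_a\otimes\pi_b)\circ\Delta$, where $\pi_c:Y\to Y^c$ denotes the canonical projection onto the truncated Yangian and $ab$ is the product series $a(z)b(z)$.
   Context: All algebras are associative unital over $\mathbb C$, $\otimes=\otimes_{\mathbb C}$, $\mathbb N=\{0,1,2,\dots\}$, $[x,y]=xy-yx$. The Yangian $Y$ of $\mathfrak{sl}_2$ is the algebra with generators $x^+_n,x^-_n,h_n$ ($n\in\mathbb N$) and relations, for $r,s\in\mathbb N$: $[h_r,h_s]=0$; $[h_0,x^\pm_s]=\pm2x^\pm_s$; $[h_{r+1},x^\pm_s]-[h_r,x^\pm_{s+1}]=\pm(h_rx^\pm_s+x^\pm_sh_r)$; $[x^+_r,x^-_s]=h_{r+s}$; $[x^\pm_{r+1},x^\pm_s]-[x^\pm_r,x^\pm_{s+1}]=\pm(x^\pm_rx^\pm_s+x^\pm_sx^\pm_r)$. Put $h(z)=1+\sum_{n\ge0}h_nz^{-n-1}$ and let $Y^=$ be the (commutative) subalgebra generated by all $h_n$. $Y$ is a Hopf algebra whose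 coproduct is the algebra morphism determined by $\Delta(x^\pm_0)=x^\pm_0\otimes1+1\otimes x^\pm_0$, $\Delta(h_0)=h_0\otimes1+1\otimes h_0$, $\Delta(x^+_1)=x^+_1\otimes1+1\otimes x^+_1+h_0\otimes x^+_0$. For $m\in\mathbb N$ and a complex Laurent series $a(z)$ in $z^{-1}$ with leading term $z^{2m}$, $A^a(z)$ is the unique Laurent series in $z^{-1}$ with leading term $z^m$ and coefficients in $Y^=$ such that $h(z)=\dfrac{a(z)}{A^a(z)A^a(z-1)}$ (expansions in $z^{-1}$). The truncated Yangian $Y^a$ is the quotient of $Y$ by the two-sided ideal generated by the coefficients of all strictly negative powers of $z$ in $A^a(z)$. *)

theory Defs
  imports
    "HOL-Algebra.Algebraic_Closure_Type"
    "HOL-Algebra.QuotRing"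
    "HOL-Algebra.Module"
    "HOL-Library.Poly_Mapping"
    "HOL-Computational_Algebra.Formal_Laurent_Series"
begin

section \<open>Complex algebras: morphisms, quotients, tensor products\<close>

text \<open>
  An associative unital complex algebra is a record of type \<open>(complex, 'a) module\<close>. (The library
  locale \<open>algebra\<close> demands commutativity, so only the record type is used.) Ring homomorphisms in
  HOL-Algebra preserve \<open>\<one>\<close>, and HOL-Algebra ideals are two-sided.
\<close>

definition alg_hom ::
  "(complex, 'a) module \<Rightarrow> (complex, 'b) module \<Rightarrow> ('a \<Rightarrow> 'b) set" where
  "alg_hom A B = {f \<in> ring_hom A B. \<forall>c. \<forall>x\<in>carrier A. f (c \<odot>\<^bsub>A\<^esub> x) = c \<odot>\<^bsub>B\<^esub> f x}"

definition quot_alg ::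
  "(complex, 'a) module \<Rightarrow> 'a set \<Rightarrow> (complex, 'a set) module" where
  "quot_alg A I = ring.extend (A Quot I)
     (module.fields (\<lambda>c S. \<Union>x\<in>S. I +>\<^bsub>A\<^esub> (c \<odot>\<^bsub>A\<^esub> x)))"

abbreviation pm_scale :: "complex \<Rightarrow> ('k \<Rightarrow>\<^sub>0 complex) \<Rightarrow> ('k \<Rightarrow>\<^sub>0 complex)" where
  "pm_scale c \<equiv> Poly_Mapping.map ((*) c)"

text \<open>
  The tensor product of \<open>A\<close> and \<open>B\<close> is the free vector space on \<open>carrier A \<times> carrier B\<close> modulo the
  span of the bilinearity relations; its product is induced by
  \<open>(x, y) (x', y') = (x x', y y')\<close> on basis elements, for which that span is a two-sided ideal.
\<close>

definition pair_alg ::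
  "(complex, 'a) module \<Rightarrow> (complex, 'b) module \<Rightarrow> (complex, ('a \<times> 'b) \<Rightarrow>\<^sub>0 complex) module" where
  "pair_alg A B =
     \<lparr> carrier = {p. Poly_Mapping.keys p \<subseteq> carrier A \<times> carrier B},
       monoid.mult = (\<lambda>p q. \<Sum>(x, y)\<in>Poly_Mapping.keys p. \<Sum>(x', y')\<in>Poly_Mapping.keys q.
                 Poly_Mapping.single (x \<otimes>\<^bsub>A\<^esub> x', y \<otimes>\<^bsub>B\<^esub> y')
                   (Poly_Mapping.lookup p (x, y) * Poly_Mapping.lookup q (x', y'))),
       monoid.one = Poly_Mapping.single (\<one>\<^bsub>A\<^esub>, \<one>\<^bsub>B\<^esub>) 1,
       ring.zero = 0,
       ring.add = (+),
       module.smult = pm_scale \<rparr>"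

inductive_set bilinear_relators ::
  "(complex, 'a) module \<Rightarrow> (complex, 'b) module \<Rightarrow> (('a \<times> 'b) \<Rightarrow>\<^sub>0 complex) set"
  for A :: "(complex, 'a) module" and B :: "(complex, 'b) module" where
  add_left: "\<lbrakk>x \<in> carrier A; x' \<in> carrier A; y \<in> carrier B\<rbrakk> \<Longrightarrow>
    Poly_Mapping.single (x \<oplus>\<^bsub>A\<^esub> x', y) 1 - Poly_Mapping.single (x, y) 1
      - Poly_Mapping.single (x', y) 1 \<in> bilinear_relators A B"
| add_right: "\<lbrakk>x \<in> carrier A; y \<in> carrier B; y' \<in> carrier B\<rbrakk> \<Longrightarrow>
    Poly_Mapping.single (x, y \<oplus>\<^bsub>B\<^esub> y') 1 - Poly_Mapping.single (x, y) 1
      - Poly_Mapping.single (x, y') 1 \<in> bilinear_relators A B"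
| scale_left: "\<lbrakk>x \<in> carrier A; y \<in> carrier B\<rbrakk> \<Longrightarrow>
    Poly_Mapping.single (c \<odot>\<^bsub>A\<^esub> x, y) 1 - Poly_Mapping.single (x, y) c \<in> bilinear_relators A B"
| scale_right: "\<lbrakk>x \<in> carrier A; y \<in> carrier B\<rbrakk> \<Longrightarrow>
    Poly_Mapping.single (x, c \<odot>\<^bsub>B\<^esub> y) 1 - Poly_Mapping.single (x, y) c \<in> bilinear_relators A B"

definition bilinear_span ::
  "(complex, 'a) module \<Rightarrow> (complex, 'b) module \<Rightarrow> (('a \<times> 'b) \<Rightarrow>\<^sub>0 complex) set" where
  "bilinear_span A B = module.span pm_scale (bilinear_relators A B)"

definition tensor_alg ::
  "(complex, 'a) module \<Rightarrow> (complex, 'b) module \<Rightarrow> (complex, (('a \<times> 'b) \<Rightarrow>\<^sub>0 complex) set) module" where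
  "tensor_alg A B = quot_alg (pair_alg A B) (bilinear_span A B)"

definition pure_tensor ::
  "(complex, 'a) module \<Rightarrow> (complex, 'b) module \<Rightarrow> 'a \<Rightarrow> 'b \<Rightarrow> (('a \<times> 'b) \<Rightarrow>\<^sub>0 complex) set" where
  "pure_tensor A B x y = bilinear_span A B +>\<^bsub>pair_alg A B\<^esub> Poly_Mapping.single (x, y) 1"

text \<open>
  For algebra morphisms (or just linear maps) \<open>f : A \<rightarrow> C\<close> and \<open>g : B \<rightarrow> D\<close> this is the map
  \<open>f \<otimes> g\<close> from \<open>tensor_alg A B\<close> to \<open>tensor_alg C D\<close>; the source algebras do not enter, since the
  argument already is a coset of formal combinations of pairs.
\<close>

definition tensor_map ::
  "(complex, 'c) module \<Rightarrow> (complex, 'd) module \<Rightarrow> ('a \<Rightarrow> 'c) \<Rightarrow> ('b \<Rightarrow> 'd) \<Rightarrow>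
    (('a \<times> 'b) \<Rightarrow>\<^sub>0 complex) set \<Rightarrow> (('c \<times> 'd) \<Rightarrow>\<^sub>0 complex) set" where
  "tensor_map C D f g S =
     (\<Union>p\<in>S. bilinear_span C D +>\<^bsub>pair_alg C D\<^esub>
        (\<Sum>(x, y)\<in>Poly_Mapping.keys p.
           Poly_Mapping.single (f x, g y) (Poly_Mapping.lookup p (x, y))))"


section \<open>The Yangian of \<open>sl\<^sub>2\<close>\<close>

text \<open>
  Words form the free monoid, written additively so that \<open>'g word \<Rightarrow>\<^sub>0 complex\<close> carries the monoid
  algebra structure of the library, i.e. is the free algebra on \<open>'g\<close>.
\<close>

datatype 'g word = Word "'g list"

instantiation word :: (type) monoid_add
begin

definition zero_word :: "'a word" where
  "zero_word = Word []"

fun plus_word :: "'a word \<Rightarrow> 'a word \<Rightarrow> 'a word" where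
  "plus_word (Word u) (Word v) = Word (u @ v)"

instance
proof
  fix u v w :: "'a word"
  show "u + v + w = u + (v + w)" by (cases u; cases v; cases w) simp
  show "0 + u = u" by (cases u) (simp add: zero_word_def)
  show "u + 0 = u" by (cases u) (simp add: zero_word_def)
qed

end

datatype gen = XP nat | XM nat | H nat

type_synonym free_alg = "gen word \<Rightarrow>\<^sub>0 complex"

abbreviation (input) fxp :: "nat \<Rightarrow> free_alg" where
  "fxp r \<equiv> Poly_Mapping.single (Word [XP r]) 1"

abbreviation (input) fxm :: "nat \<Rightarrow> free_alg" where
  "fxm r \<equiv> Poly_Mapping.single (Word [XM r]) 1"

abbreviation (input) fh :: "nat \<Rightarrow> free_alg" where
  "fh r \<equiv> Poly_Mapping.single (Word [H r]) 1"

abbreviation commutator :: "'a \<Rightarrow> 'a \<Rightarrow> 'a::ring" where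
  "commutator x y \<equiv> x * y - y * x"

inductive_set yangian_relators :: "free_alg set" where
  "commutator (fh r) (fh s) \<in> yangian_relators"
| "commutator (fh 0) (fxp s) - 2 * fxp s \<in> yangian_relators"
| "commutator (fh 0) (fxm s) + 2 * fxm s \<in> yangian_relators"
| "commutator (fh (r + 1)) (fxp s) - commutator (fh r) (fxp (s + 1))
    - (fh r * fxp s + fxp s * fh r) \<in> yangian_relators"
| "commutator (fh (r + 1)) (fxm s) - commutator (fh r) (fxm (s + 1))
    + (fh r * fxm s + fxm s * fh r) \<in> yangian_relators"
| "commutator (fxp r) (fxm s) - fh (r + s) \<in> yangian_relators"
| "commutator (fxp (r + 1)) (fxp s) - commutator (fxp r) (fxp (s + 1))
    - (fxp r * fxp s + fxp s * fxp r) \<in> yangian_relators"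
| "commutator (fxm (r + 1)) (fxm s) - commutator (fxm r) (fxm (s + 1))
    + (fxm r * fxm s + fxm s * fxm r) \<in> yangian_relators"

definition yangian_ideal :: "free_alg set" where
  "yangian_ideal = Idl\<^bsub>ring_of_type_algebra\<^esub> yangian_relators"

lemma ring_ring_of_type_algebra: "ring (ring_of_type_algebra :: 'a::ring_1 ring)"
proof -
  have "\<exists>y. x + y = 0" for x :: 'a
    by (rule exI[of _ "- x"]) simp
  thus ?thesis
    unfolding ring_of_type_algebra_def
    by unfold_locales (auto simp: algebra_simps Units_def add_eq_0_iff)
qed

lemma ideal_ring_of_type_algebraI:
  fixes I :: "'a::ring_1 set"
  assumes "0 \<in> I" "\<And>x y. x \<in> I \<Longrightarrow> y \<in> I \<Longrightarrow> x + y \<in> I"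
    and "\<And>x y. x \<in> I \<Longrightarrow> y * x \<in> I" "\<And>x y. x \<in> I \<Longrightarrow> x * y \<in> I"
  shows "ideal I ring_of_type_algebra"
proof -
  interpret R: ring "ring_of_type_algebra :: 'a ring"
    by (rule ring_ring_of_type_algebra)
  have minus: "\<ominus>\<^bsub>ring_of_type_algebra\<^esub> x = - x" for x :: 'a
    using R.minus_equality[of "- x" x] by (simp add: ring_of_type_algebra_def)
  have neg: "- x \<in> I" if "x \<in> I" for x
    using assms(3)[OF that, of "- 1"] by simp
  have "subgroup I (add_monoid (ring_of_type_algebra :: 'a ring))"
    using assms neg minus
    by (intro subgroup.intro)
       (auto simp: ring_of_type_algebra_def a_inv_def)
  then show ?thesis
    using assms by (intro idealI R.ring_axioms) (auto simp: ring_of_type_algebra_def)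
qed

lemma yangian_ideal:
  shows yangian_relators_subset: "yangian_relators \<subseteq> yangian_ideal"
    and zero_in_yangian_ideal: "0 \<in> yangian_ideal"
    and add_in_yangian_ideal: "p \<in> yangian_ideal \<Longrightarrow> q \<in> yangian_ideal \<Longrightarrow> p + q \<in> yangian_ideal"
    and mult_left_in_yangian_ideal: "p \<in> yangian_ideal \<Longrightarrow> q * p \<in> yangian_ideal"
    and mult_right_in_yangian_ideal: "p \<in> yangian_ideal \<Longrightarrow> p * q \<in> yangian_ideal"
    and minus_in_yangian_ideal: "p \<in> yangian_ideal \<Longrightarrow> - p \<in> yangian_ideal"
proof -
  interpret R: ring "ring_of_type_algebra :: free_alg ring"
    by (rule ring_ring_of_type_algebra)
  have sub: "yangian_relators \<subseteq> carrier (ring_of_type_algebra :: free_alg ring)"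
    by (simp add: ring_of_type_algebra_def)
  interpret I: ideal yangian_ideal "ring_of_type_algebra :: free_alg ring"
    unfolding yangian_ideal_def by (rule R.genideal_ideal[OF sub])
  show "yangian_relators \<subseteq> yangian_ideal"
    unfolding yangian_ideal_def by (rule R.genideal_self[OF sub])
  show "0 \<in> yangian_ideal"
    using I.zero_closed by (simp add: ring_of_type_algebra_def)
  show "p + q \<in> yangian_ideal" if "p \<in> yangian_ideal" "q \<in> yangian_ideal"
    using I.a_closed[OF that] by (simp add: ring_of_type_algebra_def)
  show left: "q * p \<in> yangian_ideal" if "p \<in> yangian_ideal" for p q
    using I.I_l_closed[OF that, of q] by (simp add: ring_of_type_algebra_def)
  show "p * q \<in> yangian_ideal" if "p \<in> yangian_ideal"
    using I.I_r_closed[OF that, of q] by (simp add: ring_of_type_algebra_def)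
  show "- p \<in> yangian_ideal" if "p \<in> yangian_ideal"
    using left[OF that, of "- 1"] by simp
qed

lemma lookup_times_zero_word:
  fixes p q :: free_alg
  shows "Poly_Mapping.lookup (p * q) 0 = Poly_Mapping.lookup p 0 * Poly_Mapping.lookup q 0"
proof -
  have eq: "0 = u + v \<longleftrightarrow> 0 = u \<and> 0 = v" for u v :: "gen word"
    by (cases u; cases v) (auto simp: zero_word_def)
  have "(\<Sum>v. Poly_Mapping.lookup q v when 0 = u + v)
      = (Poly_Mapping.lookup q 0 when u = 0)" for u
    by (cases "u = 0") (auto simp: eq)
  then show ?thesis
    by (simp add: lookup_mult mult_when)
qed

lemma one_notin_yangian_ideal: "1 \<notin> yangian_ideal"
proof -
  let ?I = "{p :: free_alg. Poly_Mapping.lookup p 0 = 0}"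
  have [simp]: "Word [g] \<noteq> 0" for g :: gen
    by (simp add: zero_word_def)
  have numeral: "Poly_Mapping.lookup (2 :: free_alg) 0 = 2"
    using lookup_add[of "1 :: free_alg" 1 0] by (simp add: lookup_one)
  have "ideal ?I ring_of_type_algebra"
    by (rule ideal_ring_of_type_algebraI) (auto simp: lookup_times_zero_word lookup_add)
  moreover have "yangian_relators \<subseteq> ?I"
    by (auto elim!: yangian_relators.cases
          simp: lookup_times_zero_word lookup_add lookup_minus lookup_single numeral)
  ultimately have "yangian_ideal \<subseteq> ?I"
    unfolding yangian_ideal_def genideal_def by blast
  then show ?thesis
    by (auto simp: lookup_one)
qed

quotient_type yangian = free_alg / "\<lambda>p q. p - q \<in> yangian_ideal"
proof (rule equivpI)
  show "reflp (\<lambda>p q. p - q \<in> yangian_ideal)"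
    by (simp add: reflp_def zero_in_yangian_ideal)
  show "symp (\<lambda>p q. p - q \<in> yangian_ideal)"
    by (rule sympI, drule minus_in_yangian_ideal) simp
  show "transp (\<lambda>p q. p - q \<in> yangian_ideal)"
    by (rule transpI, drule (1) add_in_yangian_ideal) simp
qed

instantiation yangian :: ring_1
begin

lift_definition zero_yangian :: yangian is 0 .

lift_definition one_yangian :: yangian is 1 .

lift_definition plus_yangian :: "yangian \<Rightarrow> yangian \<Rightarrow> yangian" is "(+)"
  by (drule (1) add_in_yangian_ideal) (simp add: algebra_simps)

lift_definition uminus_yangian :: "yangian \<Rightarrow> yangian" is uminus
  by (drule minus_in_yangian_ideal) (simp add: algebra_simps)

lift_definition minus_yangian :: "yangian \<Rightarrow> yangian \<Rightarrow> yangian" is "\<lambda>p q. p - q"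
proof -
  fix p p' q q' :: free_alg
  assume "p - p' \<in> yangian_ideal" "q - q' \<in> yangian_ideal"
  then have "(p - p') + - (q - q') \<in> yangian_ideal"
    by (intro add_in_yangian_ideal minus_in_yangian_ideal)
  then show "(p - q) - (p' - q') \<in> yangian_ideal"
    by (simp add: algebra_simps)
qed

lift_definition times_yangian :: "yangian \<Rightarrow> yangian \<Rightarrow> yangian" is "(*)"
proof -
  fix p p' q q' :: free_alg
  assume "p - p' \<in> yangian_ideal" "q - q' \<in> yangian_ideal"
  then have "(p - p') * q + p' * (q - q') \<in> yangian_ideal"
    by (intro add_in_yangian_ideal mult_left_in_yangian_ideal mult_right_in_yangian_ideal)
  then show "p * q - p' * q' \<in> yangian_ideal"
    by (simp add: algebra_simps)
qed

instance
proof
  fix a b c :: yangian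
  show "a * b * c = a * (b * c)"
    by transfer (simp add: mult.assoc zero_in_yangian_ideal)
  show "1 * a = a" "a * 1 = a" "0 + a = a"
    by (transfer, simp add: zero_in_yangian_ideal)+
  show "a + b + c = a + (b + c)" "a + b = b + a"
    by (transfer, simp add: add_ac zero_in_yangian_ideal)+
  show "- a + a = 0" "a - b = a + - b"
    by (transfer, simp add: zero_in_yangian_ideal)+
  show "(a + b) * c = a * c + b * c" "a * (b + c) = a * b + a * c"
    by (transfer, simp add: distrib_left distrib_right zero_in_yangian_ideal)+
  show "(0 :: yangian) \<noteq> 1"
    by transfer (use one_notin_yangian_ideal minus_in_yangian_ideal[of "- 1"] in auto)
qed

end

lift_definition scale_yangian :: "complex \<Rightarrow> yangian \<Rightarrow> yangian"
  is "\<lambda>c p. Poly_Mapping.single 0 c * p"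
  by (simp add: mult_left_in_yangian_ideal flip: right_diff_distrib)

lift_definition x_plus :: "nat \<Rightarrow> yangian" is "\<lambda>r. fxp r" .

lift_definition x_minus :: "nat \<Rightarrow> yangian" is "\<lambda>r. fxm r" .

lift_definition h_gen :: "nat \<Rightarrow> yangian" is "\<lambda>r. fh r" .

definition yangian_alg :: "(complex, yangian) module" where
  "yangian_alg = ring.extend ring_of_type_algebra (module.fields scale_yangian)"

text \<open>
  These four values determine an algebra morphism, since \<open>x_plus 0\<close>, \<open>x_minus 0\<close>, \<open>h_gen 0\<close>
  and \<open>x_plus 1\<close> generate the Yangian.
\<close>

definition is_coproduct :: "(yangian \<Rightarrow> ((yangian \<times> yangian) \<Rightarrow>\<^sub>0 complex) set) \<Rightarrow> bool" where
  "is_coproduct \<Delta> \<longleftrightarrow>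
     (let YY = tensor_alg yangian_alg yangian_alg; t = pure_tensor yangian_alg yangian_alg in
       \<Delta> \<in> alg_hom yangian_alg YY \<and>
       \<Delta> (x_plus 0) = t (x_plus 0) 1 \<oplus>\<^bsub>YY\<^esub> t 1 (x_plus 0) \<and>
       \<Delta> (x_minus 0) = t (x_minus 0) 1 \<oplus>\<^bsub>YY\<^esub> t 1 (x_minus 0) \<and>
       \<Delta> (h_gen 0) = t (h_gen 0) 1 \<oplus>\<^bsub>YY\<^esub> t 1 (h_gen 0) \<and>
       \<Delta> (x_plus 1) = t (x_plus 1) 1 \<oplus>\<^bsub>YY\<^esub> t 1 (x_plus 1) \<oplus>\<^bsub>YY\<^esub> t (h_gen 0) (x_plus 0))"


section \<open>Truncated Yangians\<close>

text \<open>
  A Laurent series in \<open>z\<^sup>-\<^sup>1\<close> is a formal Laurent series in the variable \<open>X = z\<^sup>-\<^sup>1\<close>, so the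
  coefficient of \<open>z\<^sup>k\<close> is \<open>fls_nth f (- k)\<close>, and leading term \<open>z\<^sup>k\<close> means \<open>fls_subdegree f = - k\<close>
  and \<open>fls_nth f (- k) = 1\<close>.
\<close>

inductive_set h_subalgebra :: "yangian set" where
  "scale_yangian c 1 \<in> h_subalgebra"
| "h_gen r \<in> h_subalgebra"
| "x \<in> h_subalgebra \<Longrightarrow> y \<in> h_subalgebra \<Longrightarrow> x + y \<in> h_subalgebra"
| "x \<in> h_subalgebra \<Longrightarrow> y \<in> h_subalgebra \<Longrightarrow> x * y \<in> h_subalgebra"

definition h_series :: "yangian fls" where
  "h_series = fps_to_fls (Abs_fps (\<lambda>k. case k of 0 \<Rightarrow> 1 | Suc r \<Rightarrow> h_gen r))"

definition fls_to_yangian :: "complex fls \<Rightarrow> yangian fls" where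
  "fls_to_yangian f = Abs_fls (\<lambda>i. scale_yangian (fls_nth f i) 1)"

text \<open>
  The series \<open>f(z - 1)\<close>: the term \<open>z\<^sup>-\<^sup>k = X\<^sup>k\<close> becomes \<open>z\<^sup>-\<^sup>k (1 - z\<^sup>-\<^sup>1)\<^sup>-\<^sup>k\<close>, which is
  \<open>\<Sum>j. (- 1)\<^sup>j ((- k) gchoose j) X\<^sup>k\<^sup>+\<^sup>j\<close>.
\<close>

definition fls_shift_arg :: "yangian fls \<Rightarrow> yangian fls" where
  "fls_shift_arg f = Abs_fls (\<lambda>i. \<Sum>k = fls_subdegree f..i.
     scale_yangian ((- 1) ^ nat (i - k) * (of_int (- k) gchoose nat (i - k))) (fls_nth f k))"

lemma fls_nth_fls_to_yangian: "fls_nth (fls_to_yangian f) i = scale_yangian (fls_nth f i) 1"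
proof -
  have "scale_yangian 0 1 = 0"
    by transfer (simp add: zero_in_yangian_ideal)
  then show ?thesis
    unfolding fls_to_yangian_def
    by (intro nth_Abs_fls_lower_bound[of "fls_subdegree f"]) auto
qed

lemma fls_nth_fls_shift_arg:
  "fls_nth (fls_shift_arg f) i = (\<Sum>k = fls_subdegree f..i.
     scale_yangian ((- 1) ^ nat (i - k) * (of_int (- k) gchoose nat (i - k))) (fls_nth f k))"
  unfolding fls_shift_arg_def
  by (rule nth_Abs_fls_lower_bound[of "fls_subdegree f"]) auto

text \<open>The equation \<open>h(z) = a(z) / (A(z) A(z - 1))\<close> is stated with the denominator cleared.\<close>

definition is_A_series :: "complex fls \<Rightarrow> yangian fls \<Rightarrow> bool" where
  "is_A_series a A \<longleftrightarrow>
     2 * fls_subdegree A = fls_subdegree a \<and>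
     fls_nth A (fls_subdegree A) = 1 \<and>
     (\<forall>i. fls_nth A i \<in> h_subalgebra) \<and>
     h_series * (A * fls_shift_arg A) = fls_to_yangian a"

definition A_series :: "complex fls \<Rightarrow> yangian fls" where
  "A_series a = (THE A. is_A_series a A)"

definition trunc_ideal :: "complex fls \<Rightarrow> yangian set" where
  "trunc_ideal a = Idl\<^bsub>yangian_alg\<^esub> {fls_nth (A_series a) i | i. i > 0}"

definition trunc_yangian :: "complex fls \<Rightarrow> (complex, yangian set) module" where
  "trunc_yangian a = quot_alg yangian_alg (trunc_ideal a)"

definition trunc_proj :: "complex fls \<Rightarrow> yangian \<Rightarrow> yangian set" where
  "trunc_proj a x = trunc_ideal a +>\<^bsub>yangian_alg\<^esub> x"

end

theory Submission
  imports Defs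
begin

text \<open>
  Put \<open>e = x\<^sup>+\<^sub>0\<close>, \<open>f = x\<^sup>-\<^sub>0\<close>, \<open>A = A\<^sup>a(z)\<close>, \<open>B = [e, A]\<close>, \<open>C = [A, f]\<close> and \<open>D = A + [B, f]\<close>. These
  series behave like the entries of a monodromy matrix: \<open>h(z) A(z) A(z - 1) = a(z)\<close> becomes the
  quantum determinant identity \<open>D(z) A(z - 1) - C(z) B(z - 1) = a(z)\<close>. For two commuting copies the
  series \<open>A \<otimes> A + C \<otimes> B\<close> satisfies the same commutation relations with respect to \<open>\<Delta>(e)\<close> and
  \<open>\<Delta>(f)\<close>, and its quantum determinant is \<open>a(z) b(z)\<close>. Since \<open>h(z)\<close> and the quantum determinant
  determine the series, \<open>\<Delta>(A\<^sup>a\<^sup>b) = A\<^sup>a \<otimes> A\<^sup>b + C\<^sup>a \<otimes> B\<^sup>b\<close>. A coefficient of a negative power of \<open>z\<close> on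
  the right is a sum of tensors one of whose factors is such a coefficient of \<open>A\<close>, \<open>B\<close> or \<open>C\<close>, and
  the coefficients of \<open>B\<close> and \<open>C\<close> are commutators with those of \<open>A\<close>.

  The relations come from two leading coefficient arguments. The element
  \<open>j = (h\<^sub>1 - h\<^sub>0\<^sup>2 / 2) / 2\<close> commutes with \<open>A\<close> and shifts the generators, \<open>[j, x\<^sup>\<plusminus>\<^sub>s] = \<plusminus> x\<^sup>\<plusminus>\<^sub>s\<^sub>+\<^sub>1\<close>, and
  \<open>[j, G] = z G\<close> forces \<open>G = 0\<close>; likewise \<open>P(z) G(z) + G(z - 1) Q(z) = 0\<close> forces \<open>G = 0\<close> when \<open>P\<close> and
  \<open>Q\<close> have leading coefficient \<open>1\<close>.

  Throughout, \<open>fps_X\<close> stands for \<open>z\<^sup>-\<^sup>1\<close>, and a series with leading term \<open>z\<^sup>m\<close> is divided by \<open>z\<^sup>m\<close> to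
  become a power series in \<open>fps_X\<close>.
\<close>

section \<open>Type-class complex algebras\<close>

text \<open>Scalars enter as a central unital ring map, so an algebra is simply an instance of
  \<open>ring_1\<close>, and power series over it inherit the ring structure of the library.\<close>

class complex_algebra = ring_1 +
  fixes of_cplx :: "complex \<Rightarrow> 'a"
  assumes of_cplx_add: "of_cplx (c + d) = of_cplx c + of_cplx d"
    and of_cplx_mult: "of_cplx (c * d) = of_cplx c * of_cplx d"
    and of_cplx_1 [simp]: "of_cplx 1 = 1"
    and of_cplx_commute: "of_cplx c * x = x * of_cplx c"
begin

lemma of_cplx_0 [simp]: "of_cplx 0 = 0"
  using of_cplx_add[of 0 0] by simp

lemma of_cplx_sum: "of_cplx (sum f S) = (\<Sum>x\<in>S. of_cplx (f x))"
  by (induction S rule: infinite_finite_induct) (auto simp: of_cplx_add)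

lemma of_cplx_mult_swap: "(of_cplx c * x) * (of_cplx d * y) = of_cplx (c * d) * (x * y)"
  by (metis mult.assoc of_cplx_commute of_cplx_mult)

lemma double_eq_0_iff: "x + x = 0 \<longleftrightarrow> x = 0"
proof
  assume "x + x = 0"
  then have "of_cplx (1/2) * (x + x) = 0" by simp
  also have "of_cplx (1/2) * (x + x) = (of_cplx (1/2) + of_cplx (1/2)) * x"
    by (simp add: distrib_left distrib_right)
  also have "\<dots> = x" by (simp flip: of_cplx_add)
  finally show "x = 0" .
qed simp

end

section \<open>Shifting the argument of a power series\<close>

text \<open>
  If \<open>F\<close> represents \<open>z\<^sup>m F\<close>, then \<open>fps_sh m F\<close> represents the same series with \<open>z - 1\<close> for \<open>z\<close>: the
  coefficients are those of \<open>(z - 1)\<^sup>m\<^sup>-\<^sup>k\<close>.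
\<close>

definition shcoeff :: "int \<Rightarrow> nat \<Rightarrow> nat \<Rightarrow> complex" where
  "shcoeff m i k = (- 1) ^ (i - k) * ((of_int m - of_nat k) gchoose (i - k))"

definition fps_sh :: "int \<Rightarrow> 'a::complex_algebra fps \<Rightarrow> 'a fps" where
  "fps_sh m F = Abs_fps (\<lambda>i. \<Sum>k\<le>i. of_cplx (shcoeff m i k) * F $ k)"

lemma fps_sh_nth: "fps_sh m F $ i = (\<Sum>k\<le>i. of_cplx (shcoeff m i k) * F $ k)"
  by (simp add: fps_sh_def)

lemma shcoeff_self [simp]: "shcoeff m i i = 1"
  by (simp add: shcoeff_def)

lemma fps_sh_0 [simp]: "fps_sh m 0 = 0"
  by (simp add: fps_eq_iff fps_sh_nth)

lemma fps_sh_nth_0 [simp]: "fps_sh m F $ 0 = F $ 0"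
  by (simp add: fps_sh_nth)

lemma fps_sh_add: "fps_sh m (F + G) = fps_sh m F + fps_sh m G"
  by (simp add: fps_eq_iff fps_sh_nth distrib_left sum.distrib)

lemma fps_sh_diff: "fps_sh m (F - G) = fps_sh m F - fps_sh m G"
  by (simp add: fps_eq_iff fps_sh_nth right_diff_distrib sum_subtractf)

text \<open>Compare coefficients in (z - 1)^(m - p) (z - 1)^(n - q) = (z - 1)^(m + n - p - q). Once
  the signs are collected this is Vandermonde's convolution.\<close>

lemma shcoeff_Vandermonde:
  assumes "p + q \<le> i"
  shows "(\<Sum>a=p..i-q. shcoeff m a p * shcoeff n (i - a) q) = shcoeff (m + n) i (p + q)"
proof -
  define N where "N = i - p - q"
  have "(\<Sum>a=p..i-q. shcoeff m a p * shcoeff n (i - a) q)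
      = (\<Sum>s=0..N. shcoeff m (s + p) p * shcoeff n (i - (s + p)) q)"
    using assms unfolding N_def
    by (intro sum.reindex_bij_witness[of _ "\<lambda>s. s + p" "\<lambda>a. a - p"]) auto
  also have "\<dots> = (\<Sum>s=0..N. (- 1) ^ N * ((of_int m - of_nat p gchoose s) *
       (of_int n - of_nat q gchoose (N - s))))"
  proof (intro sum.cong refl)
    fix s assume s: "s \<in> {0..N}"
    then have e: "i - (s + p + q) = N - s" "N = s + (N - s)" by (auto simp: N_def)
    have "(-1) ^ N = (- 1) ^ s * ((- 1 :: complex) ^ (N - s))"
      by (subst e(2)) (rule power_add)
    then show "shcoeff m (s + p) p * shcoeff n (i - (s + p)) q = (- 1) ^ N *
       ((of_int m - of_nat p gchoose s) * (of_int n - of_nat q gchoose (N - s)))"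
      by (simp add: shcoeff_def e(1) diff_diff_left)
  qed
  also have "\<dots> = (- 1) ^ N * ((of_int m - of_nat p) + (of_int n - of_nat q) gchoose N)"
    by (simp only: gbinomial_Vandermonde flip: sum_distrib_left)
  also have "\<dots> = shcoeff (m + n) i (p + q)"
    by (simp add: shcoeff_def N_def algebra_simps)
  finally show ?thesis .
qed

text \<open>Substitution is a ring morphism; the degrees add because z^m F times z^n G is z^(m + n)
  F G.\<close>

lemma fps_sh_mult: "fps_sh (m + n) (F * G) = fps_sh m F * fps_sh n G"
proof (rule fps_ext)
  fix i
  let ?c = "\<lambda>m i k. of_cplx (shcoeff m i k) :: 'a"
  have "(fps_sh m F * fps_sh n G) $ i =
    (\<Sum>a\<le>i. \<Sum>p\<le>a. \<Sum>q\<le>i-a. of_cplx (shcoeff m a p * shcoeff n (i - a) q) * (F $ p * G $ q))"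
    by (simp add: fps_mult_nth fps_sh_nth sum_product atMost_atLeast0 of_cplx_mult_swap)
  \<comment> \<open>The ranges of \<open>p\<close> and \<open>q\<close> depend on \<open>a\<close>.
    Padding with zeros to a common box allows the sums to be swapped, so that \<open>a\<close> is
    summed first by \<open>shcoeff_Vandermonde\<close>.\<close>
  also have "\<dots> = (\<Sum>a\<le>i. \<Sum>p\<le>i. \<Sum>q\<le>i. if p \<le> a \<and> q \<le> i - a then 
      of_cplx (shcoeff m a p * shcoeff n (i - a) q) * (F $ p * G $ q) else 0)"
  proof (rule sum.cong [OF refl])
    fix a assume "a \<in> {..i}"
    then show "(\<Sum>p\<le>a. \<Sum>q\<le>i-a. of_cplx (shcoeff m a p * shcoeff n (i - a) q) * (F $ p * G $ q)) = 
      (\<Sum>p\<le>i. \<Sum>q\<le>i. if p \<le> a \<and> q \<le> i - a then 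
      of_cplx (shcoeff m a p * shcoeff n (i - a) q) * (F $ p * G $ q) else 0)"
      by (intro sum.mono_neutral_cong_left) (auto intro!: sum.mono_neutral_cong_left)
  qed
  also have "\<dots> = (\<Sum>p\<le>i. \<Sum>q\<le>i. \<Sum>a\<le>i. if p \<le> a \<and> q \<le> i - a then 
      of_cplx (shcoeff m a p * shcoeff n (i - a) q) * (F $ p * G $ q) else 0)"
    by (rule trans [OF sum.swap sum.cong [OF refl sum.swap]])
  also have "\<dots> = (\<Sum>p\<le>i. \<Sum>q\<le>i. if p + q \<le> i then ?c (m + n) i (p + q) * (F $ p * G $ q) else 0)"
  proof (intro sum.cong refl)
    fix p q assume pq: "p \<in> {..i}" "q \<in> {..i}"
    have "(\<Sum>a\<le>i. if p \<le> a \<and> q \<le> i - a then 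
      of_cplx (shcoeff m a p * shcoeff n (i - a) q) * (F $ p * G $ q) else 0)
     = (\<Sum>a | a \<in> {..i} \<and> (p \<le> a \<and> q \<le> i - a). of_cplx (shcoeff m a p * shcoeff n (i - a) q) * (F $ p * G $ q))"
      by (rule sum.inter_filter [symmetric]) simp
    also have "{a. a \<in> {..i} \<and> (p \<le> a \<and> q \<le> i - a)} = {p..i-q}"
      using pq by auto
    also have "(\<Sum>a=p..i-q. of_cplx (shcoeff m a p * shcoeff n (i - a) q) * (F $ p * G $ q))
      = of_cplx (\<Sum>a=p..i-q. shcoeff m a p * shcoeff n (i - a) q) * (F $ p * G $ q)"
      by (simp add: of_cplx_sum sum_distrib_right)
    also have "\<dots> = (if p + q \<le> i then ?c (m + n) i (p + q) * (F $ p * G $ q) else 0)"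
      using pq by (auto simp: shcoeff_Vandermonde)
    finally show "(\<Sum>a\<le>i. if p \<le> a \<and> q \<le> i - a then 
      of_cplx (shcoeff m a p * shcoeff n (i - a) q) * (F $ p * G $ q) else 0) =
      (if p + q \<le> i then ?c (m + n) i (p + q) * (F $ p * G $ q) else 0)" .
  qed
  also have "\<dots> = (\<Sum>(p, q)\<in>{(p, q). p + q \<le> i}. ?c (m + n) i (p + q) * (F $ p * G $ q))"
    by (subst sum.cartesian_product, rule sum.mono_neutral_cong_right)
       (auto split: if_splits)
  also have "\<dots> = (\<Sum>k\<le>i. \<Sum>p\<le>k. ?c (m + n) i (p + (k - p)) * (F $ p * G $ (k - p)))"
    by (rule sum.triangle_reindex_eq)
  also have "\<dots> = fps_sh (m + n) (F * G) $ i"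
    by (simp add: fps_sh_nth fps_mult_nth sum_distrib_left atMost_atLeast0)
  finally show "fps_sh (m + n) (F * G) $ i = (fps_sh m F * fps_sh n G) $ i" ..
qed

lemma fps_sh_0_const [simp]: "fps_sh 0 (fps_const c) = fps_const c"
proof (rule fps_ext)
  fix i show "fps_sh 0 (fps_const c) $ i = fps_const c $ i"
    by (cases i) (simp_all add: fps_sh_nth sum.atMost_shift shcoeff_def)
qed

text \<open>In degree 1 the series \<open>1\<close> represents z, and z - 1 = z (1 - 1 / z).\<close>

lemma fps_sh_1_1: "fps_sh 1 (1 :: 'a::complex_algebra fps) = 1 - fps_X"
proof (rule fps_ext)
  fix i
  have 1: "shcoeff 1 (Suc n) 0 = (if n = 0 then -1 else 0)" for n
    using binomial_gbinomial[of 1 "Suc n", where ?'a = complex] by (cases n) (simp_all add: shcoeff_def)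
  have m1: "of_cplx (-1) = (-1 :: 'a)"
    using of_cplx_add[of 1 "-1", where ?'a = 'a] by (simp add: add_eq_0_iff)
  show "fps_sh 1 (1 :: 'a fps) $ i = (1 - fps_X) $ i"
    by (cases i) (auto simp: fps_sh_nth sum.atMost_shift 1 m1 fps_X_def)
qed

text \<open>Raising the degree means one more factor z, which the substitution turns into z -
  1.\<close>

lemma fps_sh_succ: "fps_sh (m + 1) F = (1 - fps_X) * fps_sh m F"
  using fps_sh_mult[of 1 m 1 F] by (simp add: fps_sh_1_1 add.commute)

text \<open>z^(m + 1) \<open>fps_X\<close> F and z^m F are the same series, so only the
  normalisation changes.\<close>

lemma fps_sh_X: "fps_sh (m + 1) (fps_X * F) = fps_X * fps_sh m F"
proof (rule fps_ext)
  fix i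
  have "shcoeff (m + 1) (Suc n) (Suc k) = shcoeff m n k" for n k
    by (simp add: shcoeff_def)
  then show "fps_sh (m + 1) (fps_X * F) $ i = (fps_X * fps_sh m F) $ i"
    by (cases i) (simp_all add: fps_sh_nth sum.atMost_shift lessThan_Suc_atMost)
qed

subsection \<open>Leading coefficient arguments\<close>

text \<open>Lowest coefficients multiply. There is a factor on either side of \<open>D\<close>
  because coefficients need not commute.\<close>

lemma fps_mult_nth_low_order:
  assumes "\<And>k. k < n \<Longrightarrow> D $ k = 0"
  shows "(P * D * Q :: 'a::ring_1 fps) $ n = P $ 0 * D $ n * Q $ 0"
proof -
  have "(P * D) $ k = (if k = n then P $ 0 * D $ n else 0)" if "k \<le> n" for k
  proof -
    have "(P * D) $ k = (\<Sum>i=0..k. if i = 0 then P $ 0 * D $ k else 0)"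
      unfolding fps_mult_nth using that assms by (intro sum.cong) auto
    then show ?thesis using that assms by auto
  qed
  then have "(P * D * Q) $ n = (\<Sum>i=0..n. if i = n then P $ 0 * D $ n * Q $ 0 else 0)"
    unfolding fps_mult_nth[of "P * D"] by (intro sum.cong) auto
  then show ?thesis by simp
qed

text \<open>The coefficients \<open>shcoeff\<close> form a unitriangular matrix, so the shift
  preserves the lowest coefficient.\<close>

lemma fps_sh_low_order:
  assumes "\<And>k. k < n \<Longrightarrow> D $ k = 0" and "k \<le> n"
  shows "fps_sh m D $ k = D $ k"
proof -
  have "fps_sh m D $ k = (\<Sum>i\<le>k. if i = k then D $ k else 0)"
    unfolding fps_sh_nth using assms by (intro sum.cong) auto
  then show ?thesis by simp
qed

text \<open>A lowest nonzero coefficient d of \<open>D\<close> would give the lowest coefficient d +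
  d on the left, and 2 is invertible.\<close>

lemma fps_sh_eq_0I:
  fixes D :: "'a::complex_algebra fps"
  assumes "P * D * Q + P' * fps_sh m D * Q' = 0"
    and "P $ 0 = 1" "Q $ 0 = 1" "P' $ 0 = 1" "Q' $ 0 = 1"
  shows "D = 0"
proof -
  have "D $ n = 0" for n
  proof (induction n rule: less_induct)
    case (less n)
    have "(P * D * Q + P' * fps_sh m D * Q') $ n = D $ n + D $ n"
      using fps_mult_nth_low_order[of n D P Q] fps_mult_nth_low_order[of n "fps_sh m D" P' Q']
        fps_sh_low_order[of n D] less by (simp add: assms(2-5))
    with assms(1) show ?case by (simp add: double_eq_0_iff)
  qed
  then show ?thesis by (simp add: fps_eq_iff)
qed

text \<open>The right-hand side has higher order than \<open>G\<close>, so the lowest coefficient of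
  \<open>G + G\<close> must vanish.\<close>

lemma fps_X_eq_0I:
  fixes G :: "'a::complex_algebra fps"
  assumes "G + G = fps_X * (P * G + G * Q)"
  shows "G = 0"
proof -
  have "G $ n = 0" for n
  proof (induction n rule: less_induct)
    case (less n)
    have "(P * G + G * Q) $ (n - 1) = 0" if "n \<noteq> 0"
      using less that by (simp add: fps_mult_nth)
    then have "(G + G) $ n = 0"
      unfolding assms by (cases n) auto
    then show ?case by (simp add: double_eq_0_iff)
  qed
  then show ?thesis by (simp add: fps_eq_iff)
qed


text \<open>This is [J, G] = z G; doubling both sides brings it into the form of
  \<open>fps_X_eq_0I\<close>.\<close>

lemma fps_X_commutator_eq_0I:
  fixes G :: "'a::complex_algebra fps"
  assumes "G = fps_X * commutator J G"
  shows "G = 0"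
proof (rule fps_X_eq_0I)
  have "G + G = fps_X * commutator J G + fps_X * commutator J G"
    using assms by metis
  then show "G + G = fps_X * ((J + J) * G + G * (- J - J))"
    by (simp add: algebra_simps)
qed

lemma fps_unit_mult_eq_0D:
  fixes D :: "'a::complex_algebra fps"
  assumes "P * D * Q = 0" "P $ 0 = 1" "Q $ 0 = 1"
  shows "D = 0"
proof -
  have "D $ n = 0" for n
  proof (induction n rule: less_induct)
    case (less n)
    then have "(P * D * Q) $ n = P $ 0 * D $ n * Q $ 0"
      by (rule fps_mult_nth_low_order)
    then show ?case by (simp add: assms)
  qed
  then show ?thesis by (simp add: fps_eq_iff)
qed

lemma fps_X_mult_eq_0D:
  fixes D :: "'a::ring_1 fps"
  assumes "fps_X * D = 0"
  shows "D = 0"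
proof (rule fps_ext)
  fix n
  have "(fps_X * D) $ Suc n = 0" by (simp add: assms)
  then show "D $ n = 0 $ n" by simp
qed

text \<open>\<open>fps_X\<close> is central even over noncommuting coefficients. The collection
  \<open>fps_X_simps\<close> moves it to the front of every product.\<close>

lemma fps_X_left_commute:
  fixes a :: "'a::ring_1 fps"
  shows "a * (fps_X * b) = fps_X * (a * b)"
  by (metis fps_mult_fps_X_commute mult.assoc)

lemmas fps_X_simps = fps_X_left_commute fps_mult_fps_X_commute [symmetric]

section \<open>Solving \<open>H(z) F(z) F(z - 1) = K(z)\<close>\<close>

text \<open>In degree n the equation is linear in the unknown coefficient, with factor 2. That
  coefficient is therefore half the defect left by the truncation \<open>T\<close> of the solution
  below n.\<close>

function sh_root :: "int \<Rightarrow> 'a::complex_algebra fps \<Rightarrow> 'a fps \<Rightarrow> nat \<Rightarrow> 'a" where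
  "sh_root m P K n = (if n = 0 then 1 else
     let T = Abs_fps (\<lambda>i. if i < n then sh_root m P K i else 0)
     in of_cplx (1 / 2) * (K $ n - (P * T * fps_sh m T) $ n))"
  by auto
termination
  by (relation "measure (\<lambda>(m, P, K, n). n)") auto

declare sh_root.simps [simp del]

text \<open>The set \<open>S\<close> records where the coefficients lie, since the recursion uses
  only scalars, sums and products. It will be the subalgebra generated by the h_n.\<close>

lemma sh_root_exists:
  fixes H K :: "'a::complex_algebra fps"
  assumes "H $ 0 = 1" "K $ 0 = 1"
    and closed: "\<And>x y. x \<in> S \<Longrightarrow> y \<in> S \<Longrightarrow> x + y \<in> S" "\<And>x y. x \<in> S \<Longrightarrow> y \<in> S \<Longrightarrow> x * y \<in> S"
      "\<And>c. of_cplx c \<in> S"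
    and coeffs: "\<And>i. H $ i \<in> S" "\<And>i. K $ i \<in> S"
  obtains F where "F $ 0 = 1" "\<And>i. F $ i \<in> S" "H * F * fps_sh m F = K"
proof -
  have zero: "0 \<in> S" and one: "1 \<in> S"
    using closed(3)[of 0] closed(3)[of 1] by simp_all
  have minus: "x - y \<in> S" if "x \<in> S" "y \<in> S" for x y
  proof -
    have "of_cplx (-1) * y = - y"
      using of_cplx_add[of 1 "-1", where ?'a = 'a] by (simp add: add_eq_0_iff)
    then show ?thesis
      using closed(1)[OF that(1) closed(2)[OF closed(3)[of "-1"] that(2)]] by simp
  qed
  have sum: "(\<Sum>i\<in>I. g i) \<in> S" if "\<And>i. i \<in> I \<Longrightarrow> g i \<in> S" for I and g :: "nat \<Rightarrow> 'a"
    using that by (induction I rule: infinite_finite_induct) (auto intro: zero closed)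
  have mult: "(P * Q) $ i \<in> S" if "\<And>i. P $ i \<in> S" "\<And>i. Q $ i \<in> S" for P Q i
    unfolding fps_mult_nth using that by (intro sum closed)
  have sh: "fps_sh m P $ i \<in> S" if "\<And>i. P $ i \<in> S" for P i
    unfolding fps_sh_nth using that by (intro sum closed)
  define F where "F = Abs_fps (sh_root m H K)"
  define T where "T n = Abs_fps (\<lambda>i. if i < n then sh_root m H K i else 0)" for n
  have F: "F $ n = of_cplx (1 / 2) * (K $ n - (H * T n * fps_sh m (T n)) $ n)" if "n > 0" for n
    unfolding F_def T_def fps_nth_Abs_fps by (subst sh_root.simps) (use that in \<open>simp add: Let_def\<close>)
  have F0: "F $ 0 = 1"
    by (simp add: F_def sh_root.simps)
  have "F $ n \<in> S" for n
  proof (induction n rule: less_induct)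
    case (less n)
    have T: "T n $ i \<in> S" for i
      using less zero by (auto simp: T_def F_def)
    show ?case
    proof (cases "n = 0")
      case True
      then show ?thesis by (simp add: F0 one)
    next
      case False
      then show ?thesis
        unfolding F[OF False[unfolded neq0_conv]] by (intro closed minus mult sh T coeffs)
    qed
  qed
  moreover have "(H * F * fps_sh m F) $ n = K $ n" for n
  proof (cases "n = 0")
    case True
    then show ?thesis by (simp add: assms F0)
  next
    case False
    let ?D = "F - T n"
    have D: "?D $ k = 0" if "k < n" for k
      using that by (simp add: T_def F_def)
    have Dn: "?D $ n = F $ n" and T0: "T n $ 0 = 1"
      using False F0 by (simp_all add: T_def F_def)
    \<comment> \<open>Replacing \<open>T n\<close> by \<open>F\<close> one factor at a time leaves
      two terms linear in \<open>F - T n\<close>. This difference starts in degree n, so each term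
      contributes \<open>F $ n\<close>.\<close>
    have "H * F * fps_sh m F - H * T n * fps_sh m (T n) =
        H * ?D * fps_sh m F + H * T n * fps_sh m ?D * 1"
      by (simp add: fps_sh_diff algebra_simps)
    then have "(H * F * fps_sh m F) $ n - (H * T n * fps_sh m (T n)) $ n =
        (H * ?D * fps_sh m F) $ n + (H * T n * fps_sh m ?D * 1) $ n"
      by (metis fps_add_nth fps_sub_nth)
    also have "(H * ?D * fps_sh m F) $ n = F $ n"
      using fps_mult_nth_low_order[of n ?D H "fps_sh m F"] D Dn by (simp add: assms F0)
    also have "(H * T n * fps_sh m ?D * 1) $ n = F $ n"
      using fps_mult_nth_low_order[of n "fps_sh m ?D" "H * T n" 1] D Dn fps_sh_low_order[of n ?D]
      by (simp add: assms T0)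
    also have "F $ n + F $ n = (of_cplx (1/2) + of_cplx (1/2)) * (K $ n - (H * T n * fps_sh m (T n)) $ n)"
      unfolding F[OF False[unfolded neq0_conv]] by (simp add: distrib_right)
    also have "\<dots> = K $ n - (H * T n * fps_sh m (T n)) $ n"
      by (simp flip: of_cplx_add)
    finally show ?thesis by simp
  qed
  ultimately show ?thesis
    by (intro that[of F]) (auto simp: F0 fps_eq_iff)
qed

text \<open>The difference D = F - G satisfies D(z) h(z) F(z - 1) + G(z) h(z) D(z - 1) = 0. The
  factor \<open>h\<close> stands in the middle, as in the quantum determinant identity, because it
  is not assumed to commute with \<open>F\<close> and \<open>G\<close>.\<close>

lemma sh_root_unique:
  fixes F G :: "'a::complex_algebra fps"
  assumes "F * h * fps_sh m F = G * h * fps_sh m G"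
    and "h $ 0 = 1" "F $ 0 = 1" "G $ 0 = 1"
  shows "F = G"
proof -
  have "1 * (F - G) * (h * fps_sh m F) + (G * h) * fps_sh m (F - G) * 1 = 0"
    using assms(1) by (simp add: fps_sh_diff algebra_simps)
  then have "F - G = 0"
    by (rule fps_sh_eq_0I) (use assms in auto)
  then show ?thesis by simp
qed


section \<open>Monodromy matrices\<close>

lemma commutator_mult_left: "commutator (x * y) z = x * commutator y z + commutator x z * (y :: 'a::ring)"
  by (simp add: algebra_simps)

text \<open>Taking the commutator of the last assumption with \<open>f\<close> yields twice the
  claim. Primed letters will be the matrix entries at z - 1.\<close>

lemma commutator_eq_imp_eq:
  fixes a b c d :: "'a::complex_algebra fps"
  assumes "commutator a f = c" "commutator b f = d - a" "commutator c f = 0" "commutator d f = - c"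
    and "commutator a' f = c'" "commutator b' f = d' - a'" "commutator c' f = 0" "commutator d' f = - c'"
    and "d * a' - c * b' = a * d' - b * c'"
  shows "d * c' = c * d'"
proof -
  have "d * commutator a' f + commutator d f * a' - (c * commutator b' f + commutator c f * b')
      = commutator (d * a' - c * b') f"
    by (simp add: algebra_simps)
  also have "\<dots> = commutator (a * d' - b * c') f" by (simp only: assms(9))
  also have "\<dots> = a * commutator d' f + commutator a f * d' - (b * commutator c' f + commutator b f * c')"
    by (simp add: algebra_simps)
  finally have "d * c' - c * a' - c * (d' - a') = - (a * c') + c * d' - (d - a) * c'"
    unfolding assms(1-8) by simp
  then have "(d * c' - c * d') + (d * c' - c * d') = 0"
    by (simp add: algebra_simps)
  \<comment> \<open>With both parameters zero, \<open>fps_X_eq_0I\<close> is division by 2.\<close>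
  then have "d * c' - c * d' = 0"
    by (intro fps_X_eq_0I [where P = 0 and Q = 0]) simp
  then show ?thesis by simp
qed

text \<open>
  Multiplied by \<open>z\<close>, the last assumption reads \<open>z [e, A] - [e\<^sub>1, A] = A e\<close>, where \<open>e\<^sub>1 = [j, e]\<close>.
\<close>

locale lax =
  fixes e f j A :: "'a::complex_algebra fps" and m :: int
  assumes sh_const: "fps_sh 0 e = e" "fps_sh 0 f = f" "fps_sh 0 j = j"
    and A_0: "A $ 0 = 1"
    and jA: "commutator j A = 0"
    and eA: "commutator e A = fps_X * (commutator (commutator j e) A + A * e)"
begin

abbreviation "e1 \<equiv> commutator j e"
abbreviation "B \<equiv> commutator e A"
abbreviation "C \<equiv> commutator A f"
abbreviation "D \<equiv> A + commutator B f"

lemma sh_const_mult: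
  "fps_sh k (e * F) = e * fps_sh k F" "fps_sh k (f * F) = f * fps_sh k F" "fps_sh k (j * F) = j * fps_sh k F"
  "fps_sh k (F * e) = fps_sh k F * e" "fps_sh k (F * f) = fps_sh k F * f" "fps_sh k (F * j) = fps_sh k F * j"
  using fps_sh_mult[of 0 k _ F] fps_sh_mult[of k 0 F] by (simp_all add: sh_const)

lemmas sh_simps = sh_const_mult fps_sh_diff fps_sh_add

text \<open>That is, \<open>[j, B] = z B - A e\<close>.\<close>

lemma jB: "B = fps_X * (commutator j B + A * e)"
proof -
  have "commutator j B = commutator e1 A + commutator e (commutator j A)"
    by (simp add: algebra_simps)
  with eA show ?thesis by (simp add: jA)
qed

lemma j_shA: "commutator j (fps_sh m A) = 0"
  using arg_cong[OF jA, of "fps_sh m"] by (simp add: sh_simps)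

text \<open>Both sides solve Y = z^-1 ([j, Y] + A e), which has only one solution. With
  \<open>E\<close> the current e(z), this is the Gauss decomposition e(z) = A(z)^-1 B(z).\<close>

lemma A_mult_E:
  assumes E: "E = fps_X * (commutator j E + e)"
  shows "A * E = B"
proof -
  define G where "G = A * E - B"
  have "A * E = fps_X * (A * (commutator j E + e))"
    by (subst E) (simp add: fps_X_left_commute)
  also have "A * (commutator j E + e) = commutator j (A * E) - commutator j A * E + A * e"
    by (simp add: algebra_simps)
  finally have 1: "A * E = fps_X * (commutator j (A * E) + A * e)"
    by (simp only: jA) simp
  have "G = fps_X * (commutator j (A * E) + A * e) - fps_X * (commutator j B + A * e)"
    unfolding G_def using 1 jB by (metis (no_types))
  then have "G = fps_X * commutator j G"
    unfolding G_def by (simp add: algebra_simps)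
  then have "G = 0" by (rule fps_X_commutator_eq_0I)
  then show ?thesis by (simp add: G_def)
qed

text \<open>Substitution in \<open>jB\<close> gives (z - 1) B(z - 1) = [j, B(z - 1)] + A(z - 1) e;
  the extra summand on the right comes from z - 1 in place of z.\<close>

lemma j_shB: "fps_sh m B = fps_X * (commutator j (fps_sh m B) + fps_sh m B + fps_sh m A * e)"
proof -
  have "fps_sh (m + 1) B = fps_X * fps_sh m (commutator j B + A * e)"
    by (subst jB) (rule fps_sh_X)
  also have "fps_sh m (commutator j B + A * e) = commutator j (fps_sh m B) + fps_sh m A * e"
    by (simp only: sh_simps)
  finally show ?thesis
    unfolding fps_sh_succ by (simp add: algebra_simps)
qed

lemma shB: "fps_sh m B = commutator e (fps_sh m A)"
  by (simp add: sh_simps)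

text \<open>Both sides solve Y = z^-1 ([j, Y] + A(z) e A(z - 1)): the extra summand in
  \<open>j_shB\<close> turns A(z - 1) e into e A(z - 1).\<close>

lemma BA: "B * fps_sh m A = A * fps_sh m B"
proof -
  define A' B' where "A' = fps_sh m A" and "B' = fps_sh m B"
  define G where "G = B * A' - A * B'"
  have B': "B' = commutator e A'" and jA': "commutator j A' = 0"
    by (simp_all only: A'_def B'_def shB j_shA)
  have "B * A' = fps_X * (commutator j B + A * e) * A'"
    using jB by metis
  also have "\<dots> = fps_X * (commutator j (B * A') - B * commutator j A' + A * e * A')"
    by (simp add: algebra_simps)
  finally have 1: "B * A' = fps_X * (commutator j (B * A') + A * e * A')"
    by (simp only: jA') simp
  have "A * B' = A * (fps_X * (commutator j B' + B' + A' * e))"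
    using j_shB unfolding A'_def B'_def by metis
  also have "\<dots> = fps_X * (A * (commutator j B' + B' + A' * e))"
    by (simp add: fps_X_left_commute)
  also have "A * (commutator j B' + B' + A' * e) = commutator j (A * B') - commutator j A * B' + A * B' + A * A' * e"
    by (simp add: algebra_simps)
  finally have 2: "A * B' = fps_X * (commutator j (A * B') + A * (e * A'))"
    by (simp add: jA B' algebra_simps)
  have "G = fps_X * (commutator j (B * A') + A * e * A') - fps_X * (commutator j (A * B') + A * (e * A'))"
    unfolding G_def using 1 2 by (metis (no_types))
  then have "G = fps_X * commutator j G"
    unfolding G_def by (simp add: algebra_simps)
  then have "G = 0" by (rule fps_X_commutator_eq_0I)
  then show ?thesis by (simp add: G_def A'_def B'_def)
qed

text \<open>The Leibniz rule and B = A E give A h = D - C E. It remains to multiply by A(z - 1) and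
  to use E(z) A(z - 1) = B(z - 1).\<close>

lemma quantum_determinant:
  assumes E: "E = fps_X * (commutator j E + e)" and h: "h = 1 + commutator E f"
  shows "A * h * fps_sh m A = D * fps_sh m A - C * fps_sh m B"
proof -
  have AE: "A * E = B" using E by (rule A_mult_E)
  \<comment> \<open>Here \<open>A\<close> is cancelled on the left of A E A(z - 1) = B A(z - 1) = A
    B(z - 1).\<close>
  have "A * (E * fps_sh m A - fps_sh m B) * 1 = 0"
    by (simp add: right_diff_distrib AE BA flip: mult.assoc)
  then have "E * fps_sh m A - fps_sh m B = 0"
    by (rule fps_unit_mult_eq_0D) (simp_all add: A_0)
  then have EA: "E * fps_sh m A = fps_sh m B" by simp
  have "A * h = A + commutator (A * E) f - C * E"
    by (simp add: h algebra_simps)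
  then have "A * h = D - C * E" by (simp only: AE)
  then show ?thesis
    by (simp only: left_diff_distrib mult.assoc EA)
qed

end

text \<open>These further relations are imposed on the two factors of a product. For the product
  itself only \<open>lax\<close> and the value of the quantum determinant are established, which is
  what the uniqueness argument uses.\<close>

locale monodromy = lax +
  fixes K :: "'a::complex_algebra fps"
  assumes fA: "commutator A f = fps_X * (commutator A (commutator f j) + f * A)"
    and ee: "commutator (commutator j e) e = e * e"
    and ff: "commutator (commutator f j) f = - (f * f)"
    and h0A: "commutator (commutator e f) A = 0"
    and h1A: "commutator (commutator (commutator j e) f) A = 0"
    and h0f: "commutator (commutator e f) f = - (f + f)"
    and qdet: "D * fps_sh m A - C * fps_sh m B = K"
begin

abbreviation "h0 \<equiv> commutator e f"
abbreviation "f1 \<equiv> commutator f j"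

lemma jC: "C = fps_X * (commutator C j + f * A)"
proof -
  have "commutator C j = commutator A f1 - commutator (commutator j A) f"
    by (simp add: algebra_simps)
  then show ?thesis using fA by (simp add: jA)
qed

text \<open>The commutator \<open>G = [e, B]\<close> vanishes because \<open>[j, G] = (2 z + 1) G\<close>.\<close>

lemma eB: "commutator e B = 0"
  and e1B: "commutator e1 B = e * B"
proof -
  define G where "G = commutator e B"
  have e1A: "fps_X * commutator e1 A = B - fps_X * A * e"
    using eA by (simp add: algebra_simps)
  have "fps_X * commutator e1 B = fps_X * (commutator (commutator e1 e) A) + commutator e (fps_X * commutator e1 A)"
    by (simp add: algebra_simps fps_X_left_commute)
  also have "\<dots> = fps_X * (e * B + B * e) + commutator e (B - fps_X * A * e)"
    by (simp only: ee e1A) (simp add: algebra_simps)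
  also have "\<dots> = fps_X * e * B + G"
    unfolding G_def by (simp add: algebra_simps fps_X_left_commute)
  finally have 1: "fps_X * commutator e1 B = fps_X * e * B + G" .
  have "fps_X * commutator j G = fps_X * commutator e1 B + commutator e (fps_X * (commutator j B + A * e)) - commutator e (fps_X * A * e)"
    unfolding G_def by (simp add: algebra_simps fps_X_left_commute)
  also have "\<dots> = (fps_X * e * B + G) + commutator e B - commutator e (fps_X * A * e)"
    by (simp only: 1 jB [symmetric])
  finally have "G + G = fps_X * ((j - 1) * G + G * (- j))"
    unfolding G_def by (simp add: algebra_simps fps_X_left_commute)
  then have G: "G = 0" by (rule fps_X_eq_0I)
  then show "commutator e B = 0" by (simp add: G_def)
  have "fps_X * (commutator e1 B - e * B) = 0"
    using 1 G by (simp add: algebra_simps)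
  then show "commutator e1 B = e * B"
    using fps_X_mult_eq_0D by fastforce
qed

text \<open>Mirror image of \<open>eB\<close>: here [j, G] = - (2 z + 1) G, with \<open>jC\<close>
  and \<open>ff\<close> in place of \<open>jB\<close> and \<open>ee\<close>.\<close>

lemma Cf: "commutator C f = 0"
proof -
  define G where "G = commutator C f"
  have Af1: "fps_X * commutator A f1 = C - fps_X * f * A"
    using fA by (simp add: algebra_simps)
  have "fps_X * commutator C f1 = commutator (fps_X * commutator A f1) f - fps_X * commutator A (commutator f1 f)"
    by (simp add: algebra_simps fps_X_left_commute)
  also have "\<dots> = commutator (C - fps_X * f * A) f + fps_X * (C * f + f * C)"
    by (simp only: ff Af1) (simp add: algebra_simps)
  also have "\<dots> = G + fps_X * C * f"
    unfolding G_def by (simp add: algebra_simps fps_X_left_commute)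
  finally have 1: "fps_X * commutator C f1 = G + fps_X * C * f" .
  have "fps_X * commutator j G = - commutator (fps_X * (commutator C j + f * A)) f + commutator (fps_X * f * A) f - fps_X * commutator C f1"
    unfolding G_def by (simp add: algebra_simps fps_X_left_commute)
  also have "\<dots> = - commutator C f + commutator (fps_X * f * A) f - (G + fps_X * C * f)"
    by (simp only: 1 jC [symmetric])
  finally have "G + G = fps_X * ((- j - 1) * G + G * j)"
    unfolding G_def by (simp add: algebra_simps fps_X_left_commute)
  then have G: "G = 0" by (rule fps_X_eq_0I)
  then show ?thesis by (simp add: G_def)
qed

text \<open>By the Jacobi identity the two sides differ by [h0, A], which vanishes.\<close>

lemma eC: "commutator e C = D - A"
proof -
  have "commutator e C = commutator B f - commutator h0 A"
    by (simp add: algebra_simps)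
  then show ?thesis by (simp add: h0A)
qed

text \<open>This is the commutator of \<open>eA\<close> with \<open>f\<close>; the term [[e1, f], A]
  vanishes by \<open>h1A\<close>, and A h0 = h0 A by \<open>h0A\<close>.\<close>

lemma eC1: "commutator e C = fps_X * (commutator e1 C + h0 * A + C * e)"
proof -
  have "fps_X * commutator e1 C = commutator (fps_X * (commutator e1 A + A * e)) f 
      - commutator (fps_X * A * e) f - fps_X * commutator (commutator e1 f) A"
    by (simp add: algebra_simps fps_X_left_commute)
  also have "\<dots> = commutator B f - commutator (fps_X * A * e) f"
    by (simp only: h1A eA [symmetric]) simp
  finally have "commutator B f = fps_X * (commutator e1 C + h0 * A + C * e) - fps_X * commutator h0 A"
    by (simp add: algebra_simps fps_X_left_commute)
  then show ?thesis by (simp add: h0A eC)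
qed

lemma h0C: "commutator h0 C = - (C + C)"
proof -
  have "commutator h0 C = commutator (commutator h0 A) f + commutator A (commutator h0 f)"
    by (simp add: algebra_simps)
  also have "\<dots> = - (C + C)"
    by (simp only: h0A h0f) (simp add: algebra_simps)
  finally show ?thesis .
qed

text \<open>Since C commutes with f, the commutator of D - A = [e, C] with f is [h0, C] = - 2
  C.\<close>

lemma Df: "commutator D f = - C"
proof -
  have "commutator D f = C + commutator (D - A) f" by (simp add: algebra_simps)
  also have "commutator (D - A) f = commutator h0 C + commutator e (commutator C f)"
    unfolding eC [symmetric] by (simp add: algebra_simps)
  finally show ?thesis by (simp add: Cf h0C)
qed

abbreviation "A' \<equiv> fps_sh m A"
abbreviation "B' \<equiv> fps_sh m B"
abbreviation "C' \<equiv> fps_sh m C"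
abbreviation "D' \<equiv> fps_sh m D"

lemma sh_f:
  "commutator A' f = C'" "commutator B' f = D' - A'" "commutator C' f = 0" "commutator D' f = - C'"
  using arg_cong[OF Cf, of "fps_sh m"] arg_cong[OF Df, of "fps_sh m"]
  by (simp_all add: sh_simps)

text \<open>This and the next identity arise from \<open>BA\<close> by taking commutators with \<open>f\<close>.\<close>

lemma BA_f: "D * A' - C * B' = A * D' - B * C'"
proof -
  have "commutator (B * A') f = commutator (A * B') f" by (simp only: BA)
  then have "B * commutator A' f + (D - A) * A' = A * commutator B' f + C * B'"
    by (simp only: commutator_mult_left) simp
  then show ?thesis unfolding sh_f by (simp add: algebra_simps)
qed

lemma DC: "D * C' = C * D'"
proof (rule commutator_eq_imp_eq [where a = A and b = B and a' = A' and b' = B' and f = f])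
  show "commutator B f = D - A" "commutator B' f = D' - A'" by (simp_all add: sh_f)
qed (simp_all only: Cf Df sh_f BA_f)

end

section \<open>From \<open>h(z)\<close> to \<open>A(z)\<close>\<close>

text \<open>
  The defect \<open>D\<close> of the claimed identity satisfies \<open>A(z - 1) D(z) + D(z - 1) A(z) = 0\<close>, since \<open>h\<close> is
  the inverse of \<open>A(z) A(z - 1)\<close> up to the central factor \<open>K\<close>.
\<close>

lemma commutator_series_right:
  fixes e e1 h A K :: "'a::complex_algebra fps" and m :: int
  defines "A' \<equiv> fps_sh m A"
  assumes sh: "fps_sh 0 e = e" "fps_sh 0 e1 = e1"
    and comm: "h * A = A * h" "h * A' = A' * h" "A * A' = A' * A"
    and K: "h * (A * A') = K" "\<And>x. K * x = x * K"
    and 0: "h $ 0 = 1" "A $ 0 = 1"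
    and R: "commutator h e = fps_X * (commutator h e1 + h * e + e * h)"
  shows "commutator e A = fps_X * (commutator e1 A + A * e)"
proof -
  define D where "D = commutator e A - fps_X * (commutator e1 A + A * e)"
  \<comment> \<open>Assumption \<open>R\<close> becomes h P = Q h. As h k = K is central,
    \<open>k\<close> behaves like an inverse of \<open>h\<close>, whence P k = k Q.\<close>
  define k P Q where "k = A' * A" and "P = e - fps_X * e - fps_X * e1" and "Q = e + fps_X * e - fps_X * e1"
  \<comment> \<open>With A(z) = z^m A, the defect \<open>D\<close> is z^-(m + 1) times z [e, A(z)] -
    [e1, A(z)] - A(z) e, so it is shifted in degree m + 1.\<close>
  have "fps_sh (m + 1) D = fps_sh (m + 1) (commutator e A) - fps_X * fps_sh m (commutator e1 A + A * e)"
    unfolding D_def by (simp only: fps_sh_diff fps_sh_X)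
  also have "fps_sh m (commutator e1 A + A * e) = commutator e1 A' + A' * e"
    using fps_sh_mult[of 0 m e1 A] fps_sh_mult[of m 0 A e1] fps_sh_mult[of m 0 A e]
    by (simp add: A'_def sh fps_sh_diff fps_sh_add)
  also have "fps_sh (m + 1) (commutator e A) = (1 - fps_X) * commutator e A'"
    using fps_sh_mult[of 0 m e A] fps_sh_mult[of m 0 A e]
    by (simp add: A'_def sh fps_sh_diff fps_sh_succ right_diff_distrib)
  finally have shD: "fps_sh (m + 1) D = (1 - fps_X) * commutator e A' - fps_X * (commutator e1 A' + A' * e)" .
  have D: "A' * D + fps_sh (m + 1) D * A = P * k - k * Q"
    unfolding shD unfolding D_def k_def P_def Q_def
    by (simp add: algebra_simps fps_X_simps)
  have hk: "h * k = K"
    unfolding k_def K(1) [symmetric] by (simp add: comm)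
  have hP: "h * P = Q * h"
    using R unfolding P_def Q_def by (simp add: algebra_simps fps_X_simps)
  have "h * (P * k - k * Q) * h = (h * P) * (k * h) - (h * k) * (Q * h)"
    by (simp add: algebra_simps)
  also have "\<dots> = Q * ((h * k) * h) - (h * k) * (Q * h)"
    unfolding hP by (simp add: mult.assoc)
  also have "\<dots> = 0"
    unfolding hk by (simp add: K(2) mult.assoc)
  finally have "P * k - k * Q = 0"
    by (rule fps_unit_mult_eq_0D) (use 0 in auto)
  then have "A' * D * 1 + 1 * fps_sh (m + 1) D * A = 0"
    using D by simp
  then have "D = 0"
    by (rule fps_sh_eq_0I) (use 0 in \<open>auto simp: A'_def\<close>)
  then show ?thesis by (simp add: D_def)
qed

text \<open>Mirror image of \<open>commutator_series_right\<close>: the defect now satisfies A(z)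
  D(z - 1) + D(z) A(z - 1) = 0.\<close>

lemma commutator_series_left:
  fixes f f1 h A K :: "'a::complex_algebra fps" and m :: int
  defines "A' \<equiv> fps_sh m A"
  assumes sh: "fps_sh 0 f = f" "fps_sh 0 f1 = f1"
    and comm: "h * A = A * h" "h * A' = A' * h" "A * A' = A' * A"
    and K: "h * (A * A') = K" "\<And>x. K * x = x * K"
    and 0: "h $ 0 = 1" "A $ 0 = 1"
    and R: "commutator h f = fps_X * (commutator h f1 - h * f - f * h)"
  shows "commutator A f = fps_X * (commutator A f1 + f * A)"
proof -
  define D where "D = commutator A f - fps_X * (commutator A f1 + f * A)"
  define k P Q where "k = A * A'" and "P = f - fps_X * f - fps_X * f1" and "Q = f + fps_X * f - fps_X * f1"
  have "fps_sh (m + 1) D = fps_sh (m + 1) (commutator A f) - fps_X * fps_sh m (commutator A f1 + f * A)"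
    unfolding D_def by (simp only: fps_sh_diff fps_sh_X)
  also have "fps_sh m (commutator A f1 + f * A) = commutator A' f1 + f * A'"
    using fps_sh_mult[of 0 m f1 A] fps_sh_mult[of m 0 A f1] fps_sh_mult[of 0 m f A]
    by (simp add: A'_def sh fps_sh_diff fps_sh_add)
  also have "fps_sh (m + 1) (commutator A f) = (1 - fps_X) * commutator A' f"
    using fps_sh_mult[of 0 m f A] fps_sh_mult[of m 0 A f]
    by (simp add: A'_def sh fps_sh_diff fps_sh_succ right_diff_distrib)
  finally have shD: "fps_sh (m + 1) D = (1 - fps_X) * commutator A' f - fps_X * (commutator A' f1 + f * A')" .
  have D: "A * fps_sh (m + 1) D + D * A' = k * P - Q * k"
    unfolding shD unfolding D_def k_def P_def Q_def
    by (simp add: algebra_simps fps_X_simps)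
  have hk: "h * k = K"
    unfolding k_def K(1) [symmetric] by simp
  have hQ: "h * Q = P * h"
    using R unfolding P_def Q_def by (simp add: algebra_simps fps_X_simps)
  have "h * (k * P - Q * k) * h = (h * k) * (P * h) - (h * Q) * (k * h)"
    by (simp add: algebra_simps)
  also have "\<dots> = (h * k) * (P * h) - P * ((h * k) * h)"
    unfolding hQ by (simp add: mult.assoc)
  also have "\<dots> = 0"
    unfolding hk by (simp add: K(2) mult.assoc)
  finally have "k * P - Q * k = 0"
    by (rule fps_unit_mult_eq_0D) (use 0 in auto)
  then have "1 * D * A' + A * fps_sh (m + 1) D * 1 = 0"
    using D by (simp add: add.commute)
  then have "D = 0"
    by (rule fps_sh_eq_0I) (use 0 in \<open>auto simp: A'_def\<close>)
  then show ?thesis by (simp add: D_def)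
qed

section \<open>Products of monodromy matrices\<close>

text \<open>\<open>S\<close> and \<open>T\<close> are the series with coefficients in the first and
  in the second tensor factor. A product of an element of \<open>S\<close> and one of
  \<open>T\<close> plays the role of a pure tensor.\<close>

locale monodromy_product =
  a: monodromy ea fa ja Aa m Ka + b: monodromy eb fb jb Ab n Kb
  for ea fa ja Aa Ka eb fb jb Ab Kb :: "'a::complex_algebra fps" and m n +
  fixes S T :: "'a fps set"
  assumes ST: "x \<in> S \<Longrightarrow> y \<in> T \<Longrightarrow> y * x = x * y"
    and S_closed: "x \<in> S \<Longrightarrow> x' \<in> S \<Longrightarrow> x * x' \<in> S" "x \<in> S \<Longrightarrow> x' \<in> S \<Longrightarrow> x + x' \<in> S"
      "x \<in> S \<Longrightarrow> x' \<in> S \<Longrightarrow> x - x' \<in> S" "x \<in> S \<Longrightarrow> fps_sh k x \<in> S"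
    and T_closed: "x \<in> T \<Longrightarrow> x' \<in> T \<Longrightarrow> x * x' \<in> T" "x \<in> T \<Longrightarrow> x' \<in> T \<Longrightarrow> x + x' \<in> T"
      "x \<in> T \<Longrightarrow> x' \<in> T \<Longrightarrow> x - x' \<in> T" "x \<in> T \<Longrightarrow> fps_sh k x \<in> T"
    and in_S [simp]: "ea \<in> S" "fa \<in> S" "ja \<in> S" "Aa \<in> S"
    and in_T [simp]: "eb \<in> T" "fb \<in> T" "jb \<in> T" "Ab \<in> T"
begin

lemma mem_S [simp]:
  "a.B \<in> S" "a.C \<in> S" "a.D \<in> S" "a.h0 \<in> S" "a.e1 \<in> S"
  "a.A' \<in> S" "a.B' \<in> S" "a.C' \<in> S" "a.D' \<in> S"
  by (intro S_closed in_S)+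

lemma mem_T [simp]:
  "b.B \<in> T" "b.C \<in> T" "b.D \<in> T" "b.h0 \<in> T" "b.e1 \<in> T"
  "b.A' \<in> T" "b.B' \<in> T" "b.C' \<in> T" "b.D' \<in> T"
  by (intro T_closed in_T)+

lemma mult_mult:
  assumes "x' \<in> S" "y \<in> T"
  shows "(x * y) * (x' * y') = (x * x') * (y * y')"
proof -
  have "y * (x' * y') = x' * (y * y')"
    using ST [OF assms] by (metis mult.assoc)
  then show ?thesis by (simp add: mult.assoc)
qed

lemma mult_mult_sum:
  assumes "x1' \<in> S" "x2' \<in> S" "y1 \<in> T" "y2 \<in> T"
  shows "(x1 * y1 + x2 * y2) * (x1' * y1' + x2' * y2') =
    (x1 * x1') * (y1 * y1') + (x1 * x2') * (y1 * y2') + (x2 * x1') * (y2 * y1') + (x2 * x2') * (y2 * y2')"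
  using assms by (simp only: distrib_left distrib_right mult_mult add_ac)

lemma commutator_mult_mult:
  assumes "x \<in> S" "u \<in> S" "y \<in> T" "v \<in> T"
  shows "commutator (x * y) (u * v) = (x * u) * (y * v) - (u * x) * (v * y)"
  by (simp only: mult_mult [OF assms(2,3)] mult_mult [OF assms(1,4)])

lemma commutator_ST:
  assumes "x \<in> S" "y \<in> T" 
  shows "commutator x y = 0" "commutator y x = 0"
  using ST [OF assms] by simp_all

lemma commutator_S:
  assumes "x \<in> S" "y \<in> T" "z \<in> S"
  shows "commutator z (x * y) = commutator z x * y" "commutator (x * y) z = commutator x z * y"
  using ST [OF assms(3,2)] by (simp_all add: algebra_simps)

lemma commutator_T:
  assumes "x \<in> S" "y \<in> T" "z \<in> T"
  shows "commutator z (x * y) = x * commutator z y" "commutator (x * y) z = x * commutator y z"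
proof -
  have "z * (x * y) = x * (z * y)"
    using ST [OF assms(1,3)] by (metis mult.assoc)
  then show "commutator z (x * y) = x * commutator z y" "commutator (x * y) z = x * commutator y z"
    by (simp_all add: algebra_simps)
qed

lemma commutator_add:
  "commutator (x + x') y = commutator x y + commutator x' (y :: 'a fps)"
  "commutator y (x + x') = commutator y x + commutator y (x' :: 'a fps)"
  "commutator (x - x') y = commutator x y - commutator x' (y :: 'a fps)"
  by (simp_all add: algebra_simps)

lemma commutator_sum:
  assumes "x \<in> S" "x' \<in> S" "u \<in> S" "y \<in> T" "y' \<in> T" "v \<in> T"
  shows "commutator (x * y + x' * y') (u + v) =
      commutator x u * y + x * commutator y v + (commutator x' u * y' + x' * commutator y' v)"
    and "commutator (u + v) (x * y + x' * y') =
      commutator u x * y + x * commutator v y + (commutator u x' * y' + x' * commutator v y')"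
  using assms by (simp_all only: commutator_add commutator_S commutator_T add_ac)

lemma commutator_sum3:
  assumes "x \<in> S" "u \<in> S" "u' \<in> S" "y \<in> T" "v \<in> T" "v' \<in> T"
  shows "commutator (x + y + w) (u * v + u' * v') =
      (commutator x u * v + commutator x u' * v') + (u * commutator y v + u' * commutator y v')
      + (commutator w (u * v) + commutator w (u' * v'))"
  using assms by (simp only: commutator_add commutator_S commutator_T add_ac)

text \<open>The correction term in \<open>j\<close> is the one occurring in \<open>\<Delta>(j) = j \<otimes> 1 + 1 \<otimes> j - f \<otimes> e\<close>.\<close>

definition "e \<equiv> ea + eb"
definition "f \<equiv> fa + fb"
definition "j \<equiv> ja + jb - fa * eb"
definition "A \<equiv> Aa * Ab + a.C * b.B"

text \<open>By \<open>a.jC\<close> and \<open>b.jB\<close> the terms with z cancel in [j, C]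
  \<otimes> B + C \<otimes> [j, B]. What is left, f A \<otimes> B - C \<otimes> A e, is the
  commutator of the correction term f \<otimes> e with A \<otimes> A.\<close>

lemma jA: "commutator j A = 0"
proof -
  have 1: "fps_X * commutator ja a.C = fps_X * fa * Aa - a.C"
    using a.jC by (simp add: algebra_simps)
  have 2: "fps_X * commutator jb b.B = b.B - fps_X * Ab * eb"
    using b.jB by (simp add: algebra_simps)
  have 3: "commutator (fa * eb) (Aa * Ab) = fa * Aa * b.B - a.C * Ab * eb"
    by (subst commutator_mult_mult) (simp_all add: algebra_simps)
  have "commutator (fa * eb) (a.C * b.B) = (fa * a.C) * (eb * b.B) - (a.C * fa) * (b.B * eb)"
    by (rule commutator_mult_mult) simp_all
  also have "\<dots> = 0"
    using a.Cf b.eB by simp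
  finally have 4: "commutator (fa * eb) (a.C * b.B) = 0" .
  have "commutator j A = commutator ja a.C * b.B + a.C * commutator jb b.B - (fa * Aa * b.B - a.C * Ab * eb)"
    unfolding j_def A_def commutator_add 3 4
    by (simp add: commutator_S commutator_T a.jA b.jA)
  \<comment> \<open>Multiplying by \<open>fps_X\<close> avoids the factor z, which is not a power
    series in z^-1.\<close>
  then have "fps_X * commutator j A = (fps_X * commutator ja a.C) * b.B + a.C * (fps_X * commutator jb b.B)
      - fps_X * (fa * Aa * b.B - a.C * Ab * eb)"
    by (simp only: distrib_left right_diff_distrib [of fps_X "_ + _"] mult.assoc fps_X_left_commute)
  also have "\<dots> = (fps_X * fa * Aa - a.C) * b.B + a.C * (b.B - fps_X * Ab * eb) 
      - fps_X * (fa * Aa * b.B - a.C * Ab * eb)"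
    unfolding 1 2 ..
  also have "\<dots> = 0"
    by (simp only: left_diff_distrib right_diff_distrib mult.assoc fps_X_left_commute) simp
  finally show ?thesis by (rule fps_X_mult_eq_0D)
qed

text \<open>Let M have rows (A, C) and (B, D). The series \<open>A\<close> is the first entry of the
  matrix product M_a M_b; this lemma and the next two identify its other entries.\<close>

lemma eA_eq: "commutator e A = a.B * Ab + a.D * b.B"
proof -
  have "commutator e A = (a.B * Ab + Aa * b.B) + (commutator ea a.C * b.B + a.C * commutator eb b.B)"
    unfolding e_def A_def by (rule commutator_sum) simp_all
  then show ?thesis
    unfolding a.eC b.eB by (simp add: left_diff_distrib distrib_right)
qed

lemma Af_eq: "commutator A f = Aa * b.C + a.C * b.D"
proof -
  have "commutator A f = a.C * Ab + Aa * b.C + (commutator a.C fa * b.B + a.C * commutator b.B fb)"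
    unfolding f_def A_def by (rule commutator_sum) simp_all
  then show ?thesis
    unfolding a.Cf by (simp add: distrib_left)
qed

lemma Bf_eq: "A + commutator (commutator e A) f = a.D * b.D + a.B * b.C"
proof -
  have "commutator (commutator e A) f = commutator a.B fa * Ab + a.B * b.C + (commutator a.D fa * b.B + a.D * commutator b.B fb)"
    unfolding eA_eq f_def by (rule commutator_sum) simp_all
  then show ?thesis
    unfolding a.Df A_def by (simp add: algebra_simps)
qed

text \<open>The correction term in \<open>j\<close> produces h0 \<otimes> e, so the result has the
  shape of the prescribed value of the coproduct at x^+_1.\<close>

lemma je: "commutator j e = a.e1 + b.e1 + a.h0 * eb"
  unfolding j_def e_def commutator_add
  by (simp add: commutator_S commutator_T commutator_ST) (simp add: algebra_simps)

lemma eA: "commutator e A = fps_X * (commutator (commutator j e) A + A * e)"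
proof -
  have 1: "commutator (a.h0 * eb) (Aa * Ab) = a.h0 * Aa * b.B"
  proof -
    have "commutator (a.h0 * eb) (Aa * Ab) = (a.h0 * Aa) * (eb * Ab) - (Aa * a.h0) * (Ab * eb)"
      by (rule commutator_mult_mult) simp_all
    also have "Aa * a.h0 = a.h0 * Aa"
      using a.h0A by simp
    finally show ?thesis by (simp only: right_diff_distrib)
  qed
  have 2: "commutator (a.h0 * eb) (a.C * b.B) = - ((a.C + a.C) * (eb * b.B))"
  proof -
    have "commutator (a.h0 * eb) (a.C * b.B) = (a.h0 * a.C) * (eb * b.B) - (a.C * a.h0) * (b.B * eb)"
      by (rule commutator_mult_mult) simp_all
    also have "b.B * eb = eb * b.B"
      using b.eB by simp
    also have "(a.h0 * a.C) * (eb * b.B) - (a.C * a.h0) * (eb * b.B) = commutator a.h0 a.C * (eb * b.B)"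
      by (simp only: left_diff_distrib)
    finally show ?thesis by (simp only: a.h0C mult_minus_left)
  qed
  have 3: "commutator (commutator j e) A =
      (commutator a.e1 Aa * Ab + commutator a.e1 a.C * b.B) + (Aa * commutator b.e1 Ab + a.C * (eb * b.B))
      + (a.h0 * Aa * b.B - (a.C + a.C) * (eb * b.B))"
  proof -
    have "commutator (commutator j e) A =
      (commutator a.e1 Aa * Ab + commutator a.e1 a.C * b.B) + (Aa * commutator b.e1 Ab + a.C * commutator b.e1 b.B)
      + (commutator (a.h0 * eb) (Aa * Ab) + commutator (a.h0 * eb) (a.C * b.B))"
      unfolding je A_def by (rule commutator_sum3) simp_all
    then show ?thesis unfolding 1 2 b.e1B add_uminus_conv_diff .
  qed
  have dist: "fps_X * (p * q + r * s + t * u) = fps_X * p * q + fps_X * r * s + t * (fps_X * u)"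
    for p q r s t u :: "'a fps"
    by (simp add: distrib_left mult.assoc fps_X_left_commute)
  have Be: "b.B * eb = eb * b.B" using b.eB by simp
  have "A * e = Aa * ea * Ab + a.C * ea * b.B + Aa * (Ab * eb) + a.C * (b.B * eb)"
  proof -
    have "Ab * ea = ea * Ab" "b.B * ea = ea * b.B"
      by (rule ST; simp)+
    then show ?thesis
      unfolding A_def e_def by (simp only: distrib_left distrib_right mult.assoc add_ac)
  qed
  then have 4: "A * e = Aa * ea * Ab + a.C * ea * b.B + Aa * (Ab * eb) + a.C * (eb * b.B)"
    unfolding Be .
  \<comment> \<open>The terms C \<otimes> e B cancel. The rest is grouped so that
    \<open>fps_X\<close> turns the three brackets into the right-hand sides of \<open>a.eA\<close>,
    \<open>a.eC1\<close> and \<open>b.eA\<close>.\<close>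
  have "commutator (commutator j e) A + A * e = (commutator a.e1 Aa + Aa * ea) * Ab
      + (commutator a.e1 a.C + a.h0 * Aa + a.C * ea) * b.B + Aa * (commutator b.e1 Ab + Ab * eb)"
    unfolding 3 4 by (simp only: distrib_left distrib_right mult.assoc) simp
  then have "fps_X * (commutator (commutator j e) A + A * e) = fps_X * (commutator a.e1 Aa + Aa * ea) * Ab
      + fps_X * (commutator a.e1 a.C + a.h0 * Aa + a.C * ea) * b.B + Aa * (fps_X * (commutator b.e1 Ab + Ab * eb))"
    by (simp only: dist)
  also have "\<dots> = a.B * Ab + (a.D - Aa) * b.B + Aa * b.B"
    unfolding a.eA [symmetric] b.eA [symmetric] a.eC1 [symmetric] a.eC ..
  also have "\<dots> = commutator e A"
    unfolding eA_eq by (simp only: left_diff_distrib) simp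
  finally show ?thesis ..
qed

sublocale lax e f j A "m + n"
proof
  show "fps_sh 0 e = e" "fps_sh 0 f = f"
    by (simp_all add: e_def f_def fps_sh_add a.sh_const b.sh_const)
  show "fps_sh 0 j = j"
    using fps_sh_mult[of 0 0 fa eb] by (simp add: j_def fps_sh_diff fps_sh_add a.sh_const b.sh_const)
  \<comment> \<open>The summand C \<otimes> B does not contribute, as \<open>b.jB\<close> shows B to
    be a multiple of \<open>fps_X\<close>.\<close>
  show "A $ 0 = 1"
    using arg_cong[OF b.jB, of "\<lambda>F. F $ 0"] by (simp add: A_def a.A_0 b.A_0)
qed (fact jA eA)+

text \<open>Of the eight products four cancel in pairs by \<open>a.BA\<close> and
  \<open>a.DC\<close>. In the others the first tensor factor is D A(z - 1) - C B(z - 1) or A D(z -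
  1) - B C(z - 1), and both equal \<open>Ka\<close> by \<open>a.BA_f\<close>.\<close>

lemma qdet: "D * fps_sh (m + n) A - C * fps_sh (m + n) B = Ka * Kb"
proof -
  have collect: "p1 * q1 + p2 * q2 + p3 * q3 + p4 * q4 - (p3 * q3 + p5 * q4 + p6 * q1 + p2 * q2)
      = (p1 - p6) * q1 - (p5 - p4) * q4" for p1 p2 p3 p4 p5 p6 q1 q2 q3 q4 :: "'a fps"
    by (simp add: algebra_simps)
  have AB: "fps_sh (m + n) A = a.A' * b.A' + a.C' * b.B'" "fps_sh (m + n) B = a.B' * b.A' + a.D' * b.B'"
    unfolding eA_eq unfolding A_def fps_sh_add fps_sh_mult by simp_all
  have "D * fps_sh (m + n) A - C * fps_sh (m + n) B =
     (a.D * b.D + a.B * b.C) * (a.A' * b.A' + a.C' * b.B') - (Aa * b.C + a.C * b.D) * (a.B' * b.A' + a.D' * b.B')"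
    unfolding AB Bf_eq Af_eq ..
  also have "\<dots> = (a.D * a.A') * (b.D * b.A') + (a.D * a.C') * (b.D * b.B') + (a.B * a.A') * (b.C * b.A') + (a.B * a.C') * (b.C * b.B')
    - ((Aa * a.B') * (b.C * b.A') + (Aa * a.D') * (b.C * b.B') + (a.C * a.B') * (b.D * b.A') + (a.C * a.D') * (b.D * b.B'))"
    by (simp only: mult_mult_sum mem_S mem_T in_S in_T)
  also have "\<dots> = (a.D * a.A' - a.C * a.B') * (b.D * b.A') - (Aa * a.D' - a.B * a.C') * (b.C * b.B')"
    unfolding a.BA a.DC by (rule collect)
  also have "\<dots> = Ka * (b.D * b.A' - b.C * b.B')"
    unfolding a.BA_f [symmetric] unfolding a.qdet unfolding right_diff_distrib ..
  finally show ?thesis by (simp only: b.qdet)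
qed

end

section \<open>Linear extension on formal linear combinations\<close>

lemma lookup_pm_scale [simp]: "Poly_Mapping.lookup (pm_scale c p) k = c * Poly_Mapping.lookup p k"
  by (simp add: Poly_Mapping.map.rep_eq when_def)

interpretation pm: vector_space "pm_scale :: complex \<Rightarrow> ('k \<Rightarrow>\<^sub>0 complex) \<Rightarrow> _"
  by unfold_locales (auto intro!: poly_mapping_eqI simp: lookup_add algebra_simps)

lemma pm_scale_single [simp]: "pm_scale c (Poly_Mapping.single k d) = Poly_Mapping.single k (c * d)"
  by (rule poly_mapping_eqI) (simp add: lookup_single when_def)

lemma keys_pm_scale: "Poly_Mapping.keys (pm_scale c p) \<subseteq> Poly_Mapping.keys p"
  by (auto simp: in_keys_iff)

lemma keys_minus_subset: "Poly_Mapping.keys (p - q :: 'k \<Rightarrow>\<^sub>0 complex) \<subseteq> Poly_Mapping.keys p \<union> Poly_Mapping.keys q"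
  by (auto simp: in_keys_iff lookup_minus)

lemma pm_induct [consumes 1, case_names zero single_add]:
  fixes p :: "'k \<Rightarrow>\<^sub>0 complex"
  assumes "Poly_Mapping.keys p \<subseteq> S"
    and "P 0"
    and "\<And>k c p. k \<in> S \<Longrightarrow> Poly_Mapping.keys p \<subseteq> S \<Longrightarrow> P p \<Longrightarrow> P (Poly_Mapping.single k c + p)"
  shows "P p"
  using assms(1)
proof (induction "card (Poly_Mapping.keys p)" arbitrary: p)
  case 0
  then have "p = 0" by (auto intro!: poly_mapping_eqI simp: in_keys_iff)
  with assms(2) show ?case by simp
next
  case (Suc n)
  then obtain k where k: "k \<in> Poly_Mapping.keys p"
    by (metis card.empty equals0I nat.distinct(1))
  define q where "q = p - Poly_Mapping.single k (Poly_Mapping.lookup p k)"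
  have p: "p = Poly_Mapping.single k (Poly_Mapping.lookup p k) + q"
    by (simp add: q_def)
  have "Poly_Mapping.keys q = Poly_Mapping.keys p - {k}"
    by (auto simp: q_def in_keys_iff lookup_minus lookup_single when_def split: if_splits)
  with Suc k have q: "n = card (Poly_Mapping.keys q)" "Poly_Mapping.keys q \<subseteq> S" "k \<in> S"
    by (auto simp: card_Diff_singleton)
  with Suc(1) have "P q" by blast
  with q show ?case by (subst p) (rule assms(3))
qed

definition pm_lin :: "('k \<Rightarrow> 'l \<Rightarrow>\<^sub>0 complex) \<Rightarrow> ('k \<Rightarrow>\<^sub>0 complex) \<Rightarrow> 'l \<Rightarrow>\<^sub>0 complex" where
  "pm_lin f p = (\<Sum>k\<in>Poly_Mapping.keys p. pm_scale (Poly_Mapping.lookup p k) (f k))"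

lemma pm_lin_superset:
  assumes "finite K" "Poly_Mapping.keys p \<subseteq> K"
  shows "pm_lin f p = (\<Sum>k\<in>K. pm_scale (Poly_Mapping.lookup p k) (f k))"
  unfolding pm_lin_def by (rule sum.mono_neutral_left) (use assms in \<open>auto simp: in_keys_iff\<close>)

lemma pm_lin_0 [simp]: "pm_lin f 0 = 0"
  by (simp add: pm_lin_def)

lemma pm_lin_add: "pm_lin f (p + q) = pm_lin f p + pm_lin f q"
proof -
  let ?K = "Poly_Mapping.keys p \<union> Poly_Mapping.keys q"
  have "Poly_Mapping.keys (p + q) \<subseteq> ?K" by (rule Poly_Mapping.keys_add)
  then show ?thesis
    by (simp add: pm_lin_superset [of ?K] lookup_add pm.scale_left_distrib sum.distrib)
qed

lemma pm_lin_scale: "pm_lin f (pm_scale c p) = pm_scale c (pm_lin f p)"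
  using keys_pm_scale[of c p]
  by (simp add: pm_lin_superset [of "Poly_Mapping.keys p"] pm.scale_sum_right)

lemma pm_lin_minus: "pm_lin f (- p) = - pm_lin f p"
  using pm_lin_add[of f p "- p"] by (simp add: eq_neg_iff_add_eq_0 add.commute)

lemma pm_lin_diff: "pm_lin f (p - q) = pm_lin f p - pm_lin f q"
  using pm_lin_add[of f p "- q"] by (simp add: pm_lin_minus)

lemma pm_lin_single [simp]: "pm_lin f (Poly_Mapping.single k c) = pm_scale c (f k)"
  by (subst pm_lin_superset [of "{k}"]) (auto simp: keys_single)

lemma pm_lin_add_fun: "pm_lin (\<lambda>k. f k + g k) p = pm_lin f p + pm_lin g p"
  by (simp add: pm_lin_def pm.scale_right_distrib sum.distrib)

lemma pm_lin_scale_fun: "pm_lin (\<lambda>k. pm_scale c (f k)) p = pm_scale c (pm_lin f p)"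
  by (simp add: pm_lin_def pm.scale_sum_right mult.commute)

lemma pm_lin_0_fun [simp]: "pm_lin (\<lambda>k. 0) p = 0"
  by (simp add: pm_lin_def)

lemma pm_lin_diff_fun: "pm_lin (\<lambda>k. f k - g k) p = pm_lin f p - pm_lin g p"
  by (simp add: pm_lin_def pm.scale_right_diff_distrib sum_subtractf)

lemma keys_pm_lin:
  assumes "\<And>k. k \<in> Poly_Mapping.keys p \<Longrightarrow> Poly_Mapping.keys (f k) \<subseteq> S"
  shows "Poly_Mapping.keys (pm_lin f p) \<subseteq> S"
proof
  fix l assume "l \<in> Poly_Mapping.keys (pm_lin f p)"
  then have "(\<Sum>k\<in>Poly_Mapping.keys p. Poly_Mapping.lookup p k * Poly_Mapping.lookup (f k) l) \<noteq> 0"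
    by (simp add: in_keys_iff pm_lin_def lookup_sum)
  then obtain k where "k \<in> Poly_Mapping.keys p" "Poly_Mapping.lookup p k * Poly_Mapping.lookup (f k) l \<noteq> 0"
    by (rule sum.not_neutral_contains_not_neutral)
  then show "l \<in> S"
    using assms[of k] by (auto simp: in_keys_iff)
qed

section \<open>Complex algebras as records\<close>

lemma alg_homI:
  "f \<in> ring_hom A B \<Longrightarrow> (\<And>c x. x \<in> carrier A \<Longrightarrow> f (c \<odot>\<^bsub>A\<^esub> x) = c \<odot>\<^bsub>B\<^esub> f x) \<Longrightarrow> f \<in> alg_hom A B"
  by (simp add: alg_hom_def)

lemma alg_homD:
  assumes "f \<in> alg_hom A B"
  shows "f \<in> ring_hom A B" "x \<in> carrier A \<Longrightarrow> f (c \<odot>\<^bsub>A\<^esub> x) = c \<odot>\<^bsub>B\<^esub> f x"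
  using assms by (simp_all add: alg_hom_def)

locale cplx_alg = ring A for A :: "(complex, 'a) module" (structure) +
  assumes smult_closed [simp, intro]: "x \<in> carrier A \<Longrightarrow> c \<odot> x \<in> carrier A"
    and smult_l_distr: "x \<in> carrier A \<Longrightarrow> (c + d) \<odot> x = c \<odot> x \<oplus> d \<odot> x"
    and smult_r_distr: "x \<in> carrier A \<Longrightarrow> y \<in> carrier A \<Longrightarrow> c \<odot> (x \<oplus> y) = c \<odot> x \<oplus> c \<odot> y"
    and smult_assoc1: "x \<in> carrier A \<Longrightarrow> (c * d) \<odot> x = c \<odot> (d \<odot> x)"
    and smult_one: "x \<in> carrier A \<Longrightarrow> 1 \<odot> x = x"
    and smult_mult_left: "x \<in> carrier A \<Longrightarrow> y \<in> carrier A \<Longrightarrow> (c \<odot> x) \<otimes> y = c \<odot> (x \<otimes> y)"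
    and smult_mult_right: "x \<in> carrier A \<Longrightarrow> y \<in> carrier A \<Longrightarrow> x \<otimes> (c \<odot> y) = c \<odot> (x \<otimes> y)"

locale cplx_alg_ideal = cplx_alg A + ideal I A for A :: "(complex, 'a) module" (structure) and I
begin

lemma smult_ideal:
  assumes "x \<in> I"
  shows "c \<odot> x \<in> I"
proof -
  have "c \<odot> x = (c \<odot> \<one>) \<otimes> x"
    using a_Hcarr[OF assms] by (simp add: smult_mult_left)
  then show ?thesis using assms by (simp add: I_l_closed)
qed

lemma quot_alg_simps:
  "carrier (quot_alg A I) = a_rcosets I"
  "\<one>\<^bsub>quot_alg A I\<^esub> = I +> \<one>"
  "\<zero>\<^bsub>quot_alg A I\<^esub> = I"
  by (simp_all add: quot_alg_def ring.defs FactRing_def)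

lemma quot_carrier: "carrier (quot_alg A I) = (\<lambda>x. I +> x) ` carrier A"
  unfolding quot_alg_simps by (auto simp: A_RCOSETS_def' )

lemma quot_add:
  assumes "x \<in> carrier A" "y \<in> carrier A"
  shows "(I +> x) \<oplus>\<^bsub>quot_alg A I\<^esub> (I +> y) = I +> (x \<oplus> y)"
  using a_rcos_sum[OF assms] by (simp add: quot_alg_def ring.defs FactRing_def)

lemma quot_mult:
  assumes "x \<in> carrier A" "y \<in> carrier A"
  shows "(I +> x) \<otimes>\<^bsub>quot_alg A I\<^esub> (I +> y) = I +> (x \<otimes> y)"
  using rcoset_mult_add[OF assms] by (simp add: quot_alg_def ring.defs FactRing_def)

lemma coset_eqI:
  assumes "x \<in> carrier A" "y \<in> carrier A" "x \<ominus> y \<in> I"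
  shows "I +> x = I +> y"
  using assms quotient_eq_iff_same_a_r_cos[OF ideal_axioms assms(1,2)] by simp

text \<open>The union in \<open>quot_alg\<close> runs over copies of a single coset, because ideals
  are stable under scalars.\<close>

lemma quot_smult:
  assumes "x \<in> carrier A"
  shows "c \<odot>\<^bsub>quot_alg A I\<^esub> (I +> x) = I +> (c \<odot> x)"
proof -
  have eq: "I +> c \<odot> y = I +> c \<odot> x" if y: "y \<in> I +> x" for y
  proof -
    obtain i where i: "i \<in> I" "y = i \<oplus> x"
      using y unfolding a_r_coset_def' by auto
    then have "c \<odot> y = c \<odot> i \<oplus> c \<odot> x"
      using assms a_Hcarr by (simp add: smult_r_distr)
    then have "c \<odot> y \<in> I +> c \<odot> x"
      using i smult_ideal by (auto simp: a_r_coset_def')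
    then show ?thesis
      using a_repr_independence'[of "c \<odot> y" "c \<odot> x"] assms by simp
  qed
  have "c \<odot>\<^bsub>quot_alg A I\<^esub> (I +> x) = (\<Union>y\<in>I +> x. I +> c \<odot> y)"
    by (simp add: quot_alg_def module.defs ring.defs)
  also have "\<dots> = (\<Union>y\<in>I +> x. I +> c \<odot> x)"
    using eq by simp
  also have "\<dots> = I +> c \<odot> x"
    using a_rcos_self[OF assms] by blast
  finally show ?thesis .
qed

lemma quot_ring: "ring (quot_alg A I)"
proof -
  interpret Q: ring "A Quot I" by (rule quotient_is_ring)
  have eqs: "carrier (quot_alg A I) = carrier (A Quot I)" "\<one>\<^bsub>quot_alg A I\<^esub> = \<one>\<^bsub>A Quot I\<^esub>"
    "\<zero>\<^bsub>quot_alg A I\<^esub> = \<zero>\<^bsub>A Quot I\<^esub>" "monoid.mult (quot_alg A I) = monoid.mult (A Quot I)"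
    "ring.add (quot_alg A I) = ring.add (A Quot I)"
    by (simp_all add: quot_alg_def ring.defs)
  show ?thesis
  proof (intro ringI abelian_groupI monoidI, unfold eqs)
    show "\<exists>y\<in>carrier (A Quot I). y \<oplus>\<^bsub>A Quot I\<^esub> x = \<zero>\<^bsub>A Quot I\<^esub>" if "x \<in> carrier (A Quot I)" for x
      using Q.l_neg[OF that] Q.a_inv_closed[OF that] by (rule bexI)
  qed ((rule Q.a_closed Q.zero_closed Q.a_assoc Q.a_comm Q.l_zero Q.m_closed Q.one_closed Q.m_assoc
        Q.l_one Q.r_one Q.l_distr Q.r_distr; assumption)+)
qed

lemma quot_cplx_alg: "cplx_alg (quot_alg A I)"
proof -
  interpret Q: ring "quot_alg A I" by (rule quot_ring)
  show ?thesis
    by unfold_locales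
      (auto simp: quot_carrier quot_smult quot_add quot_mult smult_l_distr smult_r_distr smult_assoc1
        smult_one smult_mult_left smult_mult_right)
qed

lemma quot_proj: "(\<lambda>x. I +> x) \<in> alg_hom A (quot_alg A I)"
  unfolding alg_hom_def
  by (auto intro!: ring_hom_memI simp: quot_smult quot_add quot_mult quot_carrier quot_alg_simps(2))

lemma quot_lift:
  assumes T: "cplx_alg T" and f: "f \<in> alg_hom A T" and I: "\<And>x. x \<in> I \<Longrightarrow> f x = \<zero>\<^bsub>T\<^esub>"
  obtains f' where "f' \<in> alg_hom (quot_alg A I) T" "\<And>x. x \<in> carrier A \<Longrightarrow> f' (I +> x) = f x"
proof -
  interpret T: cplx_alg T by (rule T)
  have hom: "f \<in> ring_hom A T" and smult: "\<And>c x. x \<in> carrier A \<Longrightarrow> f (c \<odot> x) = c \<odot>\<^bsub>T\<^esub> f x"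
    using f by (simp_all add: alg_homD)
  \<comment> \<open>Any representative gives the same value, since \<open>f\<close> vanishes on
    \<open>I\<close>.\<close>
  define f' where "f' S = f (SOME x. x \<in> S)" for S
  have f': "f' (I +> x) = f x" if x: "x \<in> carrier A" for x
  proof -
    have "(SOME y. y \<in> I +> x) \<in> I +> x"
      using a_rcos_self[OF x] by (rule someI)
    then obtain i where i: "i \<in> I" "(SOME y. y \<in> I +> x) = i \<oplus> x"
      unfolding a_r_coset_def' by auto
    then show ?thesis
      using x a_Hcarr[OF i(1)] ring_hom_add[OF hom, of i x] I ring_hom_closed[OF hom x]
      by (simp add: f'_def)
  qed
  have "f' \<in> alg_hom (quot_alg A I) T"
    unfolding alg_hom_def
    by (auto intro!: ring_hom_memI simp: quot_carrier quot_smult quot_add quot_mult quot_alg_simps(2) f'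
        smult ring_hom_closed[OF hom] ring_hom_add[OF hom] ring_hom_mult[OF hom] ring_hom_one[OF hom])
  then show ?thesis using f' by (rule that)
qed

end

lemma alg_hom_compose:
  assumes "f \<in> alg_hom A B" "g \<in> alg_hom B C"
  shows "(\<lambda>x. g (f x)) \<in> alg_hom A C"
proof -
  note f = alg_homD[OF assms(1)] and g = alg_homD[OF assms(2)]
  show ?thesis
  proof (intro alg_homI ring_hom_memI)
    fix c x assume x: "x \<in> carrier A"
    show "g (f (c \<odot>\<^bsub>A\<^esub> x)) = c \<odot>\<^bsub>C\<^esub> g (f x)"
      by (simp only: f(2)[OF x] g(2)[OF ring_hom_closed[OF f(1) x]])
  qed (simp_all only: ring_hom_closed[OF f(1)] ring_hom_add[OF f(1)] ring_hom_mult[OF f(1)] ring_hom_one[OF f(1)]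
     ring_hom_closed[OF g(1)] ring_hom_add[OF g(1)] ring_hom_mult[OF g(1)] ring_hom_one[OF g(1)])
qed

lemma alg_hom_genideal_eq_zero:
  assumes A: "cplx_alg A" and T: "cplx_alg T" and f: "f \<in> alg_hom A T"
    and S: "S \<subseteq> carrier A" "\<And>x. x \<in> S \<Longrightarrow> f x = \<zero>\<^bsub>T\<^esub>"
    and x: "x \<in> Idl\<^bsub>A\<^esub> S"
  shows "f x = \<zero>\<^bsub>T\<^esub>"
proof -
  have "ring A" "ring T"
    by (fact cplx_alg.axioms(1) [OF A] cplx_alg.axioms(1) [OF T])+
  moreover have "f \<in> ring_hom A T"
    using f by (rule alg_homD(1))
  ultimately have "ring_hom_ring A T f"
    by (rule ring_hom_ringI2)
  then have "ideal (a_kernel A T f) A"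
    by (rule ring_hom_ring.kernel_is_ideal)
  moreover have "S \<subseteq> a_kernel A T f"
    using S unfolding a_kernel_def' by blast
  ultimately have "Idl\<^bsub>A\<^esub> S \<subseteq> a_kernel A T f"
    by (rule ring.genideal_minimal [OF \<open>ring A\<close>])
  then show ?thesis
    using x unfolding a_kernel_def' by blast
qed

section \<open>Tensor products\<close>

locale cplx_alg_pair = A: cplx_alg A + B: cplx_alg B
  for A :: "(complex, 'a) module" and B :: "(complex, 'b) module"
begin

abbreviation "P \<equiv> pair_alg A B"
abbreviation "I \<equiv> bilinear_span A B"
abbreviation "pair_mult k l \<equiv> (fst k \<otimes>\<^bsub>A\<^esub> fst l, snd k \<otimes>\<^bsub>B\<^esub> snd l)"

lemma pair_alg_simps:
  "carrier P = {p. Poly_Mapping.keys p \<subseteq> carrier A \<times> carrier B}"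
  "\<one>\<^bsub>P\<^esub> = Poly_Mapping.single (\<one>\<^bsub>A\<^esub>, \<one>\<^bsub>B\<^esub>) 1"
  "\<zero>\<^bsub>P\<^esub> = 0" "p \<oplus>\<^bsub>P\<^esub> q = p + q" "c \<odot>\<^bsub>P\<^esub> p = pm_scale c p"
  by (simp_all add: pair_alg_def)

text \<open>As an iterated linear extension the product is visibly bilinear, so its laws reduce to
  basis elements.\<close>

lemma pair_mult_eq: "p \<otimes>\<^bsub>P\<^esub> q = pm_lin (\<lambda>k. pm_lin (\<lambda>l. Poly_Mapping.single (pair_mult k l) 1) q) p"
proof -
  have "p \<otimes>\<^bsub>P\<^esub> q = (\<Sum>k\<in>Poly_Mapping.keys p. \<Sum>l\<in>Poly_Mapping.keys q.
      Poly_Mapping.single (pair_mult k l) (Poly_Mapping.lookup p k * Poly_Mapping.lookup q l))"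
    by (simp only: pair_alg_def monoid.simps partial_object.simps case_prod_unfold prod.collapse)
  also have "\<dots> = pm_lin (\<lambda>k. pm_lin (\<lambda>l. Poly_Mapping.single (pair_mult k l) 1) q) p"
    by (simp only: pm_lin_def pm.scale_sum_right pm_scale_single mult_1_right)
  finally show ?thesis .
qed

lemma mult_add_left: "(p + p') \<otimes>\<^bsub>P\<^esub> q = p \<otimes>\<^bsub>P\<^esub> q + p' \<otimes>\<^bsub>P\<^esub> q"
  by (simp add: pair_mult_eq pm_lin_add)

lemma mult_add_right: "q \<otimes>\<^bsub>P\<^esub> (p + p') = q \<otimes>\<^bsub>P\<^esub> p + q \<otimes>\<^bsub>P\<^esub> p'"
  by (simp add: pair_mult_eq pm_lin_add pm_lin_add_fun)

lemma mult_diff_left: "(p - p') \<otimes>\<^bsub>P\<^esub> q = p \<otimes>\<^bsub>P\<^esub> q - p' \<otimes>\<^bsub>P\<^esub> q"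
  by (simp add: pair_mult_eq pm_lin_diff)

lemma mult_diff_right: "q \<otimes>\<^bsub>P\<^esub> (p - p') = q \<otimes>\<^bsub>P\<^esub> p - q \<otimes>\<^bsub>P\<^esub> p'"
  by (simp add: pair_mult_eq pm_lin_diff pm_lin_diff_fun)

lemma mult_scale_left: "pm_scale c p \<otimes>\<^bsub>P\<^esub> q = pm_scale c (p \<otimes>\<^bsub>P\<^esub> q)"
  by (simp add: pair_mult_eq pm_lin_scale)

lemma mult_scale_right: "p \<otimes>\<^bsub>P\<^esub> pm_scale c q = pm_scale c (p \<otimes>\<^bsub>P\<^esub> q)"
  by (simp add: pair_mult_eq pm_lin_scale pm_lin_scale_fun)

lemma mult_0 [simp]: "0 \<otimes>\<^bsub>P\<^esub> q = 0" "p \<otimes>\<^bsub>P\<^esub> 0 = 0"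
  by (simp_all add: pair_mult_eq)

lemma mult_single: "Poly_Mapping.single k c \<otimes>\<^bsub>P\<^esub> Poly_Mapping.single l d = Poly_Mapping.single (pair_mult k l) (c * d)"
  by (simp add: pair_mult_eq)

lemma mult_closed:
  assumes "p \<in> carrier P" "q \<in> carrier P"
  shows "p \<otimes>\<^bsub>P\<^esub> q \<in> carrier P"
  unfolding pair_mult_eq pair_alg_simps(1) mem_Collect_eq
  by (intro keys_pm_lin) (use assms in \<open>auto simp: pair_alg_simps(1) dest!: subsetD\<close>)

lemma single_in_carrier: "x \<in> carrier A \<Longrightarrow> y \<in> carrier B \<Longrightarrow> Poly_Mapping.single (x, y) c \<in> carrier P"
  by (simp add: pair_alg_simps(1))

lemma carrier_induct [consumes 1, case_names zero single_add]:
  assumes "p \<in> carrier P" and "Q 0"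
    and "\<And>x y c p. x \<in> carrier A \<Longrightarrow> y \<in> carrier B \<Longrightarrow> p \<in> carrier P \<Longrightarrow> Q p \<Longrightarrow> Q (Poly_Mapping.single (x, y) c + p)"
  shows "Q p"
  using assms(1) unfolding pair_alg_simps(1) mem_Collect_eq
  by (induction rule: pm_induct) (use assms in \<open>auto simp: pair_alg_simps(1)\<close>)

lemma mult_assoc:
  assumes "p \<in> carrier P" "q \<in> carrier P" "r \<in> carrier P"
  shows "(p \<otimes>\<^bsub>P\<^esub> q) \<otimes>\<^bsub>P\<^esub> r = p \<otimes>\<^bsub>P\<^esub> (q \<otimes>\<^bsub>P\<^esub> r)"
  using assms(1)
proof (induction rule: carrier_induct)
  case (single_add x y c p)
  have "(Poly_Mapping.single (x, y) c \<otimes>\<^bsub>P\<^esub> q) \<otimes>\<^bsub>P\<^esub> r = Poly_Mapping.single (x, y) c \<otimes>\<^bsub>P\<^esub> (q \<otimes>\<^bsub>P\<^esub> r)"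
    using assms(2)
  proof (induction rule: carrier_induct)
    case (single_add x' y' c' q)
    have "(Poly_Mapping.single (x, y) c \<otimes>\<^bsub>P\<^esub> Poly_Mapping.single (x', y') c') \<otimes>\<^bsub>P\<^esub> r =
      Poly_Mapping.single (x, y) c \<otimes>\<^bsub>P\<^esub> (Poly_Mapping.single (x', y') c' \<otimes>\<^bsub>P\<^esub> r)"
      using assms(3)
    proof (induction rule: carrier_induct)
      case (single_add x'' y'' c'' r)
      with \<open>x \<in> carrier A\<close> \<open>y \<in> carrier B\<close> \<open>x' \<in> carrier A\<close> \<open>y' \<in> carrier B\<close> show ?case
        by (simp add: mult_add_right mult_single A.m_assoc B.m_assoc mult.assoc)
    qed simp
    with single_add show ?case by (simp add: mult_add_left mult_add_right)
  qed simp
  with single_add show ?case by (simp add: mult_add_left)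
qed simp

lemma pair_ring: "ring P"
proof (intro ringI abelian_groupI monoidI)
  show "\<exists>q\<in>carrier P. q \<oplus>\<^bsub>P\<^esub> p = \<zero>\<^bsub>P\<^esub>" if "p \<in> carrier P" for p
    using that by (intro bexI[of _ "- p"]) (auto simp: pair_alg_simps)
  show "\<one>\<^bsub>P\<^esub> \<otimes>\<^bsub>P\<^esub> p = p" if "p \<in> carrier P" for p
    using that
    by (induction rule: carrier_induct) (simp_all add: pair_alg_simps(2) mult_add_right mult_single)
  show "p \<otimes>\<^bsub>P\<^esub> \<one>\<^bsub>P\<^esub> = p" if "p \<in> carrier P" for p
    using that
    by (induction rule: carrier_induct) (simp_all add: pair_alg_simps(2) mult_add_left mult_single)
  show "x \<oplus>\<^bsub>P\<^esub> y \<in> carrier P" if "x \<in> carrier P" "y \<in> carrier P" for x y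
    using that Poly_Mapping.keys_add[of x y] by (auto simp: pair_alg_simps)
qed (simp_all add: mult_closed mult_assoc, simp_all add: pair_alg_simps mult_add_left mult_add_right add_ac)

lemma pair_cplx_alg: "cplx_alg P"
proof -
  interpret P: ring P by (rule pair_ring)
  show ?thesis
  proof
    show "c \<odot>\<^bsub>P\<^esub> x \<in> carrier P" if "x \<in> carrier P" for c x
      using that keys_pm_scale[of c x] by (auto simp: pair_alg_simps)
  qed (simp_all add: pair_alg_simps mult_scale_left mult_scale_right pm.scale_left_distrib pm.scale_right_distrib)
qed

lemma bilinear_span_induct [consumes 1, case_names zero add scale relator]:
  assumes "p \<in> I"
    and "Q 0" "\<And>p q. Q p \<Longrightarrow> Q q \<Longrightarrow> Q (p + q)" "\<And>c p. Q p \<Longrightarrow> Q (pm_scale c p)"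
    and "\<And>p. p \<in> bilinear_relators A B \<Longrightarrow> Q p"
  shows "Q p"
  using assms(1) unfolding bilinear_span_def
  by (rule pm.span_induct) (auto intro!: pm.subspaceI simp: assms(2-5))

lemma bilinear_span_simps:
  "0 \<in> I" "p \<in> I \<Longrightarrow> q \<in> I \<Longrightarrow> p + q \<in> I" "p \<in> I \<Longrightarrow> pm_scale c p \<in> I"
  "p \<in> I \<Longrightarrow> q \<in> I \<Longrightarrow> p - q \<in> I" "p \<in> I \<Longrightarrow> - p \<in> I"
  unfolding bilinear_span_def
  by (fact pm.span_zero pm.span_add pm.span_scale pm.span_diff pm.span_neg)+

lemma relator_in_span: "p \<in> bilinear_relators A B \<Longrightarrow> p \<in> I"
  unfolding bilinear_span_def by (rule pm.span_base)

lemma bilinear_span_subset: "p \<in> I \<Longrightarrow> p \<in> carrier P"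
proof (induction rule: bilinear_span_induct)
  case (add p q)
  then show ?case using Poly_Mapping.keys_add[of p q] by (auto simp: pair_alg_simps)
next
  case (scale c p)
  then show ?case using keys_pm_scale[of c p] by (auto simp: pair_alg_simps)
next
  case (relator p)
  interpret P: cplx_alg P by (rule pair_cplx_alg)
  have minus: "p - q \<in> carrier P" if "p \<in> carrier P" "q \<in> carrier P" for p q
    using that keys_minus_subset[of p q] by (auto simp: pair_alg_simps(1))
  from relator show ?case
    by cases (auto intro!: minus single_in_carrier)
qed (simp add: pair_alg_simps)

text \<open>Multiplying a relator by a basis element gives a relator of the same kind; this makes
  the span a two-sided ideal.\<close>

lemma single_mult_relator:
  assumes "p \<in> bilinear_relators A B" "u \<in> carrier A" "v \<in> carrier B"
  shows "Poly_Mapping.single (u, v) 1 \<otimes>\<^bsub>P\<^esub> p \<in> I" "p \<otimes>\<^bsub>P\<^esub> Poly_Mapping.single (u, v) 1 \<in> I"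
  using assms
  by (cases; auto intro!: relator_in_span bilinear_relators.intros
      simp: mult_diff_left mult_diff_right mult_single A.r_distr B.r_distr A.l_distr B.l_distr
        A.smult_mult_left A.smult_mult_right B.smult_mult_left B.smult_mult_right)+

lemma single_mult_span:
  assumes "p \<in> I" "u \<in> carrier A" "v \<in> carrier B"
  shows "Poly_Mapping.single (u, v) c \<otimes>\<^bsub>P\<^esub> p \<in> I" "p \<otimes>\<^bsub>P\<^esub> Poly_Mapping.single (u, v) c \<in> I"
proof -
  have c: "Poly_Mapping.single (u, v) c = pm_scale c (Poly_Mapping.single (u, v) 1)" by simp
  have "Poly_Mapping.single (u, v) 1 \<otimes>\<^bsub>P\<^esub> p \<in> I"
    using assms(1) by (induction rule: bilinear_span_induct)
      (auto simp: mult_add_right mult_scale_right assms single_mult_relator bilinear_span_simps)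
  then show "Poly_Mapping.single (u, v) c \<otimes>\<^bsub>P\<^esub> p \<in> I"
    unfolding c mult_scale_left by (rule bilinear_span_simps)
  have "p \<otimes>\<^bsub>P\<^esub> Poly_Mapping.single (u, v) 1 \<in> I"
    using assms(1) by (induction rule: bilinear_span_induct)
      (auto simp: mult_add_left mult_scale_left assms single_mult_relator bilinear_span_simps)
  then show "p \<otimes>\<^bsub>P\<^esub> Poly_Mapping.single (u, v) c \<in> I"
    unfolding c mult_scale_right by (rule bilinear_span_simps)
qed

lemma span_mult:
  assumes "p \<in> I" "q \<in> carrier P"
  shows "q \<otimes>\<^bsub>P\<^esub> p \<in> I" "p \<otimes>\<^bsub>P\<^esub> q \<in> I"
  using assms(2)
  by (induction rule: carrier_induct)
    (auto simp: mult_add_left mult_add_right single_mult_span assms(1) bilinear_span_simps)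

lemma uminus_eq: "p \<in> carrier P \<Longrightarrow> \<ominus>\<^bsub>P\<^esub> p = - p"
proof -
  interpret P: ring P by (rule pair_ring)
  show "p \<in> carrier P \<Longrightarrow> \<ominus>\<^bsub>P\<^esub> p = - p"
    by (intro P.minus_equality) (auto simp: pair_alg_simps)
qed

lemma span_ideal: "ideal I P"
proof (intro idealI pair_ring)
  show "subgroup I (add_monoid P)"
  proof (rule subgroup.intro)
    show "inv\<^bsub>add_monoid P\<^esub> p \<in> I" if "p \<in> I" for p
      using uminus_eq[OF bilinear_span_subset[OF that]] bilinear_span_simps(5)[OF that]
      by (simp add: a_inv_def)
  qed (use bilinear_span_subset bilinear_span_simps in \<open>auto simp: pair_alg_simps(3,4)\<close>)
qed (auto simp: span_mult)

sublocale T: cplx_alg_ideal P I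
  by (intro cplx_alg_ideal.intro pair_cplx_alg span_ideal)

lemma tensor_cplx_alg: "cplx_alg (tensor_alg A B)"
  unfolding tensor_alg_def by (rule T.quot_cplx_alg)

lemma coset_eq: "p \<in> carrier P \<Longrightarrow> q \<in> carrier P \<Longrightarrow> p - q \<in> I \<Longrightarrow> I +>\<^bsub>P\<^esub> p = I +>\<^bsub>P\<^esub> q"
  by (rule T.coset_eqI) (simp_all add: a_minus_def uminus_eq, simp add: pair_alg_simps)

lemma tensor_carrier: "carrier (tensor_alg A B) = (\<lambda>p. I +>\<^bsub>P\<^esub> p) ` carrier P"
  unfolding tensor_alg_def by (rule T.quot_carrier)

lemma pure_tensor_closed: "x \<in> carrier A \<Longrightarrow> y \<in> carrier B \<Longrightarrow> pure_tensor A B x y \<in> carrier (tensor_alg A B)"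
  unfolding tensor_carrier pure_tensor_def by (simp add: single_in_carrier)

lemma pure_tensor_mult:
  assumes "x \<in> carrier A" "y \<in> carrier B" "x' \<in> carrier A" "y' \<in> carrier B"
  shows "pure_tensor A B x y \<otimes>\<^bsub>tensor_alg A B\<^esub> pure_tensor A B x' y' = pure_tensor A B (x \<otimes>\<^bsub>A\<^esub> x') (y \<otimes>\<^bsub>B\<^esub> y')"
  using assms unfolding pure_tensor_def tensor_alg_def
  by (subst T.quot_mult) (simp_all add: single_in_carrier mult_single)

lemma pure_tensor_one: "pure_tensor A B \<one>\<^bsub>A\<^esub> \<one>\<^bsub>B\<^esub> = \<one>\<^bsub>tensor_alg A B\<^esub>"
  unfolding pure_tensor_def tensor_alg_def T.quot_alg_simps by (simp add: pair_alg_simps)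

lemma pure_tensor_add_left:
  assumes "x \<in> carrier A" "x' \<in> carrier A" "y \<in> carrier B"
  shows "pure_tensor A B (x \<oplus>\<^bsub>A\<^esub> x') y = pure_tensor A B x y \<oplus>\<^bsub>tensor_alg A B\<^esub> pure_tensor A B x' y"
proof -
  have "Poly_Mapping.single (x \<oplus>\<^bsub>A\<^esub> x', y) 1 - (Poly_Mapping.single (x, y) 1 \<oplus>\<^bsub>P\<^esub> Poly_Mapping.single (x', y) 1) \<in> I"
    using relator_in_span[OF bilinear_relators.add_left[OF assms]] by (simp add: pair_alg_simps diff_diff_eq)
  then show ?thesis
    using assms unfolding pure_tensor_def tensor_alg_def
    by (subst T.quot_add) (simp_all add: single_in_carrier coset_eq)
qed

lemma pure_tensor_add_right:
  assumes "x \<in> carrier A" "y \<in> carrier B" "y' \<in> carrier B"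
  shows "pure_tensor A B x (y \<oplus>\<^bsub>B\<^esub> y') = pure_tensor A B x y \<oplus>\<^bsub>tensor_alg A B\<^esub> pure_tensor A B x y'"
proof -
  have "Poly_Mapping.single (x, y \<oplus>\<^bsub>B\<^esub> y') 1 - (Poly_Mapping.single (x, y) 1 \<oplus>\<^bsub>P\<^esub> Poly_Mapping.single (x, y') 1) \<in> I"
    using relator_in_span[OF bilinear_relators.add_right[OF assms]] by (simp add: pair_alg_simps diff_diff_eq)
  then show ?thesis
    using assms unfolding pure_tensor_def tensor_alg_def
    by (subst T.quot_add) (simp_all add: single_in_carrier coset_eq)
qed

lemma pure_tensor_smult:
  assumes "x \<in> carrier A" "y \<in> carrier B"
  shows "pure_tensor A B (c \<odot>\<^bsub>A\<^esub> x) y = c \<odot>\<^bsub>tensor_alg A B\<^esub> pure_tensor A B x y"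
    and "pure_tensor A B x (c \<odot>\<^bsub>B\<^esub> y) = c \<odot>\<^bsub>tensor_alg A B\<^esub> pure_tensor A B x y"
proof -
  have *: "c \<odot>\<^bsub>P\<^esub> Poly_Mapping.single (x, y) 1 = Poly_Mapping.single (x, y) c"
    by (simp add: pair_alg_simps)
  show "pure_tensor A B (c \<odot>\<^bsub>A\<^esub> x) y = c \<odot>\<^bsub>tensor_alg A B\<^esub> pure_tensor A B x y"
    using assms relator_in_span[OF bilinear_relators.scale_left[OF assms]] unfolding pure_tensor_def tensor_alg_def
    by (subst T.quot_smult) (simp_all add: * single_in_carrier coset_eq)
  show "pure_tensor A B x (c \<odot>\<^bsub>B\<^esub> y) = c \<odot>\<^bsub>tensor_alg A B\<^esub> pure_tensor A B x y"
    using assms relator_in_span[OF bilinear_relators.scale_right[OF assms]] unfolding pure_tensor_def tensor_alg_def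
    by (subst T.quot_smult) (simp_all add: * single_in_carrier coset_eq)
qed

end

section \<open>Tensor products of algebra morphisms\<close>

locale tensor_hom = src: cplx_alg_pair A B + tgt: cplx_alg_pair C D
  for A :: "(complex, 'a) module" and B :: "(complex, 'b) module"
    and C :: "(complex, 'c) module" and D :: "(complex, 'd) module" +
  fixes f g
  assumes f: "f \<in> alg_hom A C" and g: "g \<in> alg_hom B D"
begin

definition "push = pm_lin (\<lambda>k. Poly_Mapping.single (f (fst k), g (snd k)) 1)"

lemma push_simps [simp]:
  "push 0 = 0" "push (p + q) = push p + push q" "push (p - q) = push p - push q"
  "push (pm_scale c p) = pm_scale c (push p)"
  "push (Poly_Mapping.single (x, y) c) = Poly_Mapping.single (f x, g y) c"
  by (simp_all add: push_def pm_lin_add pm_lin_diff pm_lin_scale)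

lemma f_simps:
  "x \<in> carrier A \<Longrightarrow> f x \<in> carrier C" "x \<in> carrier A \<Longrightarrow> y \<in> carrier A \<Longrightarrow> f (x \<oplus>\<^bsub>A\<^esub> y) = f x \<oplus>\<^bsub>C\<^esub> f y"
  "x \<in> carrier A \<Longrightarrow> y \<in> carrier A \<Longrightarrow> f (x \<otimes>\<^bsub>A\<^esub> y) = f x \<otimes>\<^bsub>C\<^esub> f y"
  "f \<one>\<^bsub>A\<^esub> = \<one>\<^bsub>C\<^esub>" "x \<in> carrier A \<Longrightarrow> f (c \<odot>\<^bsub>A\<^esub> x) = c \<odot>\<^bsub>C\<^esub> f x"
  using f by (auto simp: alg_hom_def ring_hom_closed ring_hom_add ring_hom_mult ring_hom_one)

lemma g_simps:
  "x \<in> carrier B \<Longrightarrow> g x \<in> carrier D" "x \<in> carrier B \<Longrightarrow> y \<in> carrier B \<Longrightarrow> g (x \<oplus>\<^bsub>B\<^esub> y) = g x \<oplus>\<^bsub>D\<^esub> g y"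
  "x \<in> carrier B \<Longrightarrow> y \<in> carrier B \<Longrightarrow> g (x \<otimes>\<^bsub>B\<^esub> y) = g x \<otimes>\<^bsub>D\<^esub> g y"
  "g \<one>\<^bsub>B\<^esub> = \<one>\<^bsub>D\<^esub>" "x \<in> carrier B \<Longrightarrow> g (c \<odot>\<^bsub>B\<^esub> x) = c \<odot>\<^bsub>D\<^esub> g x"
  using g by (auto simp: alg_hom_def ring_hom_closed ring_hom_add ring_hom_mult ring_hom_one)

lemma push_closed: "p \<in> carrier src.P \<Longrightarrow> push p \<in> carrier tgt.P"
  unfolding push_def tgt.pair_alg_simps(1) mem_Collect_eq
  by (intro keys_pm_lin) (auto simp: src.pair_alg_simps(1) f_simps g_simps dest!: subsetD)

lemma push_mult:
  assumes "p \<in> carrier src.P" "q \<in> carrier src.P"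
  shows "push (p \<otimes>\<^bsub>src.P\<^esub> q) = push p \<otimes>\<^bsub>tgt.P\<^esub> push q"
  using assms(1)
proof (induction rule: src.carrier_induct)
  case (single_add x y c p)
  have "push (Poly_Mapping.single (x, y) c \<otimes>\<^bsub>src.P\<^esub> q) = push (Poly_Mapping.single (x, y) c) \<otimes>\<^bsub>tgt.P\<^esub> push q"
    using assms(2)
    by (induction rule: src.carrier_induct)
      (use single_add in \<open>simp_all add: src.mult_add_right tgt.mult_add_right src.mult_single tgt.mult_single f_simps g_simps\<close>)
  with single_add show ?case by (simp add: src.mult_add_left tgt.mult_add_left)
qed simp

lemma push_span: "p \<in> src.I \<Longrightarrow> push p \<in> tgt.I"
proof (induction rule: src.bilinear_span_induct)
  case (relator p)
  then have "push p \<in> bilinear_relators C D"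
    by cases (auto simp: f_simps g_simps intro!: bilinear_relators.intros)
  then show ?case by (rule tgt.relator_in_span)
qed (simp_all add: tgt.bilinear_span_simps)

text \<open>\<open>push\<close> respects the bilinear spans, so the union defining
  \<open>tensor_map\<close> consists of equal cosets.\<close>

lemma tensor_map_coset:
  assumes "p \<in> carrier src.P"
  shows "tensor_map C D f g (src.I +>\<^bsub>src.P\<^esub> p) = tgt.I +>\<^bsub>tgt.P\<^esub> push p"
proof -
  have push: "(\<Sum>(x, y)\<in>Poly_Mapping.keys q. Poly_Mapping.single (f x, g y) (Poly_Mapping.lookup q (x, y))) = push q" for q
    by (simp add: push_def pm_lin_def case_prod_unfold)
  have eq: "tgt.I +>\<^bsub>tgt.P\<^esub> push q = tgt.I +>\<^bsub>tgt.P\<^esub> push p" if q: "q \<in> src.I +>\<^bsub>src.P\<^esub> p" for q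
  proof -
    obtain i where i: "i \<in> src.I" "q = i + p"
      using q unfolding a_r_coset_def' by (auto simp: src.pair_alg_simps)
    then have q: "q \<in> carrier src.P"
      using assms src.bilinear_span_subset[OF i(1)] Poly_Mapping.keys_add[of i p]
      by (auto simp: src.pair_alg_simps(1))
    show ?thesis
      by (rule tgt.coset_eq [OF push_closed [OF q] push_closed [OF assms]])
        (use i in \<open>simp add: push_span\<close>)
  qed
  moreover have "p \<in> src.I +>\<^bsub>src.P\<^esub> p"
    using assms by (rule src.T.a_rcos_self)
  ultimately show ?thesis
    unfolding tensor_map_def push by blast
qed

lemma tensor_map_hom: "tensor_map C D f g \<in> alg_hom (tensor_alg A B) (tensor_alg C D)"
proof -
  let ?t = "tensor_map C D f g"
  show ?thesis
    unfolding tensor_alg_def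
  proof (intro alg_homI ring_hom_memI; (unfold src.T.quot_carrier, elim imageE, hypsubst)?)
    fix p assume p: "p \<in> carrier src.P"
    show "?t (src.I +>\<^bsub>src.P\<^esub> p) \<in> carrier (quot_alg tgt.P tgt.I)"
      unfolding tgt.T.quot_carrier by (simp add: tensor_map_coset p push_closed)
    fix c
    have "pm_scale c p \<in> carrier src.P"
      using src.T.smult_closed[OF p, of c] by (simp add: src.pair_alg_simps(5))
    then show "?t (c \<odot>\<^bsub>quot_alg src.P src.I\<^esub> (src.I +>\<^bsub>src.P\<^esub> p)) =
        c \<odot>\<^bsub>quot_alg tgt.P tgt.I\<^esub> ?t (src.I +>\<^bsub>src.P\<^esub> p)"
      by (simp add: src.T.quot_smult tgt.T.quot_smult tensor_map_coset p push_closed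
          src.pair_alg_simps(5) tgt.pair_alg_simps(5))
    fix q assume q: "q \<in> carrier src.P"
    show "?t ((src.I +>\<^bsub>src.P\<^esub> p) \<otimes>\<^bsub>quot_alg src.P src.I\<^esub> (src.I +>\<^bsub>src.P\<^esub> q)) =
        ?t (src.I +>\<^bsub>src.P\<^esub> p) \<otimes>\<^bsub>quot_alg tgt.P tgt.I\<^esub> ?t (src.I +>\<^bsub>src.P\<^esub> q)"
      by (simp add: src.T.quot_mult tgt.T.quot_mult tensor_map_coset p q push_closed push_mult src.mult_closed)
    have "p + q \<in> carrier src.P"
      using src.T.add.m_closed[OF p q] by (simp add: src.pair_alg_simps(4))
    then show "?t ((src.I +>\<^bsub>src.P\<^esub> p) \<oplus>\<^bsub>quot_alg src.P src.I\<^esub> (src.I +>\<^bsub>src.P\<^esub> q)) =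
        ?t (src.I +>\<^bsub>src.P\<^esub> p) \<oplus>\<^bsub>quot_alg tgt.P tgt.I\<^esub> ?t (src.I +>\<^bsub>src.P\<^esub> q)"
      by (simp add: src.T.quot_add tgt.T.quot_add tensor_map_coset p q push_closed
          src.pair_alg_simps(4) tgt.pair_alg_simps(4))
  next
    have "push \<one>\<^bsub>src.P\<^esub> = \<one>\<^bsub>tgt.P\<^esub>"
      by (simp add: src.pair_alg_simps(2) tgt.pair_alg_simps(2) f_simps g_simps)
    then show "?t \<one>\<^bsub>quot_alg src.P src.I\<^esub> = \<one>\<^bsub>quot_alg tgt.P tgt.I\<^esub>"
      by (simp add: src.T.quot_alg_simps(2) tgt.T.quot_alg_simps(2) tensor_map_coset)
  qed
qed

lemma tensor_map_pure:
  assumes "x \<in> carrier A" "y \<in> carrier B"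
  shows "tensor_map C D f g (pure_tensor A B x y) = pure_tensor C D (f x) (g y)"
  using assms unfolding pure_tensor_def by (simp add: tensor_map_coset src.single_in_carrier)

end

section \<open>The Yangian and its commutation relations\<close>

lemma single_0_mult: "Poly_Mapping.single 0 c * p = p * Poly_Mapping.single 0 (c :: complex)"
  for p :: "'g word \<Rightarrow>\<^sub>0 complex"
proof -
  have "Poly_Mapping.keys p \<subseteq> UNIV" by simp
  then show ?thesis
    by (induction rule: pm_induct) (auto simp: distrib_left distrib_right mult_single mult.commute)
qed

instantiation yangian :: complex_algebra
begin

definition "of_cplx_yangian c = scale_yangian c (1 :: yangian)"

instance
proof
  fix c d :: complex and x :: yangian
  show "(of_cplx (c + d) :: yangian) = of_cplx c + of_cplx d"
    unfolding of_cplx_yangian_def by transfer (simp add: single_add zero_in_yangian_ideal)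
  show "(of_cplx (c * d) :: yangian) = of_cplx c * of_cplx d"
    unfolding of_cplx_yangian_def by transfer (simp add: mult_single zero_in_yangian_ideal)
  show "(of_cplx 1 :: yangian) = 1"
    unfolding of_cplx_yangian_def by transfer (simp add: zero_in_yangian_ideal)
  show "of_cplx c * x = x * of_cplx c"
    unfolding of_cplx_yangian_def by transfer (simp add: single_0_mult zero_in_yangian_ideal)
qed

end

lemma scale_yangian_eq: "scale_yangian c x = of_cplx c * x"
  unfolding of_cplx_yangian_def by transfer (simp add: zero_in_yangian_ideal)

lemma yangian_relation:
  "commutator (h_gen r) (h_gen s) = 0"
  "commutator (h_gen 0) (x_plus s) = x_plus s + x_plus s"
  "commutator (h_gen 0) (x_minus s) = - (x_minus s + x_minus s)"
  "commutator (h_gen (Suc r)) (x_plus s) - commutator (h_gen r) (x_plus (Suc s)) =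
     h_gen r * x_plus s + x_plus s * h_gen r"
  "commutator (h_gen (Suc r)) (x_minus s) - commutator (h_gen r) (x_minus (Suc s)) =
     - (h_gen r * x_minus s + x_minus s * h_gen r)"
  "commutator (x_plus r) (x_minus s) = h_gen (r + s)"
  "commutator (x_plus (Suc r)) (x_plus s) - commutator (x_plus r) (x_plus (Suc s)) =
     x_plus r * x_plus s + x_plus s * x_plus r"
  "commutator (x_minus (Suc r)) (x_minus s) - commutator (x_minus r) (x_minus (Suc s)) =
     - (x_minus r * x_minus s + x_minus s * x_minus r)"
proof -
  note rel = yangian_relators.intros [THEN subsetD [OF yangian_relators_subset]]
  show "commutator (h_gen r) (h_gen s) = 0"
    by (transfer fixing: r s) (use rel(1)[of r s] in simp)
  show "commutator (h_gen 0) (x_plus s) = x_plus s + x_plus s"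
    by (transfer fixing: r s) (use rel(2)[of s] in \<open>simp add: mult_2\<close>)
  have "commutator (h_gen 0) (x_minus s) + (x_minus s + x_minus s) = 0"
    by (transfer fixing: r s) (use rel(3)[of s] in \<open>simp add: mult_2\<close>)
  then show "commutator (h_gen 0) (x_minus s) = - (x_minus s + x_minus s)"
    by (simp only: eq_neg_iff_add_eq_0)
  show "commutator (h_gen (Suc r)) (x_plus s) - commutator (h_gen r) (x_plus (Suc s)) =
     h_gen r * x_plus s + x_plus s * h_gen r"
    by (transfer fixing: r s) (use rel(4)[of r s] in simp)
  have "commutator (h_gen (Suc r)) (x_minus s) - commutator (h_gen r) (x_minus (Suc s)) +
     (h_gen r * x_minus s + x_minus s * h_gen r) = 0"
    by (transfer fixing: r s) (use rel(5)[of r s] in \<open>simp only: Suc_eq_plus1 diff_zero\<close>)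
  then show "commutator (h_gen (Suc r)) (x_minus s) - commutator (h_gen r) (x_minus (Suc s)) =
     - (h_gen r * x_minus s + x_minus s * h_gen r)"
    by (simp only: eq_neg_iff_add_eq_0)
  show "commutator (x_plus r) (x_minus s) = h_gen (r + s)"
    by (transfer fixing: r s) (use rel(6)[of r s] in simp)
  show "commutator (x_plus (Suc r)) (x_plus s) - commutator (x_plus r) (x_plus (Suc s)) =
     x_plus r * x_plus s + x_plus s * x_plus r"
    by (transfer fixing: r s) (use rel(7)[of r s] in simp)
  have "commutator (x_minus (Suc r)) (x_minus s) - commutator (x_minus r) (x_minus (Suc s)) +
     (x_minus r * x_minus s + x_minus s * x_minus r) = 0"
    by (transfer fixing: r s) (use rel(8)[of r s] in \<open>simp only: Suc_eq_plus1 diff_zero\<close>)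
  then show "commutator (x_minus (Suc r)) (x_minus s) - commutator (x_minus r) (x_minus (Suc s)) =
     - (x_minus r * x_minus s + x_minus s * x_minus r)"
    by (simp only: eq_neg_iff_add_eq_0)
qed

lemma commutator_double: "commutator (x + x) y = commutator x y + commutator x (y :: 'a::ring)"
  by (simp add: algebra_simps)

lemma double_cancel: "x + x = y + y \<longleftrightarrow> x = (y :: 'a::complex_algebra)"
proof
  assume "x + x = y + y"
  then have "(x - y) + (x - y) = 0" by (simp add: algebra_simps)
  then show "x = y" by (simp only: double_eq_0_iff) simp
qed simp

lemma half_add_half: "of_cplx (1 / 2) * x + of_cplx (1 / 2) * x = (x :: 'a::complex_algebra)"
proof -
  have "of_cplx (1 / 2) * x + of_cplx (1 / 2) * x = (of_cplx (1 / 2) + of_cplx (1 / 2)) * x"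
    by (simp only: distrib_right)
  then show ?thesis by (simp flip: of_cplx_add)
qed

section \<open>The element j and its action on the generators\<close>

definition j_gen :: yangian where
  "j_gen = of_cplx (1 / 2) * (of_cplx (1 / 2) * (h_gen 1 + h_gen 1 - h_gen 0 * h_gen 0))"

lemma j_gen: "(j_gen + j_gen) + (j_gen + j_gen) = h_gen 1 + h_gen 1 - h_gen 0 * h_gen 0"
  unfolding j_gen_def half_add_half ..

text \<open>The relation for h_1 gives [h_1, x_s] = 2 x_(s+1) + h_0 x_s + x_s h_0, and the quadratic
  part is half of [h_0^2, x_s].\<close>

lemma j_x_plus: "commutator j_gen (x_plus s) = x_plus (Suc s)"
proof -
  let ?c = "\<lambda>y. commutator y (x_plus s)" and ?w = "h_gen 0 * x_plus s + x_plus s * h_gen 0"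
  have 1: "?c (h_gen 1) = x_plus (Suc s) + x_plus (Suc s) + ?w"
    using yangian_relation(4)[of 0 s] yangian_relation(2)[of "Suc s"] by (simp add: algebra_simps)
  have "?c (h_gen 0 * h_gen 0) = h_gen 0 * ?c (h_gen 0) + ?c (h_gen 0) * h_gen 0"
    by (rule commutator_mult_left)
  also have "\<dots> = ?w + ?w"
    unfolding yangian_relation(2) by (simp add: algebra_simps)
  finally have 2: "?c (h_gen 0 * h_gen 0) = ?w + ?w" .
  have "(?c j_gen + ?c j_gen) + (?c j_gen + ?c j_gen) = ?c ((j_gen + j_gen) + (j_gen + j_gen))"
    by (simp only: commutator_double)
  also have "\<dots> = ?c (h_gen 1) + ?c (h_gen 1) - ?c (h_gen 0 * h_gen 0)"
    unfolding j_gen by (simp add: algebra_simps)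
  also have "\<dots> = (x_plus (Suc s) + x_plus (Suc s)) + (x_plus (Suc s) + x_plus (Suc s))"
    unfolding 1 2 by (simp add: algebra_simps)
  finally show ?thesis unfolding double_cancel .
qed

lemma j_x_minus: "commutator (x_minus s) j_gen = x_minus (Suc s)"
proof -
  let ?c = "\<lambda>y. commutator y (x_minus s)" and ?w = "h_gen 0 * x_minus s + x_minus s * h_gen 0"
  have 1: "?c (h_gen 1) = - (x_minus (Suc s) + x_minus (Suc s) + ?w)"
    using yangian_relation(5)[of 0 s] yangian_relation(3)[of "Suc s"] by (simp add: algebra_simps)
  have "?c (h_gen 0 * h_gen 0) = h_gen 0 * ?c (h_gen 0) + ?c (h_gen 0) * h_gen 0"
    by (rule commutator_mult_left)
  also have "\<dots> = - (?w + ?w)"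
    unfolding yangian_relation(3) by (simp add: algebra_simps)
  finally have 2: "?c (h_gen 0 * h_gen 0) = - (?w + ?w)" .
  have "(?c j_gen + ?c j_gen) + (?c j_gen + ?c j_gen) = ?c ((j_gen + j_gen) + (j_gen + j_gen))"
    by (simp only: commutator_double)
  also have "\<dots> = ?c (h_gen 1) + ?c (h_gen 1) - ?c (h_gen 0 * h_gen 0)"
    unfolding j_gen by (simp add: algebra_simps)
  also have "\<dots> = (- x_minus (Suc s) + - x_minus (Suc s)) + (- x_minus (Suc s) + - x_minus (Suc s))"
    unfolding 1 2 by (simp add: algebra_simps)
  finally have "?c j_gen = - x_minus (Suc s)" unfolding double_cancel .
  then show ?thesis by (simp add: algebra_simps)
qed

section \<open>The commutative subalgebra generated by the h_n\<close>

lemma h_subalgebra_of_cplx: "of_cplx c \<in> h_subalgebra"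
  unfolding of_cplx_yangian_def by (rule h_subalgebra.intros)

lemma h_subalgebra_commute:
  assumes "x \<in> h_subalgebra" "y \<in> h_subalgebra"
  shows "x * y = y * x"
proof -
  have gen: "h_gen r * y = y * h_gen r" if "y \<in> h_subalgebra" for r y
    using that
  proof induction
    case (1 c)
    then show ?case by (metis of_cplx_commute of_cplx_yangian_def)
  next
    case (2 s)
    then show ?case using yangian_relation(1)[of r s] by simp
  next
    case (3 x y)
    then show ?case by (simp add: distrib_left distrib_right)
  next
    case (4 x y)
    then show ?case by (metis mult.assoc)
  qed
  show ?thesis
    using assms(1)
  proof induction
    case (1 c)
    then show ?case by (metis of_cplx_commute of_cplx_yangian_def)
  next
    case (2 r)
    then show ?case using gen assms(2) by simp
  next
    case (3 u v)
    then show ?case by (simp add: distrib_left distrib_right)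
  next
    case (4 u v)
    then show ?case by (metis mult.assoc)
  qed
qed

lemma h_subalgebra_0: "0 \<in> h_subalgebra" and h_subalgebra_1: "1 \<in> h_subalgebra"
  using h_subalgebra_of_cplx[of 0] h_subalgebra_of_cplx[of 1] by simp_all

lemma h_subalgebra_minus: "x \<in> h_subalgebra \<Longrightarrow> y \<in> h_subalgebra \<Longrightarrow> x - y \<in> h_subalgebra"
proof -
  assume "x \<in> h_subalgebra" "y \<in> h_subalgebra"
  then have "x + of_cplx (-1) * y \<in> h_subalgebra"
    by (intro h_subalgebra.intros h_subalgebra_of_cplx)
  moreover have "of_cplx (-1) = (-1 :: yangian)"
    using of_cplx_add[of 1 "-1", where ?'a = yangian] by (simp add: add_eq_0_iff)
  ultimately show "x - y \<in> h_subalgebra" by simp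
qed

lemma h_subalgebra_sum: "(\<And>i. i \<in> I \<Longrightarrow> g i \<in> h_subalgebra) \<Longrightarrow> sum g I \<in> h_subalgebra"
  by (induction I rule: infinite_finite_induct) (auto intro: h_subalgebra_0 h_subalgebra.intros)

lemma j_gen_in_h_subalgebra: "j_gen \<in> h_subalgebra"
  unfolding j_gen_def by (intro h_subalgebra.intros h_subalgebra_minus h_subalgebra_of_cplx)

section \<open>The generating series h(z) and e(z)\<close>

definition h_fps :: "yangian fps" where
  "h_fps = 1 + fps_X * Abs_fps h_gen"

definition e_fps :: "yangian fps" where
  "e_fps = fps_X * Abs_fps x_plus"

lemma h_fps_nth: "h_fps $ 0 = 1" "h_fps $ Suc n = h_gen n"
  by (simp_all add: h_fps_def)

lemma e_fps_nth: "e_fps $ 0 = 0" "e_fps $ Suc n = x_plus n"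
  by (simp_all add: e_fps_def)

text \<open>Coefficientwise this is \<open>j_x_plus\<close>. It is the equation required of
  \<open>E\<close> in \<open>quantum_determinant\<close>.\<close>

lemma e_fps_eq: "e_fps = fps_X * (commutator (fps_const j_gen) e_fps + fps_const (x_plus 0))"
proof (rule fps_ext)
  fix n
  consider "n = 0" | "n = 1" | r where "n = Suc (Suc r)" by (metis One_nat_def not0_implies_Suc)
  then show "e_fps $ n = (fps_X * (commutator (fps_const j_gen) e_fps + fps_const (x_plus 0))) $ n"
    by cases (use j_x_plus in \<open>simp_all add: e_fps_nth\<close>)
qed

lemma h_fps_eq: "h_fps = 1 + commutator e_fps (fps_const (x_minus 0))"
proof (rule fps_ext)
  fix n show "h_fps $ n = (1 + commutator e_fps (fps_const (x_minus 0))) $ n"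
    using yangian_relation(6)[of _ 0] by (cases n) (simp_all add: h_fps_nth e_fps_nth)
qed

section \<open>Existence and uniqueness of A(z) as a normalised power series\<close>

definition fps_of_cplx :: "complex fps \<Rightarrow> 'a::complex_algebra fps" where
  "fps_of_cplx k = Abs_fps (\<lambda>i. of_cplx (k $ i))"

lemma fps_of_cplx_nth [simp]: "fps_of_cplx k $ i = of_cplx (k $ i)"
  by (simp add: fps_of_cplx_def)

lemma fps_of_cplx_mult: "fps_of_cplx (k * l) = fps_of_cplx k * fps_of_cplx l"
  by (simp add: fps_eq_iff fps_mult_nth of_cplx_sum of_cplx_mult)

lemma fps_commuteI:
  fixes F G :: "'a::ring_1 fps"
  assumes "\<And>i k. F $ i * G $ k = G $ k * F $ i"
  shows "F * G = G * F"
proof (rule fps_ext)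
  fix n
  have "(F * G) $ n = (\<Sum>i=0..n. G $ (n - i) * F $ i)"
    by (simp add: fps_mult_nth assms)
  also have "\<dots> = (\<Sum>i=0..n. G $ i * F $ (n - i))"
    by (rule sum.reindex_bij_witness[of _ "\<lambda>i. n - i" "\<lambda>i. n - i"]) auto
  finally show "(F * G) $ n = (G * F) $ n" by (simp add: fps_mult_nth)
qed

lemma fps_of_cplx_commute: "fps_of_cplx k * F = F * fps_of_cplx k"
  by (rule fps_commuteI) (simp add: of_cplx_commute)

lemma fps_const_commutator: "commutator (fps_const x) (fps_const y) = fps_const (commutator x (y :: 'a::ring_1))"
  by simp

text \<open>With \<open>F = z\<^sup>-\<^sup>m A\<^sup>a(z)\<close> and \<open>k = z\<^sup>-\<^sup>2\<^sup>m a(z)\<close>.\<close>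

definition is_A_fps :: "int \<Rightarrow> complex fps \<Rightarrow> yangian fps \<Rightarrow> bool" where
  "is_A_fps m k F \<longleftrightarrow> F $ 0 = 1 \<and> (\<forall>i. F $ i \<in> h_subalgebra) \<and> h_fps * (F * fps_sh m F) = fps_of_cplx k"

lemma h_fps_in_h_subalgebra: "h_fps $ i \<in> h_subalgebra"
  by (cases i) (auto simp: h_fps_nth intro: h_subalgebra_1 h_subalgebra.intros)

lemma fps_sh_in_h_subalgebra: "(\<And>i. F $ i \<in> h_subalgebra) \<Longrightarrow> fps_sh m F $ i \<in> h_subalgebra"
  unfolding fps_sh_nth by (intro h_subalgebra_sum h_subalgebra.intros h_subalgebra_of_cplx)

lemma h_subalgebra_fps_commute:
  "(\<And>i. F $ i \<in> h_subalgebra) \<Longrightarrow> (\<And>i. G $ i \<in> h_subalgebra) \<Longrightarrow> F * G = G * F"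
  by (rule fps_commuteI) (rule h_subalgebra_commute)

lemma is_A_fps_exists:
  assumes "k $ 0 = 1"
  obtains F where "is_A_fps m k F"
proof -
  obtain F where "F $ 0 = 1" "\<And>i. F $ i \<in> h_subalgebra" "h_fps * F * fps_sh m F = fps_of_cplx k"
    by (rule sh_root_exists[of h_fps "fps_of_cplx k" h_subalgebra m])
      (auto simp: h_fps_nth assms intro: h_subalgebra.intros h_subalgebra_of_cplx h_fps_in_h_subalgebra)
  then show ?thesis by (intro that[of F]) (auto simp: is_A_fps_def mult.assoc)
qed

lemma is_A_fps_unique:
  assumes "is_A_fps m k F" "is_A_fps m k G"
  shows "F = G"
proof (rule sh_root_unique[where h = h_fps])
  \<comment> \<open>Commutativity moves \<open>h_fps\<close> to the middle position expected by
    \<open>sh_root_unique\<close>.\<close>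
  have "h_fps * F = F * h_fps" "h_fps * G = G * h_fps"
    using assms by (auto simp: is_A_fps_def intro!: h_subalgebra_fps_commute h_fps_in_h_subalgebra)
  then show "F * h_fps * fps_sh m F = G * h_fps * fps_sh m G"
    using assms by (simp add: is_A_fps_def flip: mult.assoc)
qed (use assms in \<open>auto simp: is_A_fps_def h_fps_nth\<close>)

text \<open>The relations with s = 0 give the commutators of h(z) with the constant series; the
  \<open>commutator_series\<close> lemmas pass from h(z) to A(z), and
  \<open>quantum_determinant\<close> evaluates the determinant as a(z).\<close>

lemma monodromy_yangian:
  assumes "is_A_fps m k F"
  shows "monodromy (fps_const (x_plus 0)) (fps_const (x_minus 0)) (fps_const j_gen) F m (fps_of_cplx k)"
proof -
  let ?e = "fps_const (x_plus 0)" and ?f = "fps_const (x_minus 0)" and ?j = "fps_const j_gen"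
  let ?e1 = "fps_const (x_plus 1)" and ?f1 = "fps_const (x_minus 1)"
  have F: "F $ 0 = 1" "\<And>i. F $ i \<in> h_subalgebra" "h_fps * (F * fps_sh m F) = fps_of_cplx k"
    using assms by (auto simp: is_A_fps_def)
  note comm = h_subalgebra_fps_commute[OF h_fps_in_h_subalgebra F(2)]
    h_subalgebra_fps_commute[OF h_fps_in_h_subalgebra fps_sh_in_h_subalgebra[OF F(2)]]
    h_subalgebra_fps_commute[OF F(2) fps_sh_in_h_subalgebra[OF F(2)]]
  have const: "commutator (fps_const x) F = 0" if "x \<in> h_subalgebra" for x
    using h_subalgebra_fps_commute[of "fps_const x" F] F(2) that h_subalgebra_0 by (simp add: fps_const_def)
  have je: "commutator ?j ?e = ?e1" and fj: "commutator ?f ?j = ?f1"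
    unfolding fps_const_commutator j_x_plus j_x_minus by simp_all
  have ef: "commutator ?e ?f = fps_const (h_gen 0)" and e1f: "commutator ?e1 ?f = fps_const (h_gen 1)"
    unfolding fps_const_commutator yangian_relation by simp_all
  have he: "commutator h_fps ?e = fps_X * (commutator h_fps ?e1 + h_fps * ?e + ?e * h_fps)"
  proof (rule fps_ext)
    fix n
    \<comment> \<open>Coefficient 1 stems from the leading 1 of h(z) and is the relation for h_0;
      the later ones relate h_(r+1) to h_r.\<close>
    consider "n = 0" | "n = 1" | r where "n = Suc (Suc r)" by (metis One_nat_def not0_implies_Suc)
    then show "commutator h_fps ?e $ n = (fps_X * (commutator h_fps ?e1 + h_fps * ?e + ?e * h_fps)) $ n"
    proof cases
      case 3
      then show ?thesis using yangian_relation(4)[of r 0] by (simp add: h_fps_nth algebra_simps)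
    qed (use yangian_relation(2)[of 0] in \<open>simp_all add: h_fps_nth\<close>)
  qed
  have hf: "commutator h_fps ?f = fps_X * (commutator h_fps ?f1 - h_fps * ?f - ?f * h_fps)"
  proof (rule fps_ext)
    fix n
    consider "n = 0" | "n = 1" | r where "n = Suc (Suc r)" by (metis One_nat_def not0_implies_Suc)
    then show "commutator h_fps ?f $ n = (fps_X * (commutator h_fps ?f1 - h_fps * ?f - ?f * h_fps)) $ n"
    proof cases
      case 3
      then show ?thesis using yangian_relation(5)[of r 0] by (simp add: h_fps_nth algebra_simps)
    qed (use yangian_relation(3)[of 0] in \<open>simp_all add: h_fps_nth\<close>)
  qed
  have eF: "commutator ?e F = fps_X * (commutator ?e1 F + F * ?e)"
    by (rule commutator_series_right[OF _ _ comm F(3) fps_of_cplx_commute _ F(1) he]) (simp_all add: h_fps_nth)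
  have fF: "commutator F ?f = fps_X * (commutator F ?f1 + ?f * F)"
    by (rule commutator_series_left[OF _ _ comm F(3) fps_of_cplx_commute _ F(1) hf]) (simp_all add: h_fps_nth)
  interpret lax ?e ?f ?j F m
    by unfold_locales (simp_all only: fps_sh_0_const F(1) const[OF j_gen_in_h_subalgebra] je eF)
  have "F * h_fps * fps_sh m F = D * fps_sh m F - C * fps_sh m B"
  proof (rule quantum_determinant)
  qed (fact e_fps_eq h_fps_eq)+
  then have "D * fps_sh m F - C * fps_sh m B = fps_of_cplx k"
    unfolding comm(1) [symmetric] mult.assoc [of h_fps F] F(3) ..
  moreover have "commutator ?e1 ?e = ?e * ?e"
  proof -
    \<comment> \<open>For r = s = 0 the two commutators in the relation are negatives of each other,
      so it gives twice the claim.\<close>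
    let ?a = "commutator (x_plus 1) (x_plus 0)"
    have "?a + ?a = x_plus 0 * x_plus 0 + x_plus 0 * x_plus 0"
      using yangian_relation(7)[of 0 0] by (simp add: algebra_simps)
    then show ?thesis unfolding double_cancel by simp
  qed
  moreover have "commutator ?f1 ?f = - (?f * ?f)"
  proof -
    let ?a = "commutator (x_minus 1) (x_minus 0)"
    have "?a + ?a = - (x_minus 0 * x_minus 0) + - (x_minus 0 * x_minus 0)"
      using yangian_relation(8)[of 0 0] by (simp add: algebra_simps)
    then show ?thesis unfolding double_cancel by simp
  qed
  moreover have "commutator (fps_const (h_gen 0)) ?f = - (?f + ?f)"
    unfolding fps_const_commutator yangian_relation by simp
  ultimately show ?thesis
    by unfold_locales (simp_all only: je fj ef e1f fF const[OF h_subalgebra.intros(2)])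
qed

section \<open>The coproduct of the series \<open>A(z)\<close>\<close>

definition fps_map :: "('a \<Rightarrow> 'b) \<Rightarrow> 'a fps \<Rightarrow> 'b fps" where
  "fps_map \<phi> F = Abs_fps (\<lambda>n. \<phi> (F $ n))"

lemma fps_map_nth [simp]: "fps_map \<phi> F $ n = \<phi> (F $ n)"
  by (simp add: fps_map_def)

locale cplx_hom =
  fixes \<phi> :: "'a::complex_algebra \<Rightarrow> 'b::complex_algebra"
  assumes hom_add: "\<phi> (x + y) = \<phi> x + \<phi> y"
    and hom_mult: "\<phi> (x * y) = \<phi> x * \<phi> y"
    and hom_of_cplx: "\<phi> (of_cplx c) = of_cplx c"
begin

lemma hom_1: "\<phi> 1 = 1" and hom_0: "\<phi> 0 = 0"
  using hom_of_cplx[of 1] hom_of_cplx[of 0] by simp_all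

lemma hom_diff: "\<phi> (x - y) = \<phi> x - \<phi> y"
  using hom_add[of "x - y" y] by (simp add: algebra_simps)

lemma hom_uminus: "\<phi> (- x) = - \<phi> x"
  using hom_diff[of 0 x] by (simp add: hom_0)

lemma hom_sum: "\<phi> (sum g I) = (\<Sum>i\<in>I. \<phi> (g i))"
  by (induction I rule: infinite_finite_induct) (auto simp: hom_0 hom_add)

lemma fps_map_simps:
  "fps_map \<phi> (F + G) = fps_map \<phi> F + fps_map \<phi> G"
  "fps_map \<phi> (F - G) = fps_map \<phi> F - fps_map \<phi> G"
  "fps_map \<phi> (- F) = - fps_map \<phi> F"
  "fps_map \<phi> (F * G) = fps_map \<phi> F * fps_map \<phi> G"
  "fps_map \<phi> 0 = 0" "fps_map \<phi> 1 = 1" "fps_map \<phi> fps_X = fps_X"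
  "fps_map \<phi> (fps_const c) = fps_const (\<phi> c)"
  "fps_map \<phi> (fps_sh k F) = fps_sh k (fps_map \<phi> F)"
  "fps_map \<phi> (fps_of_cplx l) = fps_of_cplx l"
  by (auto simp: fps_eq_iff fps_mult_nth fps_sh_nth hom_add hom_diff hom_uminus hom_mult hom_sum hom_0 hom_1
      hom_of_cplx fps_X_def)

text \<open>The assumptions are equations between ring expressions in the series,
  \<open>fps_X\<close> and \<open>fps_sh\<close>, all of which \<open>fps_map\<close>
  respects.\<close>

lemma monodromy_map:
  assumes "monodromy e f j A m K"
  shows "monodromy (fps_map \<phi> e) (fps_map \<phi> f) (fps_map \<phi> j) (fps_map \<phi> A) m (fps_map \<phi> K)"
proof -
  interpret monodromy e f j A m K by fact
  note map = arg_cong [of _ _ "fps_map \<phi>"]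
  show ?thesis
    by unfold_locales
      (use sh_const [THEN map] jA [THEN map] eA [THEN map] fA [THEN map] ee [THEN map] ff [THEN map]
        h0A [THEN map] h1A [THEN map] h0f [THEN map] qdet [THEN map] A_0
       in \<open>simp_all only: fps_map_simps fps_map_nth hom_1\<close>)
qed

end

text \<open>Here \<open>\<iota>\<close> and \<open>\<kappa>\<close> are the embeddings of the two
  tensor factors. Both sides Y solve Y(z) \<Delta>(h(z)) Y(z - 1) = a(z) b(z): the left one as an
  image of A(z), the right one by \<open>quantum_determinant\<close> and multiplicativity of the
  determinant.\<close>

lemma coproduct_root:
  fixes \<Delta> \<iota> \<kappa> :: "yangian \<Rightarrow> 'r::complex_algebra"
  assumes hom: "cplx_hom \<Delta>" "cplx_hom \<iota>" "cplx_hom \<kappa>"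
    and comm: "\<And>x y. \<kappa> y * \<iota> x = \<iota> x * \<kappa> y"
    and \<Delta>: "\<Delta> (x_plus 0) = \<iota> (x_plus 0) + \<kappa> (x_plus 0)"
      "\<Delta> (x_minus 0) = \<iota> (x_minus 0) + \<kappa> (x_minus 0)"
      "\<Delta> (x_plus 1) = \<iota> (x_plus 1) + \<kappa> (x_plus 1) + \<iota> (h_gen 0) * \<kappa> (x_plus 0)"
    and root: "is_A_fps m k F" "is_A_fps n l G" "is_A_fps (m + n) (k * l) R"
  shows "fps_map \<Delta> R = fps_map \<iota> F * fps_map \<kappa> G
    + fps_map \<iota> (commutator F (fps_const (x_minus 0))) * fps_map \<kappa> (commutator (fps_const (x_plus 0)) G)"
proof -
  interpret \<Delta>: cplx_hom \<Delta> by fact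
  interpret \<iota>: cplx_hom \<iota> by fact
  interpret \<kappa>: cplx_hom \<kappa> by fact
  let ?S = "{F :: 'r fps. \<forall>i. F $ i \<in> range \<iota>}" and ?T = "{F :: 'r fps. \<forall>i. F $ i \<in> range \<kappa>}"
  \<comment> \<open>This description gives the closure properties of the two families, as
    \<open>fps_map\<close> commutes with the ring operations and the shift.\<close>
  have range: "F \<in> {F. \<forall>i. F $ i \<in> range \<phi>} \<longleftrightarrow> (\<exists>F'. F = fps_map \<phi> F')" for F :: "'r fps" and \<phi> :: "yangian \<Rightarrow> 'r"
  proof
    assume "F \<in> {F. \<forall>i. F $ i \<in> range \<phi>}"
    then have "\<forall>i. \<exists>x. F $ i = \<phi> x" by auto
    then obtain g where "\<forall>i. F $ i = \<phi> (g i)" by metis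
    then show "\<exists>F'. F = fps_map \<phi> F'" by (intro exI[of _ "Abs_fps g"]) (simp add: fps_eq_iff)
  qed auto
  let ?e = "fps_const (x_plus 0)" and ?f = "fps_const (x_minus 0)" and ?j = "fps_const j_gen"
  interpret P: monodromy_product "fps_map \<iota> ?e" "fps_map \<iota> ?f" "fps_map \<iota> ?j" "fps_map \<iota> F" "fps_map \<iota> (fps_of_cplx k)"
    "fps_map \<kappa> ?e" "fps_map \<kappa> ?f" "fps_map \<kappa> ?j" "fps_map \<kappa> G" "fps_map \<kappa> (fps_of_cplx l)" m n ?S ?T
  proof (intro monodromy_product.intro monodromy_product_axioms.intro \<iota>.monodromy_map \<kappa>.monodromy_map
      monodromy_yangian root)
    show "y * x = x * y" if "x \<in> ?S" "y \<in> ?T" for x y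
      using that comm by (intro fps_commuteI) (auto simp: image_iff, metis)
  qed (unfold range, auto simp: \<iota>.fps_map_simps [symmetric] \<kappa>.fps_map_simps [symmetric])
  have A: "P.A = fps_map \<iota> F * fps_map \<kappa> G
    + fps_map \<iota> (commutator F ?f) * fps_map \<kappa> (commutator ?e G)"
    unfolding P.A_def unfolding \<iota>.fps_map_simps \<kappa>.fps_map_simps ..
  have e: "P.e = fps_const (\<Delta> (x_plus 0))" and f: "P.f = fps_const (\<Delta> (x_minus 0))"
    unfolding P.e_def P.f_def unfolding \<iota>.fps_map_simps \<kappa>.fps_map_simps by (simp_all add: \<Delta>)
  \<comment> \<open>As h_0 and h_1 are commutators of generators, the given values of
    \<open>\<Delta>\<close> determine their images.\<close>
  have h0: "\<Delta> (h_gen 0) = \<iota> (h_gen 0) + \<kappa> (h_gen 0)"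
  proof -
    have h: "h_gen 0 = commutator (x_plus 0) (x_minus 0)" by (simp add: yangian_relation)
    show ?thesis
      unfolding h \<Delta>.hom_diff \<Delta>.hom_mult \<iota>.hom_diff \<iota>.hom_mult \<kappa>.hom_diff \<kappa>.hom_mult \<Delta>
      by (simp add: algebra_simps comm)
  qed
  have h1: "\<Delta> (h_gen 1) = \<iota> (h_gen 1) + \<kappa> (h_gen 1) + \<iota> (h_gen 0) * \<kappa> (h_gen 0)
    - (\<iota> (x_minus 0) * \<kappa> (x_plus 0) + \<iota> (x_minus 0) * \<kappa> (x_plus 0))"
  proof -
    have "\<Delta> (h_gen 1) = commutator (\<Delta> (x_plus 1)) (\<Delta> (x_minus 0))"
      using yangian_relation(6)[of 1 0] by (simp flip: \<Delta>.hom_diff \<Delta>.hom_mult)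
    also have "\<dots> = commutator (\<iota> (x_plus 1)) (\<iota> (x_minus 0)) + commutator (\<kappa> (x_plus 1)) (\<kappa> (x_minus 0))
      + \<iota> (h_gen 0) * commutator (\<kappa> (x_plus 0)) (\<kappa> (x_minus 0))
      + commutator (\<iota> (h_gen 0)) (\<iota> (x_minus 0)) * \<kappa> (x_plus 0)"
    proof -
      have comm': "\<kappa> y * (\<iota> x * z) = \<iota> x * (\<kappa> y * z)" for x y z
        by (metis comm mult.assoc)
      show ?thesis
        unfolding \<Delta> by (simp add: algebra_simps comm comm')
    qed
    also have "commutator (\<iota> (x_plus 1)) (\<iota> (x_minus 0)) = \<iota> (h_gen 1)"
      using yangian_relation(6)[of 1 0] by (simp flip: \<iota>.hom_diff \<iota>.hom_mult)
    also have "commutator (\<kappa> (x_plus 1)) (\<kappa> (x_minus 0)) = \<kappa> (h_gen 1)"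
      using yangian_relation(6)[of 1 0] by (simp flip: \<kappa>.hom_diff \<kappa>.hom_mult)
    also have "commutator (\<kappa> (x_plus 0)) (\<kappa> (x_minus 0)) = \<kappa> (h_gen 0)"
      using yangian_relation(6)[of 0 0] by (simp flip: \<kappa>.hom_diff \<kappa>.hom_mult)
    also have "commutator (\<iota> (h_gen 0)) (\<iota> (x_minus 0)) = - (\<iota> (x_minus 0) + \<iota> (x_minus 0))"
      using yangian_relation(3)[of 0] by (simp flip: \<iota>.hom_diff \<iota>.hom_mult \<iota>.hom_add \<iota>.hom_uminus)
    finally show ?thesis by (simp add: algebra_simps)
  qed
  \<comment> \<open>In 4 j = 2 h_1 - h_0^2 the summand 2 h_0 \<otimes> h_0 from 2 \<Delta>(h_1)
    cancels the mixed terms of \<Delta>(h_0)^2, leaving - 4 f \<otimes> e besides the images of 4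
    j.\<close>
  have "\<Delta> j_gen = \<iota> j_gen + \<kappa> j_gen - \<iota> (x_minus 0) * \<kappa> (x_plus 0)"
  proof -
    let ?fe = "\<iota> (x_minus 0) * \<kappa> (x_plus 0)"
    have 4: "(\<phi> j_gen + \<phi> j_gen) + (\<phi> j_gen + \<phi> j_gen) = \<phi> (h_gen 1) + \<phi> (h_gen 1) - \<phi> (h_gen 0) * \<phi> (h_gen 0)"
      if "cplx_hom \<phi>" for \<phi> :: "yangian \<Rightarrow> 'r"
    proof -
      interpret cplx_hom \<phi> by fact
      show ?thesis using arg_cong[OF j_gen, of \<phi>] by (simp only: hom_add hom_diff hom_mult)
    qed
    have "(\<Delta> j_gen + \<Delta> j_gen) + (\<Delta> j_gen + \<Delta> j_gen) =
      (\<iota> (h_gen 1) + \<iota> (h_gen 1) - \<iota> (h_gen 0) * \<iota> (h_gen 0)) + (\<kappa> (h_gen 1) + \<kappa> (h_gen 1) - \<kappa> (h_gen 0) * \<kappa> (h_gen 0))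
      - ((?fe + ?fe) + (?fe + ?fe))"
      unfolding 4[OF hom(1)] h0 h1 by (simp add: algebra_simps comm)
    also have "\<dots> = (\<iota> j_gen + \<kappa> j_gen - ?fe + (\<iota> j_gen + \<kappa> j_gen - ?fe)) + (\<iota> j_gen + \<kappa> j_gen - ?fe + (\<iota> j_gen + \<kappa> j_gen - ?fe))"
      unfolding 4[OF hom(2), symmetric] 4[OF hom(3), symmetric] by (simp add: algebra_simps)
    finally show ?thesis unfolding double_cancel .
  qed
  then have j: "P.j = fps_const (\<Delta> j_gen)"
    unfolding P.j_def unfolding \<iota>.fps_map_simps \<kappa>.fps_map_simps by simp
  have R: "R $ 0 = 1" "\<And>i. R $ i \<in> h_subalgebra" "h_fps * (R * fps_sh (m + n) R) = fps_of_cplx (k * l)"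
    using root(3) by (auto simp: is_A_fps_def)
  have hR: "h_fps * R = R * h_fps"
    by (rule h_subalgebra_fps_commute[OF h_fps_in_h_subalgebra R(2)])
  have "P.A * fps_map \<Delta> h_fps * fps_sh (m + n) P.A = P.D * fps_sh (m + n) P.A - P.C * fps_sh (m + n) P.B"
  proof (rule P.quantum_determinant)
    show "fps_map \<Delta> e_fps = fps_X * (commutator P.j (fps_map \<Delta> e_fps) + P.e)"
      using arg_cong[OF e_fps_eq, of "fps_map \<Delta>"] unfolding e j \<Delta>.fps_map_simps .
    show "fps_map \<Delta> h_fps = 1 + commutator (fps_map \<Delta> e_fps) P.f"
      using arg_cong[OF h_fps_eq, of "fps_map \<Delta>"] unfolding f \<Delta>.fps_map_simps .
  qed
  also have "\<dots> = fps_of_cplx (k * l)"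
    unfolding P.qdet unfolding \<iota>.fps_map_simps \<kappa>.fps_map_simps fps_of_cplx_mult ..
  also have "\<dots> = fps_map \<Delta> (R * h_fps * fps_sh (m + n) R)"
    unfolding hR [symmetric] mult.assoc R(3) \<Delta>.fps_map_simps ..
  finally have "P.A * fps_map \<Delta> h_fps * fps_sh (m + n) P.A =
      fps_map \<Delta> R * fps_map \<Delta> h_fps * fps_sh (m + n) (fps_map \<Delta> R)"
    unfolding \<Delta>.fps_map_simps .
  then have "P.A = fps_map \<Delta> R"
    by (rule sh_root_unique) (simp_all add: P.A_0 R(1) h_fps_nth \<Delta>.hom_1)
  then show ?thesis unfolding A ..
qed

section \<open>Laurent series\<close>

text \<open>\<open>fls_shift m\<close> is multiplication by z^m, so it restores the leading power
  removed from the power series.\<close>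

lemma fls_shift_fps_mult:
  fixes F G :: "'a::ring_1 fps"
  shows "fls_shift m (fps_to_fls F) * fls_shift n (fps_to_fls G) = fls_shift (m + n) (fps_to_fls (F * G))"
  by (simp add: fls_shifted_times_simps fls_times_fps_to_fls add.commute)

lemma fls_subdegree_shift_fps:
  assumes "F $ 0 = (1 :: 'a::zero_neq_one)"
  shows "fls_subdegree (fls_shift m (fps_to_fls F)) = - m"
  by (rule fls_subdegree_eqI) (use assms in auto)

text \<open>Coefficient p of \<open>F\<close> belongs to the exponent k = p - m of z^-1, so - k = m
  - p and the binomials are those of \<open>shcoeff\<close>. The condition on \<open>F $ 0\<close>
  fixes where the sum in \<open>fls_shift_arg\<close> starts.\<close>

lemma fls_shift_arg_eq:
  assumes "F $ 0 = 1"
  shows "fls_shift_arg (fls_shift m (fps_to_fls F)) = fls_shift m (fps_to_fls (fps_sh m F))"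
proof (rule fls_eqI)
  fix i :: int
  let ?A = "fls_shift m (fps_to_fls F)"
  have "fls_nth (fls_shift_arg ?A) i = (\<Sum>k = - m..i. scale_yangian 
      ((- 1) ^ nat (i - k) * (of_int (- k) gchoose nat (i - k))) (F $ nat (k + m)))"
    unfolding fls_nth_fls_shift_arg fls_subdegree_shift_fps[OF assms]
    by (intro sum.cong refl) auto
  also have "\<dots> = (if i + m < 0 then 0 else fps_sh m F $ nat (i + m))"
  proof (cases "i + m < 0")
    case False
    have "(\<Sum>k = - m..i. scale_yangian ((- 1) ^ nat (i - k) * (of_int (- k) gchoose nat (i - k))) (F $ nat (k + m)))
      = (\<Sum>p\<le>nat (i + m). scale_yangian (shcoeff m (nat (i + m)) p) (F $ p))"
    proof (rule sum.reindex_bij_witness[of _ "\<lambda>p. int p - m" "\<lambda>k. nat (k + m)"])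
      fix k assume k: "k \<in> {- m..i}"
      then have e: "nat (i + m) - nat (k + m) = nat (i - k)" by auto
      have "of_int m - of_nat (nat (k + m)) = (of_int (- k) :: complex)"
        using k by (simp add: of_nat_nat)
      then show "scale_yangian (shcoeff m (nat (i + m)) (nat (k + m))) (F $ nat (k + m)) =
        scale_yangian ((- 1) ^ nat (i - k) * (of_int (- k) gchoose nat (i - k))) (F $ nat (k + m))"
        unfolding shcoeff_def e by simp
    qed (use False in auto)
    with False show ?thesis by (simp add: fps_sh_nth scale_yangian_eq)
  qed simp
  finally show "fls_nth (fls_shift_arg ?A) i = fls_nth (fls_shift m (fps_to_fls (fps_sh m F))) i"
    by simp
qed

lemma h_series_eq: "h_series = fps_to_fls h_fps"
  unfolding h_series_def by (rule arg_cong[of _ _ fps_to_fls], rule fps_ext) (simp add: h_fps_nth split: nat.split)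

lemma fls_to_yangian_eq: "fls_to_yangian (fls_shift m (fps_to_fls k)) = fls_shift m (fps_to_fls (fps_of_cplx k))"
  by (rule fls_eqI) (simp add: fls_nth_fls_to_yangian scale_yangian_eq)

lemma is_A_series_shift_iff:
  assumes "F $ 0 = 1" "k $ 0 = 1"
  shows "is_A_series (fls_shift (2 * int m) (fps_to_fls k)) (fls_shift (int m) (fps_to_fls F)) \<longleftrightarrow> is_A_fps (int m) k F"
proof -
  let ?A = "fls_shift (int m) (fps_to_fls F)"
  have "h_series * (?A * fls_shift_arg ?A) = fls_shift (2 * int m) (fps_to_fls (h_fps * (F * fps_sh m F)))"
    unfolding fls_shift_arg_eq[OF assms(1)] h_series_eq fls_shift_fps_mult
    using fls_shift_fps_mult[of 0 h_fps "2 * int m"] by simp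
  moreover have "(\<forall>i. fls_nth ?A i \<in> h_subalgebra) \<longleftrightarrow> (\<forall>i. F $ i \<in> h_subalgebra)"
  proof
    assume *: "\<forall>i. fls_nth ?A i \<in> h_subalgebra"
    show "\<forall>i. F $ i \<in> h_subalgebra"
    proof
      fix i show "F $ i \<in> h_subalgebra" using *[rule_format, of "int i - int m"] by simp
    qed
  qed (auto simp: h_subalgebra_0)
  ultimately show ?thesis
    unfolding is_A_series_def is_A_fps_def fls_to_yangian_eq fls_subdegree_shift_fps[OF assms(1)]
      fls_subdegree_shift_fps[OF assms(2)]
    by (simp add: assms fls_shift_eq_iff)
qed

text \<open>Every candidate has subdegree - m, hence is z^m times a power series, and uniqueness
  follows from \<open>is_A_fps_unique\<close>.\<close>

lemma A_series_eq:
  assumes "is_A_fps (int m) k F" "k $ 0 = 1"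
  shows "A_series (fls_shift (2 * int m) (fps_to_fls k)) = fls_shift (int m) (fps_to_fls F)"
  unfolding A_series_def
proof (rule the_equality)
  have F: "F $ 0 = 1" using assms(1) by (simp add: is_A_fps_def)
  show "is_A_series (fls_shift (2 * int m) (fps_to_fls k)) (fls_shift (int m) (fps_to_fls F))"
    using assms by (simp only: is_A_series_shift_iff[OF F])
  fix A assume A: "is_A_series (fls_shift (2 * int m) (fps_to_fls k)) A"
  then have sub: "fls_subdegree A = - int m" and lead: "fls_nth A (- int m) = 1"
    unfolding is_A_series_def fls_subdegree_shift_fps[OF assms(2)] by auto
  define G where "G = Abs_fps (\<lambda>i. fls_nth A (int i - int m))"
  have AG: "A = fls_shift (int m) (fps_to_fls G)"
  proof (rule fls_eqI)
    fix i show "fls_nth A i = fls_nth (fls_shift (int m) (fps_to_fls G)) i"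
      using fls_eq0_below_subdegree[of i A] by (simp add: G_def sub)
  qed
  have "G $ 0 = 1" by (simp add: G_def lead)
  then have "is_A_fps (int m) k G"
    using A assms(2) unfolding AG by (simp only: is_A_series_shift_iff)
  then show "A = fls_shift (int m) (fps_to_fls F)"
    unfolding AG using is_A_fps_unique[OF assms(1)] by simp
qed

lemma fls_eq_shift_fps:
  assumes "fls_subdegree a = - int (2 * m)" "fls_nth a (- int (2 * m)) = (1 :: complex)"
  obtains k where "k $ 0 = 1" "a = fls_shift (2 * int m) (fps_to_fls k)"
proof
  let ?k = "Abs_fps (\<lambda>i. fls_nth a (int i - 2 * int m))"
  show "?k $ 0 = 1" using assms by simp
  show "a = fls_shift (2 * int m) (fps_to_fls ?k)"
    by (rule fls_eqI) (use assms fls_eq0_below_subdegree[of _ a] in auto)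
qed

section \<open>The tensor square of the Yangian as a type\<close>

lemma yangian_alg_simps:
  "carrier yangian_alg = UNIV" "x \<otimes>\<^bsub>yangian_alg\<^esub> y = x * y" "x \<oplus>\<^bsub>yangian_alg\<^esub> y = x + y"
  "\<one>\<^bsub>yangian_alg\<^esub> = 1" "\<zero>\<^bsub>yangian_alg\<^esub> = 0" "c \<odot>\<^bsub>yangian_alg\<^esub> x = of_cplx c * x"
  by (simp_all add: yangian_alg_def ring.defs module.defs ring_of_type_algebra_def scale_yangian_eq)

lemma yangian_cplx_alg: "cplx_alg yangian_alg"
proof -
  have "ring yangian_alg"
  proof (intro ringI abelian_groupI monoidI, unfold yangian_alg_simps)
    show "\<exists>y\<in>UNIV. y + x = 0" for x :: yangian
      by (rule bexI[of _ "- x"]) simp_all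
  qed (simp_all add: algebra_simps)
  then interpret ring yangian_alg .
  show ?thesis
    by unfold_locales
      (simp_all add: yangian_alg_simps of_cplx_add of_cplx_mult distrib_left distrib_right mult.assoc,
       metis of_cplx_commute mult.assoc)
qed

lemma yangian_pair: "cplx_alg_pair yangian_alg yangian_alg"
  by (intro cplx_alg_pair.intro yangian_cplx_alg)

abbreviation "YY_alg \<equiv> tensor_alg yangian_alg yangian_alg"
abbreviation "tens \<equiv> pure_tensor yangian_alg yangian_alg"

interpretation YYT: cplx_alg YY_alg
  by (rule cplx_alg_pair.tensor_cplx_alg [OF yangian_pair])

text \<open>The counit is only needed to see that the tensor square is not the zero ring.\<close>

lemma yangian_ideal_lookup_0:
  assumes "p \<in> yangian_ideal"
  shows "Poly_Mapping.lookup p 0 = 0"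
proof -
  let ?I = "{p :: free_alg. Poly_Mapping.lookup p 0 = 0}"
  have [simp]: "Word [g] \<noteq> 0" for g :: gen
    by (simp add: zero_word_def)
  have "ideal ?I ring_of_type_algebra"
    by (rule ideal_ring_of_type_algebraI) (auto simp: lookup_times_zero_word lookup_add)
  moreover have "yangian_relators \<subseteq> ?I"
    by (auto elim!: yangian_relators.cases
          simp: lookup_times_zero_word lookup_add lookup_minus lookup_single mult_2)
  ultimately show ?thesis
    using assms unfolding yangian_ideal_def genideal_def by blast
qed

lift_definition counit :: "yangian \<Rightarrow> complex" is "\<lambda>p. Poly_Mapping.lookup p 0"
  by (drule yangian_ideal_lookup_0) (simp add: lookup_minus)

lemma counit_simps: "counit (x + y) = counit x + counit y" "counit (of_cplx c * x) = c * counit x" "counit 1 = 1"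
  unfolding scale_yangian_eq [symmetric]
  by (transfer, simp add: lookup_add lookup_times_zero_word lookup_one)+

text \<open>The functional counit \<otimes> counit kills the bilinear span but takes the value 1 at
  1 \<otimes> 1.\<close>

lemma YY_one_neq_zero: "\<one>\<^bsub>YY_alg\<^esub> \<noteq> \<zero>\<^bsub>YY_alg\<^esub>"
proof
  interpret YY: cplx_alg_pair yangian_alg yangian_alg by (rule yangian_pair)
  \<comment> \<open>Since \<open>pm_lin\<close> has values in formal combinations, those over the
    one-element type stand for the complex numbers.\<close>
  define \<epsilon> where "\<epsilon> = pm_lin (\<lambda>(x, y). Poly_Mapping.single () (counit x * counit y))"
  have \<epsilon>: "\<epsilon> p = 0" if "p \<in> YY.I" for p
    using that
  proof (induction rule: YY.bilinear_span_induct)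
    case (relator p)
    then show ?case
      by cases (simp_all add: \<epsilon>_def pm_lin_diff yangian_alg_simps counit_simps single_add distrib_left distrib_right mult_ac)
  qed (simp_all add: \<epsilon>_def pm_lin_add pm_lin_scale)
  assume "\<one>\<^bsub>YY_alg\<^esub> = \<zero>\<^bsub>YY_alg\<^esub>"
  then have "YY.I +>\<^bsub>YY.P\<^esub> \<one>\<^bsub>YY.P\<^esub> = YY.I"
    by (simp add: tensor_alg_def YY.T.quot_alg_simps)
  moreover have "\<one>\<^bsub>YY.P\<^esub> \<in> YY.I +>\<^bsub>YY.P\<^esub> \<one>\<^bsub>YY.P\<^esub>"
    by (rule YY.T.a_rcos_self) simp
  ultimately have "\<epsilon> \<one>\<^bsub>YY.P\<^esub> = 0" using \<epsilon> by simp
  then have "Poly_Mapping.single () (1 :: complex) = 0"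
    by (simp add: \<epsilon>_def YY.pair_alg_simps(2) yangian_alg_simps counit_simps)
  from arg_cong [OF this, of "\<lambda>p. Poly_Mapping.lookup p ()"] show False
    by simp
qed

text \<open>The power series arguments concern types of class \<open>complex_algebra\<close>, so the
  carrier of the tensor square is made into such a type.\<close>

typedef yy = "carrier YY_alg"
  by (rule exI) (rule YYT.zero_closed)

setup_lifting type_definition_yy

instantiation yy :: complex_algebra
begin

lift_definition zero_yy :: yy is "\<zero>\<^bsub>YY_alg\<^esub>" by (rule YYT.zero_closed)
lift_definition one_yy :: yy is "\<one>\<^bsub>YY_alg\<^esub>" by (rule YYT.one_closed)
lift_definition plus_yy :: "yy \<Rightarrow> yy \<Rightarrow> yy" is "\<lambda>x y. x \<oplus>\<^bsub>YY_alg\<^esub> y" by (rule YYT.a_closed)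
lift_definition times_yy :: "yy \<Rightarrow> yy \<Rightarrow> yy" is "\<lambda>x y. x \<otimes>\<^bsub>YY_alg\<^esub> y" by (rule YYT.m_closed)
lift_definition uminus_yy :: "yy \<Rightarrow> yy" is "\<lambda>x. \<ominus>\<^bsub>YY_alg\<^esub> x" by (rule YYT.a_inv_closed)
lift_definition minus_yy :: "yy \<Rightarrow> yy \<Rightarrow> yy" is "\<lambda>x y. x \<ominus>\<^bsub>YY_alg\<^esub> y" by (rule YYT.minus_closed)
lift_definition of_cplx_yy :: "complex \<Rightarrow> yy" is "\<lambda>c. c \<odot>\<^bsub>YY_alg\<^esub> \<one>\<^bsub>YY_alg\<^esub>"
  by (rule YYT.smult_closed) (rule YYT.one_closed)

instance
proof
  fix x y z :: yy and c d :: complex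
  show "x + y + z = x + (y + z)" by transfer (rule YYT.a_assoc)
  show "x + y = y + x" by transfer (rule YYT.a_comm)
  show "0 + x = x" by transfer (rule YYT.l_zero)
  show "- x + x = 0" by transfer (rule YYT.l_neg)
  show "x - y = x + - y" by transfer (simp add: a_minus_def)
  show "x * y * z = x * (y * z)" by transfer (rule YYT.m_assoc)
  show "1 * x = x" by transfer (rule YYT.l_one)
  show "x * 1 = x" by transfer (rule YYT.r_one)
  show "(x + y) * z = x * z + y * z" by transfer (rule YYT.l_distr)
  show "x * (y + z) = x * y + x * z" by transfer (rule YYT.r_distr)
  show "(0 :: yy) \<noteq> 1" by transfer (rule YY_one_neq_zero [symmetric])
  show "(of_cplx (c + d) :: yy) = of_cplx c + of_cplx d"
    by transfer (rule YYT.smult_l_distr [OF YYT.one_closed])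
  show "(of_cplx (c * d) :: yy) = of_cplx c * of_cplx d"
    by transfer (simp add: YYT.smult_assoc1 YYT.smult_mult_left)
  show "(of_cplx 1 :: yy) = 1"
    by transfer (rule YYT.smult_one [OF YYT.one_closed])
  show "of_cplx c * x = x * of_cplx c"
    by transfer (simp add: YYT.smult_mult_left YYT.smult_mult_right)
qed

end

section \<open>The embeddings and the coproduct as morphisms into the tensor square\<close>

lemma tens_closed: "tens x y \<in> carrier YY_alg"
  by (rule cplx_alg_pair.pure_tensor_closed [OF yangian_pair]) (simp_all add: yangian_alg_simps)

lift_definition tens_yy :: "yangian \<Rightarrow> yangian \<Rightarrow> yy" is tens by (rule tens_closed)

lemma tens_yy_simps:
  "tens_yy x y * tens_yy x' y' = tens_yy (x * x') (y * y')"
  "tens_yy (x + x') y = tens_yy x y + tens_yy x' y" "tens_yy x (y + y') = tens_yy x y + tens_yy x y'"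
  "tens_yy (of_cplx c) 1 = of_cplx c" "tens_yy 1 (of_cplx c) = of_cplx c"
proof -
  interpret YY: cplx_alg_pair yangian_alg yangian_alg by (rule yangian_pair)
  note C = yangian_alg_simps and U = UNIV_I
  have 1: "tens 1 1 = \<one>\<^bsub>YY_alg\<^esub>"
    using YY.pure_tensor_one by (simp add: C)
  show "tens_yy x y * tens_yy x' y' = tens_yy (x * x') (y * y')"
    by transfer (rule YY.pure_tensor_mult [unfolded C, OF U U U U])
  show "tens_yy (x + x') y = tens_yy x y + tens_yy x' y"
    by transfer (rule YY.pure_tensor_add_left [unfolded C, OF U U U])
  show "tens_yy x (y + y') = tens_yy x y + tens_yy x y'"
    by transfer (rule YY.pure_tensor_add_right [unfolded C, OF U U U])
  show "tens_yy (of_cplx c) 1 = of_cplx c"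
    by transfer (use YY.pure_tensor_smult(1) [unfolded C, OF U U, of _ 1 1] in \<open>simp add: 1\<close>)
  show "tens_yy 1 (of_cplx c) = of_cplx c"
    by transfer (use YY.pure_tensor_smult(2) [unfolded C, OF U U, of 1 _ 1] in \<open>simp add: 1\<close>)
qed

lemma Abs_yy_tens: "Abs_yy (tens x y) = tens_yy x y"
  by (simp add: tens_yy_def)

lemma Abs_yy_add:
  "s \<in> carrier YY_alg \<Longrightarrow> t \<in> carrier YY_alg \<Longrightarrow> Abs_yy (s \<oplus>\<^bsub>YY_alg\<^esub> t) = Abs_yy s + Abs_yy t"
  by (simp add: plus_yy.abs_eq eq_onp_def)

lemma cplx_hom_left: "cplx_hom (\<lambda>x. tens_yy x 1)" and cplx_hom_right: "cplx_hom (tens_yy 1)"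
  by unfold_locales (simp_all add: tens_yy_simps)

lemma cplx_hom_Abs_yy:
  assumes "\<Delta> \<in> alg_hom yangian_alg YY_alg"
  shows "cplx_hom (\<lambda>x. Abs_yy (\<Delta> x))"
proof -
  note \<Delta> = alg_homD[OF assms]
  have closed: "\<Delta> x \<in> carrier YY_alg" for x
    using ring_hom_closed[OF \<Delta>(1)] by (simp add: yangian_alg_simps)
  show ?thesis
  proof
    fix x y c
    show "Abs_yy (\<Delta> (x + y)) = Abs_yy (\<Delta> x) + Abs_yy (\<Delta> y)"
      using ring_hom_add[OF \<Delta>(1), of x y]
      by (simp add: plus_yy.abs_eq eq_onp_def closed yangian_alg_simps)
    show "Abs_yy (\<Delta> (x * y)) = Abs_yy (\<Delta> x) * Abs_yy (\<Delta> y)"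
      using ring_hom_mult[OF \<Delta>(1), of x y]
      by (simp add: times_yy.abs_eq eq_onp_def closed yangian_alg_simps)
    show "Abs_yy (\<Delta> (of_cplx c)) = of_cplx c"
      using \<Delta>(2)[of 1 c] ring_hom_one[OF \<Delta>(1)]
      by (simp add: of_cplx_yy_def yangian_alg_simps)
  qed
qed

section \<open>Truncation\<close>

lemma trunc_cplx_alg_ideal: "cplx_alg_ideal yangian_alg (trunc_ideal a)"
  unfolding trunc_ideal_def
  by (intro cplx_alg_ideal.intro yangian_cplx_alg ring.genideal_ideal cplx_alg.axioms(1)) (simp add: yangian_alg_simps)

lemma trunc_ideal_commutator:
  assumes "x \<in> trunc_ideal a"
  shows "commutator x y \<in> trunc_ideal a" "commutator y x \<in> trunc_ideal a"
proof -
  interpret cplx_alg_ideal yangian_alg "trunc_ideal a" by (rule trunc_cplx_alg_ideal)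
  have mult: "u * z \<in> trunc_ideal a" "z * u \<in> trunc_ideal a" if "z \<in> trunc_ideal a" for u z
    using I_l_closed[OF that, of u] I_r_closed[OF that, of u] by (simp_all add: yangian_alg_simps)
  have minus: "u - v \<in> trunc_ideal a" if "u \<in> trunc_ideal a" "v \<in> trunc_ideal a" for u v
    using a_closed[OF that(1) mult(1)[OF that(2), of "- 1"]] by (simp add: yangian_alg_simps)
  show "commutator x y \<in> trunc_ideal a" "commutator y x \<in> trunc_ideal a"
    by (intro minus mult assms)+
qed

text \<open>Coefficient i of \<open>F\<close> belongs to z^(m - i), a strictly negative power
  exactly when i > m.\<close>

lemma root_in_trunc_ideal:
  assumes "is_A_fps (int m) k F" "k $ 0 = 1" "i > m"
  shows "F $ i \<in> trunc_ideal (fls_shift (2 * int m) (fps_to_fls k))"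
proof -
  let ?a = "fls_shift (2 * int m) (fps_to_fls k)"
  let ?S = "{fls_nth (A_series ?a) i | i. i > 0}"
  have "?S \<subseteq> Idl\<^bsub>yangian_alg\<^esub> ?S"
    by (rule ring.genideal_self [OF cplx_alg.axioms(1) [OF yangian_cplx_alg]]) (simp add: yangian_alg_simps)
  moreover have "F $ i = fls_nth (A_series ?a) (int i - int m)"
    unfolding A_series_eq[OF assms(1,2)] by simp
  then have "F $ i \<in> ?S"
    using assms(3) by (intro CollectI exI[of _ "int i - int m"]) simp
  ultimately show ?thesis
    unfolding trunc_ideal_def by (rule subsetD)
qed

lemma pure_tensor_zero:
  assumes "cplx_alg_pair C D"
  shows "y \<in> carrier D \<Longrightarrow> pure_tensor C D \<zero>\<^bsub>C\<^esub> y = \<zero>\<^bsub>tensor_alg C D\<^esub>"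
    and "x \<in> carrier C \<Longrightarrow> pure_tensor C D x \<zero>\<^bsub>D\<^esub> = \<zero>\<^bsub>tensor_alg C D\<^esub>"
proof -
  interpret cplx_alg_pair C D by fact
  interpret TT: cplx_alg "tensor_alg C D" by (rule tensor_cplx_alg)
  show "pure_tensor C D \<zero>\<^bsub>C\<^esub> y = \<zero>\<^bsub>tensor_alg C D\<^esub>" if "y \<in> carrier D"
    using pure_tensor_add_left[OF A.zero_closed A.zero_closed that] pure_tensor_closed[OF A.zero_closed that]
    by (metis A.l_zero A.zero_closed TT.add.r_cancel_one')
  show "pure_tensor C D x \<zero>\<^bsub>D\<^esub> = \<zero>\<^bsub>tensor_alg C D\<^esub>" if "x \<in> carrier C"
    using pure_tensor_add_right[OF that B.zero_closed B.zero_closed] pure_tensor_closed[OF that B.zero_closed]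
    by (metis B.l_zero B.zero_closed TT.add.r_cancel_one')
qed

theorem theorem9:
  fixes m n :: nat and a b :: "complex fls"
    and \<Delta> :: "yangian \<Rightarrow> ((yangian \<times> yangian) \<Rightarrow>\<^sub>0 complex) set"
  assumes a: "fls_subdegree a = - int (2 * m)" "fls_nth a (- int (2 * m)) = 1"
    and b: "fls_subdegree b = - int (2 * n)" "fls_nth b (- int (2 * n)) = 1"
    and \<Delta>: "is_coproduct \<Delta>"
  shows "\<exists>\<Delta>'. \<Delta>' \<in> alg_hom (trunc_yangian (a * b)) (tensor_alg (trunc_yangian a) (trunc_yangian b)) \<and>
    (\<forall>x \<in> carrier yangian_alg. \<Delta>' (trunc_proj (a * b) x) =
       tensor_map (trunc_yangian a) (trunc_yangian b) (trunc_proj a) (trunc_proj b) (\<Delta> x))"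
proof -
  obtain k where k: "k $ 0 = 1" and a_eq: "a = fls_shift (2 * int m) (fps_to_fls k)"
    using a by (rule fls_eq_shift_fps)
  obtain l where l: "l $ 0 = 1" and b_eq: "b = fls_shift (2 * int n) (fps_to_fls l)"
    using b by (rule fls_eq_shift_fps)
  have kl: "(k * l) $ 0 = 1" and ab_eq: "a * b = fls_shift (2 * int (m + n)) (fps_to_fls (k * l))"
    using k l by (simp_all add: a_eq b_eq fls_shift_fps_mult distrib_left)
  obtain F where F: "is_A_fps (int m) k F" using k by (rule is_A_fps_exists)
  obtain G where G: "is_A_fps (int n) l G" using l by (rule is_A_fps_exists)
  obtain R where R: "is_A_fps (int (m + n)) (k * l) R" using kl by (rule is_A_fps_exists)

  interpret Ia: cplx_alg_ideal yangian_alg "trunc_ideal a" by (rule trunc_cplx_alg_ideal)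
  interpret Ib: cplx_alg_ideal yangian_alg "trunc_ideal b" by (rule trunc_cplx_alg_ideal)
  interpret Iab: cplx_alg_ideal yangian_alg "trunc_ideal (a * b)" by (rule trunc_cplx_alg_ideal)
  let ?Ya = "trunc_yangian a" and ?Yb = "trunc_yangian b"
  let ?T = "tensor_alg ?Ya ?Yb"
  have proj: "trunc_proj a \<in> alg_hom yangian_alg ?Ya" "trunc_proj b \<in> alg_hom yangian_alg ?Yb"
    using Ia.quot_proj Ib.quot_proj unfolding trunc_yangian_def trunc_proj_def by simp_all
  have pair: "cplx_alg_pair ?Ya ?Yb"
    unfolding trunc_yangian_def by (intro cplx_alg_pair.intro Ia.quot_cplx_alg Ib.quot_cplx_alg)
  have T: "cplx_alg ?T"
    by (rule cplx_alg_pair.tensor_cplx_alg [OF pair])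
  interpret T: cplx_alg ?T by (rule T)
  interpret hom: tensor_hom yangian_alg yangian_alg ?Ya ?Yb "trunc_proj a" "trunc_proj b"
    by (intro tensor_hom.intro tensor_hom_axioms.intro proj pair yangian_pair)
  let ?\<pi> = "tensor_map ?Ya ?Yb (trunc_proj a) (trunc_proj b)"
  note \<pi> = alg_homD[OF hom.tensor_map_hom]

  have \<Delta>_hom: "\<Delta> \<in> alg_hom yangian_alg YY_alg"
    and \<Delta>_gen: "\<Delta> (x_plus 0) = tens (x_plus 0) 1 \<oplus>\<^bsub>YY_alg\<^esub> tens 1 (x_plus 0)"
      "\<Delta> (x_minus 0) = tens (x_minus 0) 1 \<oplus>\<^bsub>YY_alg\<^esub> tens 1 (x_minus 0)"
      "\<Delta> (x_plus 1) = tens (x_plus 1) 1 \<oplus>\<^bsub>YY_alg\<^esub> tens 1 (x_plus 1) \<oplus>\<^bsub>YY_alg\<^esub> tens (h_gen 0) (x_plus 0)"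
    using \<Delta> unfolding is_coproduct_def Let_def by blast+

  \<comment> \<open>The kernel of the tensor product of the two projections, on the type-level
    tensor square.\<close>
  define N where "N = {s :: yy. ?\<pi> (Rep_yy s) = \<zero>\<^bsub>?T\<^esub>}"
  have N_add: "s + t \<in> N" if "s \<in> N" "t \<in> N" for s t
    using that ring_hom_add[OF \<pi>(1) Rep_yy Rep_yy, of s t] by (simp add: N_def plus_yy.rep_eq)
  have N_sum: "sum g I \<in> N" if "\<And>i. i \<in> I \<Longrightarrow> g i \<in> N" "finite I" "I \<noteq> {}" for g :: "nat \<Rightarrow> yy" and I
    using that(2,3,1) by (induction I rule: finite_ne_induct) (auto intro: N_add)
  have N_tens: "tens_yy x y \<in> N" if "x \<in> trunc_ideal a \<or> y \<in> trunc_ideal b" for x y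
  proof -
    have "?\<pi> (tens x y) = pure_tensor ?Ya ?Yb (trunc_proj a x) (trunc_proj b y)"
      by (rule hom.tensor_map_pure) (simp_all add: yangian_alg_simps)
    also have "\<dots> = \<zero>\<^bsub>?T\<^esub>"
      using that
    proof
      assume "x \<in> trunc_ideal a"
      then have "trunc_proj a x = \<zero>\<^bsub>?Ya\<^esub>"
        unfolding trunc_proj_def trunc_yangian_def Ia.quot_alg_simps by (rule Ia.a_rcos_const)
      moreover have "trunc_proj b y \<in> carrier ?Yb"
        using ring_hom_closed[OF alg_homD(1)[OF proj(2)]] by (simp add: yangian_alg_simps)
      ultimately show ?thesis by (simp add: pure_tensor_zero[OF pair])
    next
      assume "y \<in> trunc_ideal b"
      then have "trunc_proj b y = \<zero>\<^bsub>?Yb\<^esub>"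
        unfolding trunc_proj_def trunc_yangian_def Ib.quot_alg_simps by (rule Ib.a_rcos_const)
      moreover have "trunc_proj a x \<in> carrier ?Ya"
        using ring_hom_closed[OF alg_homD(1)[OF proj(1)]] by (simp add: yangian_alg_simps)
      ultimately show ?thesis by (simp add: pure_tensor_zero[OF pair])
    qed
    finally show ?thesis by (simp add: N_def tens_yy.rep_eq)
  qed

  have R_eq: "fps_map (\<lambda>x. Abs_yy (\<Delta> x)) R = fps_map (\<lambda>x. tens_yy x 1) F * fps_map (tens_yy 1) G
    + fps_map (\<lambda>x. tens_yy x 1) (commutator F (fps_const (x_minus 0))) * fps_map (tens_yy 1) (commutator (fps_const (x_plus 0)) G)"
  proof (rule coproduct_root[OF cplx_hom_Abs_yy[OF \<Delta>_hom] cplx_hom_left cplx_hom_right _ _ _ _ F G])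
    show "tens_yy 1 y * tens_yy x 1 = tens_yy x 1 * tens_yy 1 y" for x y
      by (simp add: tens_yy_simps)
    show "is_A_fps (int m + int n) (k * l) R" using R by simp
  qed (simp_all only: \<Delta>_gen Abs_yy_add Abs_yy_tens tens_closed YYT.a_closed tens_yy_simps mult_1_left mult_1_right)
  \<comment> \<open>Commutators with a constant series are taken coefficientwise, so they stay in
    the ideal at the same index.\<close>
  have F_ideal: "F $ p \<in> trunc_ideal a" "commutator F (fps_const (x_minus 0)) $ p \<in> trunc_ideal a" if "p > m" for p
  proof -
    show *: "F $ p \<in> trunc_ideal a"
      unfolding a_eq by (rule root_in_trunc_ideal[OF F k that])
    show "commutator F (fps_const (x_minus 0)) $ p \<in> trunc_ideal a"
      using trunc_ideal_commutator(1)[OF *] by simp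
  qed
  have G_ideal: "G $ p \<in> trunc_ideal b" "commutator (fps_const (x_plus 0)) G $ p \<in> trunc_ideal b" if "p > n" for p
  proof -
    show *: "G $ p \<in> trunc_ideal b"
      unfolding b_eq by (rule root_in_trunc_ideal[OF G l that])
    show "commutator (fps_const (x_plus 0)) G $ p \<in> trunc_ideal b"
      using trunc_ideal_commutator(2)[OF *] by simp
  qed
  have R_N: "Abs_yy (\<Delta> (R $ i)) \<in> N" if i: "i > m + n" for i
  proof -
    have sum: "(\<Sum>p=0..i. tens_yy (P $ p) (Q $ (i - p))) \<in> N"
      if P: "\<And>p. p > m \<Longrightarrow> P $ p \<in> trunc_ideal a" and Q: "\<And>p. p > n \<Longrightarrow> Q $ p \<in> trunc_ideal b" for P Q
    proof (rule N_sum)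
      fix p
      \<comment> \<open>The two indices add up to i > m + n, so one of them exceeds its bound and
        its tensor factor lies in the ideal.\<close>
      have "p > m \<or> i - p > n" using i by auto
      with P [of p] Q [of "i - p"] show "tens_yy (P $ p) (Q $ (i - p)) \<in> N"
        by (intro N_tens) auto
    qed auto
    have "Abs_yy (\<Delta> (R $ i)) = (\<Sum>p=0..i. tens_yy (F $ p) (G $ (i - p)))
      + (\<Sum>p=0..i. tens_yy (commutator F (fps_const (x_minus 0)) $ p) (commutator (fps_const (x_plus 0)) G $ (i - p)))"
      using arg_cong[OF R_eq, of "\<lambda>S. S $ i"] by (simp add: fps_mult_nth tens_yy_simps del: fps_sub_nth)
    also have "\<dots> \<in> N"
      by (rule N_add [OF sum [OF F_ideal(1) G_ideal(1)] sum [OF F_ideal(2) G_ideal(2)]])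
    finally show ?thesis .
  qed

  \<comment> \<open>This composite kills the coefficients generating the truncation ideal of
    \<open>a * b\<close>, hence the ideal, and so descends to the quotient.\<close>
  let ?f = "\<lambda>x. ?\<pi> (\<Delta> x)"
  have f: "?f \<in> alg_hom yangian_alg ?T"
    using \<Delta>_hom hom.tensor_map_hom by (rule alg_hom_compose)
  have f_zero: "?f x = \<zero>\<^bsub>?T\<^esub>" if "x \<in> trunc_ideal (a * b)" for x
  proof (rule alg_hom_genideal_eq_zero[OF yangian_cplx_alg T f _ _ that[unfolded trunc_ideal_def]])
    fix x assume "x \<in> {fls_nth (A_series (a * b)) i | i. i > 0}"
    then obtain i where i: "i > 0" "x = fls_nth (A_series (a * b)) i" by blast
    \<comment> \<open>The exponent i > 0 of z^-1 is offset by the leading power z^(m + n), which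
      gives an index above m + n.\<close>
    then have x: "x = R $ nat (i + int (m + n))"
      unfolding ab_eq A_series_eq[OF R kl] by simp
    have "Abs_yy (\<Delta> x) \<in> N"
      unfolding x using i(1) by (intro R_N) auto
    moreover have "\<Delta> x \<in> carrier YY_alg"
      using ring_hom_closed[OF alg_homD(1)[OF \<Delta>_hom]] by (simp add: yangian_alg_simps)
    ultimately show "?f x = \<zero>\<^bsub>?T\<^esub>"
      by (simp add: N_def Abs_yy_inverse)
  qed (simp add: yangian_alg_simps)
  obtain \<Delta>' where "\<Delta>' \<in> alg_hom (quot_alg yangian_alg (trunc_ideal (a * b))) ?T"
    "\<And>x. x \<in> carrier yangian_alg \<Longrightarrow> \<Delta>' (trunc_ideal (a * b) +>\<^bsub>yangian_alg\<^esub> x) = ?f x"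
    using Iab.quot_lift [OF T f f_zero] by blast
  then show ?thesis
    unfolding trunc_yangian_def [of "a * b"] trunc_proj_def [of "a * b"] by blast
qed

end
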